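(* Let $I\subseteq\mathbb{R}$ be an open interval and assume that $\Phi(u)=g(u,0,\varphi(u,0))$ changes sign at the isolated zeros $p_1,\ldots,p_n\in I$. For $i=1,\ldots,n$, put $P_i=\big(p_i,0,\varphi(p_i,0),\ldots,\varphi(p_i,0)\big)\in\mathbb{R}^{b+2}$. Assume that $g$ and $\varphi$ are such that $G$ is Lipschitz with constant $L$ on a neighborhood of $\{P_1,\ldots,P_n\}$, and that the period $T$ of $f$ satisfies $T<2\pi/L$. Consider the equation $$(\ast)\qquad \ddot x(t)=g\Big(x(t),\dot x(t),\int_{-\infty}^t\gamma_a^b(t-s)\,\varphi(x(s),\dot x(s))\,ds\Big)+\lambda f\big(t,x(t),\dot x(t)\big).$$ Then: (1) For $i=1,\ldots,n$, there exist connected sets $\Gamma_i$ of nontrivial $T$-forced pairs of $(\ast)$ emanating from $(0,\overline{p_i})$. (2) There exists $\lambda_*>0$ such that the projection of each $\Gamma_i$ on the first component contains $[0,\lambda_*]$. Consequently, $(\ast)$ has at least $n$ solutions $x_1^\lambda,\ldots,x_n^\lambda$ of period $T$ for $\lambda\in[0,\lambda_* )$. (3) The images of $x_1^\lambda,\ldots,x_n^\lambda$ are pairwise disjoint.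
   Context: Let $a>0$, $b\in\mathbb{N}\setminus\{0\}$, $T>0$. Let $g\colon\mathbb{R}^3\to\mathbb{R}$ be continuous, $\varphi\colon\mathbb{R}^2\to\mathbb{R}$ locally Lipschitz, and $f\colon\mathbb{R}^3\to\mathbb{R}$ continuous and $T$-periodic in its first variable; $\lambda\ge0$ is a parameter. The gamma probability density $\gamma_a^b$ is $$\gamma_a^b(s)=\frac{a^b s^{b-1}e^{-as}}{(b-1)!}\ \text{ for } s\ge 0,\qquad \gamma_a^b(s)=0\ \text{ for } s<0.$$ The map $G\colon\mathbb{R}^{b+2}\to\mathbb{R}^{b+2}$ is $$G(u,v_0,v_1,\ldots,v_b)=\big(v_0,\;g(u,v_0,v_b),\;a(\varphi(u,v_0)-v_1),\;a(v_1-v_2),\ldots,a(v_{b-1}-v_b)\big);$$ Lipschitz constants are with respect to the Euclidean norm. $C^1_T(\mathbb{R})$ is the Banach space of $T$-periodic $C^1$ functions $x\colon\mathbb{R}\to\mathbb{R}$ with norm $\max|x|+\max|\dot x|$. For $u\in\mathbb{R}$, $\overline{u}$ denotes the constant function $t\mapsto u$. A $T$-periodic solution of $(\ast)$ (for a given $\lambda\ge0$) is a $C^2$ function $x\colon\mathbb{R}\to\mathbb{R}$ of period $T$ satisfying it identically on $\mathbb{R}$. A $T$-forced pair is a pair $(\lambda,x)\in[0,\infty)\times C^1_T(\mathbb{R})$ with $x$ a $T$-periodic solution of $(\ast)$ corresponding to $\lambda$. A $T$-forced pair is trivial if it is of the form $(0,x)$ with $x$ constant, and nontrivial otherwise. A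 set $\Gamma_i$ of $T$-forced pairs emanates from $(0,\overline{p_i})$ if $(0,\overline{p_i})$ belongs to the closure of $\Gamma_i$ in $[0,\infty)\times C^1_T(\mathbb{R})$. $\Phi$ changes sign at an isolated zero $p$ if $\Phi$ has opposite (strict) signs immediately to the left and to the right of $p$.
   Formalization: In (2) the projection of Γ_i together with its emanation point (0, p_i) contains [0,λ_*], i.e. Γ_i itself covers (0,λ_*]; as written the claim fails at λ=0 (e.g. g=u, φ=0, f=1, a=b=L=T=1: no nontrivial pair has λ=0). *)

theory Defs
  imports "HOL-Probability.Probability"
begin

subsection \<open>The Banach space of periodic continuously differentiable functions\<close>

definition C1_per :: "real \<Rightarrow> (real \<Rightarrow> real) set" where
  "C1_per T = {x. x C1_differentiable_on UNIV \<and> (\<forall>t. x (t + T) = x t)}"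

definition C1_norm :: "(real \<Rightarrow> real) \<Rightarrow> real" where
  "C1_norm x = (SUP t. \<bar>x t\<bar>) + (SUP t. \<bar>deriv x t\<bar>)"

text \<open>
  The value 0 off the carrier is a dummy: the locale \<^locale>\<open>Metric_space\<close> asks for
  nonnegativity and symmetry on the whole type, and the suprema are only meaningful for
  bounded functions.
\<close>
definition C1_dist :: "real \<Rightarrow> (real \<Rightarrow> real) \<Rightarrow> (real \<Rightarrow> real) \<Rightarrow> real" where
  "C1_dist T x y = (if x \<in> C1_per T \<and> y \<in> C1_per T then C1_norm (\<lambda>t. x t - y t) else 0)"

definition C1_topology :: "real \<Rightarrow> (real \<Rightarrow> real) topology" where
  "C1_topology T = Metric_space.mtopology (C1_per T) (C1_dist T)"

definition pair_topology :: "real \<Rightarrow> (real \<times> (real \<Rightarrow> real)) topology" where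
  "pair_topology T = prod_topology (top_of_set {0..}) (C1_topology T)"

lemma C1_has_deriv:
  fixes x :: "real \<Rightarrow> real"
  assumes "x C1_differentiable_on UNIV"
  shows "(x has_real_derivative deriv x t) (at t)" and "continuous_on UNIV (deriv x)"
proof -
  obtain D where D: "\<And>t. (x has_vector_derivative D t) (at t)" "continuous_on UNIV D"
    using assms by (auto simp: C1_differentiable_on_def)
  have *: "deriv x t = D t" for t
    using D(1)[of t] by (intro DERIV_imp_deriv) (simp add: has_real_derivative_iff_has_vector_derivative)
  show "(x has_real_derivative deriv x t) (at t)"
    using D(1)[of t] * by (simp add: has_real_derivative_iff_has_vector_derivative)
  show "continuous_on UNIV (deriv x)"
    using D(2) * by (simp add: continuous_on_eq)
qed

lemma periodic_continuous_bounded: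
  fixes x :: "real \<Rightarrow> real"
  assumes "T > 0" "continuous_on UNIV x" "\<And>t. x (t + T) = x t"
  shows "bdd_above (range (\<lambda>t. \<bar>x t\<bar>))"
proof -
  interpret periodic_fun_simple x T
    by unfold_locales (use assms in auto)
  have "compact ((\<lambda>t. \<bar>x t\<bar>) ` {0..T})"
    by (intro compact_continuous_image continuous_intros continuous_on_subset[OF assms(2)]) auto
  then obtain B where B: "\<And>t. t \<in> {0..T} \<Longrightarrow> \<bar>x t\<bar> \<le> B"
    by (meson bdd_above.E bounded_imp_bdd_above compact_imp_bounded imageI)
  have "\<bar>x t\<bar> \<le> B" for t
  proof -
    define k where "k = \<lfloor>t / T\<rfloor>"
    have "of_int k \<le> t / T" "t / T < of_int k + 1"
      unfolding k_def by linarith+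
    then have "of_int k * T \<le> t" "t < (of_int k + 1) * T"
      using assms(1) by (simp_all add: field_simps)
    then have "t - of_int k * T \<in> {0..T}"
      by (simp add: algebra_simps)
    then show ?thesis
      using B[of "t - of_int k * T"] minus_of_int[of t k] by simp
  qed
  then show ?thesis by (auto intro!: bdd_aboveI)
qed

lemma deriv_periodic:
  fixes x :: "real \<Rightarrow> real"
  assumes "x C1_differentiable_on UNIV" "\<And>t. x (t + T) = x t"
  shows "deriv x (t + T) = deriv x t"
proof -
  have "((\<lambda>t. x (t + T)) has_real_derivative deriv x (t + T)) (at t)"
    using C1_has_deriv(1)[OF assms(1), of "t + T"] by (simp add: DERIV_shift)
  then show ?thesis
    using assms(2) by (simp add: DERIV_imp_deriv)
qed

lemma C1_per_diff:
  assumes "x \<in> C1_per T" "y \<in> C1_per T"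
  shows "(\<lambda>t. x t - y t) \<in> C1_per T"
  using assms by (auto simp: C1_per_def)

lemma C1_per_bdd:
  assumes "T > 0" "x \<in> C1_per T"
  shows "bdd_above (range (\<lambda>t. \<bar>x t\<bar>))" "bdd_above (range (\<lambda>t. \<bar>deriv x t\<bar>))"
proof -
  have x: "x C1_differentiable_on UNIV" "\<And>t. x (t + T) = x t"
    using assms(2) by (auto simp: C1_per_def)
  have cont: "continuous_on UNIV x"
    using C1_has_deriv(1)[OF x(1)] by (meson DERIV_isCont continuous_at_imp_continuous_on)
  show "bdd_above (range (\<lambda>t. \<bar>x t\<bar>))"
    by (rule periodic_continuous_bounded[OF assms(1) cont x(2)])
  show "bdd_above (range (\<lambda>t. \<bar>deriv x t\<bar>))"
    by (rule periodic_continuous_bounded[OF assms(1) C1_has_deriv(2)[OF x(1)] deriv_periodic[OF x]])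
qed

lemma deriv_C1_diff:
  assumes "x \<in> C1_per T" "y \<in> C1_per T"
  shows "deriv (\<lambda>t. x t - y t) t = deriv x t - deriv y t"
proof -
  have "x C1_differentiable_on UNIV" "y C1_differentiable_on UNIV"
    using assms by (auto simp: C1_per_def)
  then show ?thesis
    by (intro DERIV_imp_deriv DERIV_diff C1_has_deriv)
qed

lemma Metric_space_C1:
  assumes "T > 0"
  shows "Metric_space (C1_per T) (C1_dist T)"
proof
  have bdd: "bdd_above (range (\<lambda>t. \<bar>x t - y t\<bar>))"
            "bdd_above (range (\<lambda>t. \<bar>deriv x t - deriv y t\<bar>))"
    if "x \<in> C1_per T" "y \<in> C1_per T" for x y
    using C1_per_bdd[OF assms C1_per_diff[OF that]] deriv_C1_diff[OF that] by simp_all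
  have D: "C1_dist T x y = (SUP t. \<bar>x t - y t\<bar>) + (SUP t. \<bar>deriv x t - deriv y t\<bar>)"
    if "x \<in> C1_per T" "y \<in> C1_per T" for x y
    using that deriv_C1_diff[OF that] by (simp add: C1_dist_def C1_norm_def)
  have sup_nonneg: "0 \<le> (SUP t. \<bar>u t\<bar>)" if "bdd_above (range (\<lambda>t. \<bar>u t\<bar>))"
    for u :: "real \<Rightarrow> real"
    using cSUP_upper[OF UNIV_I that, of 0] by (meson abs_ge_zero order_trans)
  have sup_tri: "(SUP t. \<bar>u t - w t\<bar>) \<le> (SUP t. \<bar>u t - v t\<bar>) + (SUP t. \<bar>v t - w t\<bar>)"
    if "bdd_above (range (\<lambda>t. \<bar>u t - v t\<bar>))" "bdd_above (range (\<lambda>t. \<bar>v t - w t\<bar>))"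
    for u v w :: "real \<Rightarrow> real"
  proof (rule cSUP_least)
    fix t
    show "\<bar>u t - w t\<bar> \<le> (SUP t. \<bar>u t - v t\<bar>) + (SUP t. \<bar>v t - w t\<bar>)"
      using cSUP_upper[OF UNIV_I that(1), of t] cSUP_upper[OF UNIV_I that(2), of t] by linarith
  qed simp
  fix x y z
  show nn: "0 \<le> C1_dist T x y"
  proof (cases "x \<in> C1_per T \<and> y \<in> C1_per T")
    case True
    then show ?thesis
      using D[of x y] sup_nonneg[OF bdd(1)[of x y]] sup_nonneg[OF bdd(2)[of x y]] by simp
  next
    case False
    then show ?thesis by (auto simp: C1_dist_def)
  qed
  show "C1_dist T x y = C1_dist T y x"
  proof (cases "x \<in> C1_per T \<and> y \<in> C1_per T")
    case True
    then show ?thesis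
      using D[of x y] D[of y x] by (simp add: abs_minus_commute)
  next
    case False
    then show ?thesis by (auto simp: C1_dist_def)
  qed
  assume x: "x \<in> C1_per T" and y: "y \<in> C1_per T"
  show "C1_dist T x y = 0 \<longleftrightarrow> x = y"
  proof
    assume "C1_dist T x y = 0"
    then have 0: "(SUP t. \<bar>x t - y t\<bar>) = 0"
      using D[OF x y] sup_nonneg[OF bdd(1)[OF x y]] sup_nonneg[OF bdd(2)[OF x y]] by linarith
    show "x = y"
    proof
      fix t
      show "x t = y t"
        using cSUP_upper[OF UNIV_I bdd(1)[OF x y], of t] 0 by simp
    qed
  qed (use D[OF x y] in simp)
  assume z: "z \<in> C1_per T"
  show "C1_dist T x z \<le> C1_dist T x y + C1_dist T y z"
    using sup_tri[OF bdd(1)[OF x y] bdd(1)[OF y z]] sup_tri[OF bdd(2)[OF x y] bdd(2)[OF y z]]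
    by (simp add: D x y z)
qed

subsection \<open>The equation and its periodic solutions\<close>

definition gamma_density :: "real \<Rightarrow> nat \<Rightarrow> real \<Rightarrow> real" where
  "gamma_density a b = erlang_density (b - 1) a"

lemma gamma_density_eq:
  assumes "b \<ge> 1"
  shows "gamma_density a b s =
    (if s \<ge> 0 then a ^ b * s ^ (b - 1) * exp (- a * s) / fact (b - 1) else 0)"
  using assms by (simp add: gamma_density_def erlang_density_def)

definition C2_fun :: "(real \<Rightarrow> real) \<Rightarrow> bool" where
  "C2_fun x \<longleftrightarrow> x C1_differentiable_on UNIV \<and> deriv x C1_differentiable_on UNIV"

definition periodic_solution ::
  "real \<Rightarrow> nat \<Rightarrow> real \<Rightarrow> (real \<times> real \<times> real \<Rightarrow> real) \<Rightarrow> (real \<times> real \<Rightarrow> real) \<Rightarrow>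
   (real \<times> real \<times> real \<Rightarrow> real) \<Rightarrow> real \<Rightarrow> (real \<Rightarrow> real) \<Rightarrow> bool" where
  "periodic_solution a b T g \<phi> f \<mu> x \<longleftrightarrow>
     C2_fun x \<and> (\<forall>t. x (t + T) = x t) \<and>
     (\<forall>t. deriv (deriv x) t =
        g (x t, deriv x t,
           LINT s:{..t}|lborel. gamma_density a b (t - s) * \<phi> (x s, deriv x s))
        + \<mu> * f (t, x t, deriv x t))"

definition forced_pairs ::
  "real \<Rightarrow> nat \<Rightarrow> real \<Rightarrow> (real \<times> real \<times> real \<Rightarrow> real) \<Rightarrow> (real \<times> real \<Rightarrow> real) \<Rightarrow>
   (real \<times> real \<times> real \<Rightarrow> real) \<Rightarrow> (real \<times> (real \<Rightarrow> real)) set" where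
  "forced_pairs a b T g \<phi> f =
     {(\<mu>, x). \<mu> \<ge> 0 \<and> x \<in> C1_per T \<and> periodic_solution a b T g \<phi> f \<mu> x}"

definition trivial_pair :: "real \<times> (real \<Rightarrow> real) \<Rightarrow> bool" where
  "trivial_pair q \<longleftrightarrow> (\<exists>c. q = (0, \<lambda>_. c))"

definition emanates_from ::
  "real \<Rightarrow> (real \<times> (real \<Rightarrow> real)) set \<Rightarrow> real \<times> (real \<Rightarrow> real) \<Rightarrow> bool" where
  "emanates_from T \<Gamma> q \<longleftrightarrow> q \<in> pair_topology T closure_of \<Gamma>"

subsection \<open>Hypotheses on the nonlinearities\<close>

definition locally_lipschitz :: "('a::metric_space \<Rightarrow> 'b::metric_space) \<Rightarrow> bool" where
  "locally_lipschitz h \<longleftrightarrow> (\<forall>z. \<exists>r>0. \<exists>C. C-lipschitz_on (ball z r) h)"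

definition isolated_zero :: "(real \<Rightarrow> real) \<Rightarrow> real \<Rightarrow> bool" where
  "isolated_zero F p \<longleftrightarrow> F p = 0 \<and> (\<forall>\<^sub>F u in at p. F u \<noteq> 0)"

definition changes_sign_at :: "(real \<Rightarrow> real) \<Rightarrow> real \<Rightarrow> bool" where
  "changes_sign_at F p \<longleftrightarrow>
     (\<forall>\<^sub>F u in at_left p. F u < 0) \<and> (\<forall>\<^sub>F u in at_right p. F u > 0) \<or>
     (\<forall>\<^sub>F u in at_left p. F u > 0) \<and> (\<forall>\<^sub>F u in at_right p. F u < 0)"

text \<open>
  As in \<^const>\<open>Euclidean_space\<close>, a point of $m$-dimensional space is a sequence vanishing from
  index $m$ on. With $m = b + 2$, the point $(u, v_0, v_1, \ldots, v_b)$ has $u$ at index 0 and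
  $v_k$ at index $k + 1$. The metric of the type class on functions is not the Euclidean one,
  hence the Lipschitz condition is written out with \<^const>\<open>L2_set\<close>.
\<close>
definition euclidean_lipschitz_on ::
  "nat \<Rightarrow> real \<Rightarrow> (nat \<Rightarrow> real) set \<Rightarrow> ((nat \<Rightarrow> real) \<Rightarrow> (nat \<Rightarrow> real)) \<Rightarrow> bool" where
  "euclidean_lipschitz_on m L U H \<longleftrightarrow> 0 \<le> L \<and>
     (\<forall>w\<in>U. \<forall>z\<in>U. L2_set (\<lambda>k. H w k - H z k) {..<m} \<le> L * L2_set (\<lambda>k. w k - z k) {..<m})"

definition G_map ::
  "real \<Rightarrow> nat \<Rightarrow> (real \<times> real \<times> real \<Rightarrow> real) \<Rightarrow> (real \<times> real \<Rightarrow> real) \<Rightarrow>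
   (nat \<Rightarrow> real) \<Rightarrow> (nat \<Rightarrow> real)" where
  "G_map a b g \<phi> w = (\<lambda>k.
     if k = 0 then w 1
     else if k = 1 then g (w 0, w 1, w (b + 1))
     else if k = 2 then a * (\<phi> (w 0, w 1) - w 2)
     else if k < b + 2 then a * (w (k - 1) - w k)
     else 0)"

definition P_point :: "nat \<Rightarrow> (real \<times> real \<Rightarrow> real) \<Rightarrow> real \<Rightarrow> (nat \<Rightarrow> real)" where
  "P_point b \<phi> p = (\<lambda>k.
     if k = 0 then p else if k = 1 then 0 else if k < b + 2 then \<phi> (p, 0) else 0)"

definition Phi :: "(real \<times> real \<times> real \<Rightarrow> real) \<Rightarrow> (real \<times> real \<Rightarrow> real) \<Rightarrow> real \<Rightarrow> real" where
  "Phi g \<phi> u = g (u, 0, \<phi> (u, 0))"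

end

theory Submission
  imports Defs "HOL-Complex_Analysis.Great_Picard"
begin

text \<open>
  By the linear chain trick the integral term is the last of the \<open>b\<close> components \<open>v\<^sub>1, \<dots>, v\<^sub>b\<close> of a
  linear cascade driven by \<open>\<phi>(x, x')\<close>, so the equation becomes \<open>w' = G(w) + \<lambda> f e\<^sub>1\<close> in \<open>b + 2\<close> unknowns.
  Its periodic solutions are fixed points of a compact operator (zero-mean primitive of the right-hand side plus
  prescribed means), in which only the mean of \<open>x\<close> is a genuine bifurcation unknown. Near \<open>P\<^sub>i\<close> the field
  is \<open>L\<close>-Lipschitz and \<open>L T < 2 \<pi>\<close>, so Wirtinger's inequality forces every periodic solution to be within
  \<open>O(\<lambda>)\<close> of its mean; hence the mean equation is close to \<open>\<Phi>(u) = 0\<close>, whose change of sign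
  isolates the solutions from the boundary of a small interval around \<open>p\<^sub>i\<close>.

  No degree theory is needed for the connected branch. If the compact solution set could be separated
  between \<open>\<lambda> = 0\<close> and \<open>\<lambda> = \<lambda>\<^sub>*\<close>, treating \<open>\<lambda>\<close> as one more unknown that drifts towards the wrong end on
  each part would give a compact map without fixed points, against Schauder's theorem. Boundary
  bumping then removes the trivial pair from the resulting continuum.
\<close>

subsection \<open>Schauder's fixed point theorem\<close>

text \<open>The dimension \<open>b + 2\<close> is a variable and not a type, so a trajectory is
  encoded as one bounded continuous function on \<open>real \<times> nat\<close> that vanishes from
  component \<open>b + 2\<close> on. In its uniform norm, bounded sets of equi-Lipschitz periodic
  trajectories are relatively compact, as Schauder's theorem asks. Two obstacles shape the operator.
  The field is controlled only near the equilibrium, so it is multiplied by a cutoff; this depends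
  on the trajectory as a whole and not on the time, hence it commutes with averaging over a period.
  And a periodic primitive exists only for a field of mean zero, so the mean is subtracted and fed
  back into the mean of \<open>x\<close>, truncated to [p - \<delta>, p + \<delta>]. A sign \<sigma>
  orients the feedback towards p; a fixed point at which the subtracted mean is not zero would sit
  at an end of the interval, where the sign of \<Phi> contradicts it. The bound 2 pi is the sharp
  constant of Wirtinger's inequality for periodic functions; the strict inequality leaves room for
  separating the forcing from the Lipschitz part.\<close>

lemma compact_Hilbert_cube: "compact {z::nat \<Rightarrow> real. \<forall>i. 0 \<le> z i \<and> z i \<le> 1}"
proof -
  have "{z::nat \<Rightarrow> real. \<forall>i. 0 \<le> z i \<and> z i \<le> 1} = PiE UNIV (\<lambda>_. {0..1})"
    by auto
  moreover have "compactin (product_topology (\<lambda>_::nat. euclideanreal) UNIV) (PiE UNIV (\<lambda>_. {0..1}))"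
    unfolding compactin_PiE by auto
  ultimately show ?thesis
    by (simp add: euclidean_product_topology)
qed

lemma tendsto_fun_iff:
  fixes l :: "'b \<Rightarrow> real"
  shows "(f \<longlongrightarrow> l) F \<longleftrightarrow> (\<forall>i. ((\<lambda>x. f x i) \<longlongrightarrow> l i) F)"
  using limitin_componentwise[of "\<lambda>_. euclideanreal" UNIV f l F]
  by (simp add: euclidean_product_topology)

text \<open>Kuhn's combinatorial lemma plus compactness: on ever finer grids it finds a small cell
  in which every coordinate is pushed up at one vertex and down at another, and a limit of such
  cells is fixed. The dimension \<open>n\<close> will be the size of a finite net, so the cube
  consists of sequences; grid points are padded with 0, and nothing is claimed about
  \<open>F z i\<close> for \<open>i \<ge> n\<close>.\<close>

lemma brouwer_cube:
  fixes F :: "(nat \<Rightarrow> real) \<Rightarrow> nat \<Rightarrow> real"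
  assumes cont: "\<And>i. i < n \<Longrightarrow> continuous_on {z. \<forall>i. 0 \<le> z i \<and> z i \<le> 1} (\<lambda>z. F z i)"
    and self: "\<And>z i. i < n \<Longrightarrow> \<forall>i. 0 \<le> z i \<and> z i \<le> 1 \<Longrightarrow> 0 \<le> F z i \<and> F z i \<le> 1"
  obtains z where "\<forall>i. 0 \<le> z i \<and> z i \<le> 1" "\<forall>i<n. F z i = z i"
proof -
  define Q where "Q = {z::nat \<Rightarrow> real. \<forall>i. 0 \<le> z i \<and> z i \<le> 1}"
  define pt where "pt p x = (\<lambda>j. if j < n then real (x j) / real p else 0)" for p and x :: "nat \<Rightarrow> nat"
  have ptQ: "pt p x \<in> Q" if "\<forall>i<n. x i \<le> p" for p x
    using that unfolding Q_def pt_def by (auto simp: divide_le_eq_1)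
  have step: "\<exists>q. \<forall>i<n. \<exists>r s. r \<in> Q \<and> s \<in> Q \<and> (\<forall>j. \<bar>r j - q j\<bar> \<le> 1 / real (Suc k)) \<and>
      (\<forall>j. \<bar>s j - q j\<bar> \<le> 1 / real (Suc k)) \<and> q \<in> Q \<and> F r i \<ge> r i \<and> F s i \<le> s i" for k
  proof -
    define p where "p = Suc k"
    \<comment> \<open>Kuhn's lemma requires label 0 on the face \<open>x i = 0\<close> and label 1
      on the face \<open>x i = p\<close>. Both agree with the direction in which \<open>F\<close>
      moves the point, since \<open>F\<close> takes values in [0, 1].\<close>
    define label where "label x i = (if x i = 0 \<or> (x i \<noteq> p \<and> F (pt p x) i \<ge> pt p x i) then 0 else 1::nat)" for x i
    have p: "p > 0" by (simp add: p_def)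
    obtain q where q: "\<forall>i<n. q i < p"
      and rs: "\<forall>i<n. \<exists>r s. (\<forall>j<n. q j \<le> r j \<and> r j \<le> q j + 1) \<and>
                 (\<forall>j<n. q j \<le> s j \<and> s j \<le> q j + 1) \<and> label r i \<noteq> label s i"
      by (rule kuhn_lemma[of p n label]) (use p in \<open>auto simp: label_def\<close>)
    have l0: "F (pt p x) i \<ge> pt p x i" if "label x i = 0" "\<forall>i<n. x i \<le> p" "i < n" for x i
      using that self[OF \<open>i < n\<close>, of "pt p x"] ptQ[of x p]
      by (auto simp: label_def pt_def Q_def split: if_splits)
    have l1: "F (pt p x) i \<le> pt p x i" if "label x i \<noteq> 0" "\<forall>i<n. x i \<le> p" "i < n" for x i
      using that self[OF \<open>i < n\<close>, of "pt p x"] ptQ[of x p] p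
      by (auto simp: label_def pt_def Q_def split: if_splits)
    have near: "\<forall>j. \<bar>pt p x j - pt p q j\<bar> \<le> 1 / real (Suc k)" if "\<forall>j<n. q j \<le> x j \<and> x j \<le> q j + 1" for x
    proof
      fix j
      have "\<bar>real (x j) - real (q j)\<bar> \<le> 1" if "j < n"
        using \<open>\<forall>j<n. q j \<le> x j \<and> x j \<le> q j + 1\<close> that by fastforce
      then show "\<bar>pt p x j - pt p q j\<bar> \<le> 1 / real (Suc k)"
        by (simp add: pt_def p_def divide_right_mono flip: diff_divide_distrib)
    qed
    have le: "\<forall>i<n. x i \<le> p" if "\<forall>j<n. q j \<le> x j \<and> x j \<le> q j + 1" for x
      using that q by fastforce
    have "\<exists>r s. r \<in> Q \<and> s \<in> Q \<and> (\<forall>j. \<bar>r j - pt p q j\<bar> \<le> 1 / real (Suc k)) \<and>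
      (\<forall>j. \<bar>s j - pt p q j\<bar> \<le> 1 / real (Suc k)) \<and> pt p q \<in> Q \<and> F r i \<ge> r i \<and> F s i \<le> s i" if i: "i < n" for i
    proof -
      obtain r s where r: "\<forall>j<n. q j \<le> r j \<and> r j \<le> q j + 1" and s: "\<forall>j<n. q j \<le> s j \<and> s j \<le> q j + 1"
        and ne: "label r i \<noteq> label s i"
        using rs i by blast
      have qQ: "pt p q \<in> Q" using q by (intro ptQ) auto
      note facts = le[OF r] le[OF s] near[OF r] near[OF s] ptQ[OF le[OF r]] ptQ[OF le[OF s]] qQ
      show ?thesis
      proof (cases "label r i = 0")
        case True
        then have "label s i \<noteq> 0" using ne by simp
        then show ?thesis using l0[OF True _ i] l1[OF _ _ i, of s] facts by blast
      next
        case False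
        then have "label s i = 0" using ne by (auto simp: label_def split: if_splits)
        then show ?thesis using l1[OF False _ i] l0[OF _ _ i, of s] facts by blast
      qed
    qed
    then show ?thesis by blast
  qed
  then obtain q where q: "\<And>k. \<forall>i<n. \<exists>r s. r \<in> Q \<and> s \<in> Q \<and> (\<forall>j. \<bar>r j - q k j\<bar> \<le> 1 / real (Suc k)) \<and>
      (\<forall>j. \<bar>s j - q k j\<bar> \<le> 1 / real (Suc k)) \<and> q k \<in> Q \<and> F r i \<ge> r i \<and> F s i \<le> s i"
    by metis
  \<comment> \<open>For \<open>n = 0\<close> the property of \<open>q k\<close> is vacuous and does
    not even place it in \<open>Q\<close>, hence the case distinction.\<close>
  show ?thesis
  proof (cases "n = 0")
    case True
    then show ?thesis using that[of "\<lambda>_. 0"] by simp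
  next
    case False
    then have "\<And>k. q k \<in> Q" using q by blast
    moreover have "seq_compact Q"
      using compact_Hilbert_cube unfolding Q_def by (simp add: compact_eq_seq_compact_metric)
    ultimately obtain z \<rho> where z: "z \<in> Q" and \<rho>: "strict_mono (\<rho>::nat\<Rightarrow>nat)" and lim: "(q \<circ> \<rho>) \<longlonglongrightarrow> z"
      by (blast elim: seq_compactE)
    have limj: "(\<lambda>k. q (\<rho> k) j) \<longlonglongrightarrow> z j" for j
      using lim by (simp add: tendsto_fun_iff o_def)
    have inv: "(\<lambda>k. 1 / real (Suc (\<rho> k))) \<longlonglongrightarrow> 0"
      using LIMSEQ_subseq_LIMSEQ[OF lim_inverse_n' [THEN LIMSEQ_Suc] \<rho>] by (simp add: o_def)
    have conv: "r \<longlonglongrightarrow> z" if "\<And>k j. \<bar>r k j - q (\<rho> k) j\<bar> \<le> 1 / real (Suc (\<rho> k))" for r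
    proof (subst tendsto_fun_iff, rule allI)
      fix j
      have "(\<lambda>k. r k j - q (\<rho> k) j) \<longlonglongrightarrow> 0"
        by (rule Lim_null_comparison[OF _ inv]) (use that in auto)
      from tendsto_add[OF this limj[of j]] show "(\<lambda>k. r k j) \<longlonglongrightarrow> z j" by simp
    qed
    have "F z i = z i" if i: "i < n" for i
    proof -
      have "\<forall>k. \<exists>r s. r \<in> Q \<and> s \<in> Q \<and> (\<forall>j. \<bar>r j - q (\<rho> k) j\<bar> \<le> 1 / real (Suc (\<rho> k))) \<and>
      (\<forall>j. \<bar>s j - q (\<rho> k) j\<bar> \<le> 1 / real (Suc (\<rho> k))) \<and> F r i \<ge> r i \<and> F s i \<le> s i"
        using q i by blast
      then obtain r s where r: "\<And>k. r k \<in> Q" "\<And>k j. \<bar>r k j - q (\<rho> k) j\<bar> \<le> 1 / real (Suc (\<rho> k))" "\<And>k. F (r k) i \<ge> r k i"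
        and s: "\<And>k. s k \<in> Q" "\<And>k j. \<bar>s k j - q (\<rho> k) j\<bar> \<le> 1 / real (Suc (\<rho> k))" "\<And>k. F (s k) i \<le> s k i"
        by metis
      have lr: "r \<longlonglongrightarrow> z" "s \<longlonglongrightarrow> z" using conv r s by auto
      have lF: "(\<lambda>k. F (r k) i) \<longlonglongrightarrow> F z i" "(\<lambda>k. F (s k) i) \<longlonglongrightarrow> F z i"
        using continuous_on_tendsto_compose[OF cont[OF i, folded Q_def] lr(1) z] r(1)
          continuous_on_tendsto_compose[OF cont[OF i, folded Q_def] lr(2) z] s(1) by auto
      have lc: "(\<lambda>k. r k i) \<longlonglongrightarrow> z i" "(\<lambda>k. s k i) \<longlonglongrightarrow> z i"
        using lr by (simp_all add: tendsto_fun_iff)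
      have "z i \<le> F z i" using LIMSEQ_le[OF lc(1) lF(1)] r(3) by auto
      moreover have "F z i \<le> z i" using LIMSEQ_le[OF lF(2) lc(2)] s(3) by auto
      ultimately show ?thesis by simp
    qed
    then show ?thesis using that[of z] z unfolding Q_def by simp
  qed
qed

text \<open>The Schauder projection onto a finite net of mesh e yields a point moved by at most e;
  the displacement attains its minimum on the compact set, and this minimum is then 0. Brouwer is
  applied to the weights attached to the net points, not to points of \<open>S\<close>.\<close>

theorem schauder:
  fixes f :: "'a::real_normed_vector \<Rightarrow> 'a"
  assumes "compact S" "convex S" "S \<noteq> {}" and cont: "continuous_on S f" and self: "f ` S \<subseteq> S"
  obtains x where "x \<in> S" "f x = x"
proof -
  have approx: "\<exists>y\<in>S. dist (f y) y \<le> e" if e: "e > 0" for e :: real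
  proof -
    obtain K where K: "finite K" "K \<subseteq> S" "S \<subseteq> (\<Union>x\<in>K. ball x e)"
      using seq_compact_imp_totally_bounded[of S] \<open>compact S\<close> e unfolding compact_eq_seq_compact_metric by metis
    obtain x n where xn: "K = x ` {i. i < (n::nat)}"
      using finite_imp_nat_seg_image_inj_on[OF K(1)] by metis
    have n: "n > 0" using K(3) \<open>S \<noteq> {}\<close> unfolding xn by (cases n) auto
    have xS: "i < n \<Longrightarrow> x i \<in> S" for i using K(2) xn by auto
    define Q where "Q = {z::nat \<Rightarrow> real. \<forall>i. 0 \<le> z i \<and> z i \<le> 1}"
    define s where "s z = (\<Sum>i<n. z i)" for z :: "nat \<Rightarrow> real"
    \<comment> \<open>Turns any point of the cube into convex weights: a deficit of total mass goes
      to index 0, an excess is divided out. Points of total mass 1 are left alone, and the fixed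
      point below is one of them.\<close>
    define u where "u z i = (z i + (if i = 0 then max 0 (1 - s z) else 0)) / max 1 (s z)" for z i
    define y where "y z = (\<Sum>i<n. u z i *\<^sub>R x i)" for z
    define w where "w v i = max 0 (e - dist v (x i))" for v i
    define W where "W v = (\<Sum>i<n. w v i)" for v
    have sum_u: "(\<Sum>i<n. u z i) = 1" for z
    proof -
      have "(\<Sum>i<n. u z i) = (s z + max 0 (1 - s z)) / max 1 (s z)"
        using n by (simp add: u_def sum_divide_distrib[symmetric] sum.distrib s_def)
      then show ?thesis by (auto simp: max_def)
    qed
    have yS: "y z \<in> S" if "z \<in> Q" for z
      unfolding y_def
      by (rule convex_sum) (use that \<open>convex S\<close> sum_u xS in \<open>auto simp: u_def Q_def\<close>)
    have w0: "w v i \<ge> 0" for v i by (simp add: w_def)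
    have W: "W v > 0" if vS: "v \<in> S" for v
    proof -
      obtain i where i: "i < n" "dist (x i) v < e" using subsetD[OF K(3) vS] unfolding xn by auto
      then have "w v i > 0" by (simp add: w_def dist_commute)
      then show ?thesis unfolding W_def using i w0 by (intro sum_pos2[of _ i]) auto
    qed
    have wW: "w v i \<le> W v" if "i < n" for v i
      unfolding W_def using that w0 by (intro member_le_sum) auto
    have contc: "continuous_on Q (\<lambda>z. z i)" for i
      by (rule continuous_on_subset[OF continuous_on_product_coordinates]) simp
    have contm: "continuous_on Q (\<lambda>z. if i = 0 then max 0 (1 - s z) else 0)" for i :: nat
      unfolding s_def by (cases "i = 0") (auto intro!: continuous_intros contc)
    have "continuous_on Q s" unfolding s_def by (intro continuous_intros contc)
    then have conty: "continuous_on Q y"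
      unfolding y_def u_def by (intro continuous_intros contc contm) (auto simp: max_def)
    have contfy: "continuous_on Q (\<lambda>z. f (y z))"
      by (rule continuous_on_compose2[OF cont conty]) (use yS in auto)
    \<comment> \<open>The fixed weights are those of \<open>f (y z)\<close> with respect to the net.
      They sum to 1, so \<open>y z\<close> is their barycentre, and only net points closer than
      \<open>e\<close> to \<open>f (y z)\<close> carry weight.\<close>
    obtain z where zQ: "\<forall>i. 0 \<le> z i \<and> z i \<le> 1" and z: "\<forall>i<n. w (f (y z)) i / W (f (y z)) = z i"
    proof (rule brouwer_cube[of n "\<lambda>z i. w (f (y z)) i / W (f (y z))"])
      fix i assume i: "i < n"
      show "continuous_on {z. \<forall>i. 0 \<le> z i \<and> z i \<le> 1} (\<lambda>z. w (f (y z)) i / W (f (y z)))"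
        unfolding Q_def[symmetric]
      proof (intro continuous_intros ballI)
        show "continuous_on Q (\<lambda>z. w (f (y z)) i)"
          unfolding w_def by (intro continuous_intros contfy)
        show "continuous_on Q (\<lambda>z. W (f (y z)))"
          unfolding w_def W_def by (intro continuous_intros contfy)
        fix z assume "z \<in> Q"
        then show "W (f (y z)) \<noteq> 0" using W[of "f (y z)"] yS self by force
      qed
    next
      fix z :: "nat \<Rightarrow> real" and i assume i: "i < n" and "\<forall>i. 0 \<le> z i \<and> z i \<le> 1"
      then have "z \<in> Q" by (simp add: Q_def)
      then have "W (f (y z)) > 0" using W[of "f (y z)"] yS self by blast
      then show "0 \<le> w (f (y z)) i / W (f (y z)) \<and> w (f (y z)) i / W (f (y z)) \<le> 1"
        using wW[OF i] w0 by simp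
    qed
    have "z \<in> Q" using zQ by (simp add: Q_def)
    then have yz: "y z \<in> S" "f (y z) \<in> S" using yS self by auto
    have z': "z i = w (f (y z)) i / W (f (y z))" if "i < n" for i using z that by simp
    have "s z = (\<Sum>i<n. w (f (y z)) i / W (f (y z)))" unfolding s_def using z' by (intro sum.cong) auto
    also have "\<dots> = 1" using W[OF yz(2)] by (simp add: sum_divide_distrib[symmetric] W_def)
    finally have s1: "s z = 1" .
    then have yeq: "y z = (\<Sum>i<n. z i *\<^sub>R x i)" by (auto simp: y_def u_def intro!: sum.cong)
    have "(\<Sum>i<n. z i *\<^sub>R (f (y z) - x i)) = s z *\<^sub>R f (y z) - (\<Sum>i<n. z i *\<^sub>R x i)"
      by (simp add: s_def scaleR_diff_right sum_subtractf scaleR_sum_left)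
    then have "f (y z) - y z = (\<Sum>i<n. z i *\<^sub>R (f (y z) - x i))"
      using s1 yeq by simp
    then have "norm (f (y z) - y z) \<le> (\<Sum>i<n. norm (z i *\<^sub>R (f (y z) - x i)))"
      by (simp only: norm_sum)
    also have "\<dots> \<le> (\<Sum>i<n. z i * e)"
    proof (rule sum_mono)
      fix i assume "i \<in> {..<n}"
      then have i: "i < n" by simp
      show "norm (z i *\<^sub>R (f (y z) - x i)) \<le> z i * e"
      proof (cases "dist (f (y z)) (x i) < e")
        case True
        then show ?thesis using zQ by (auto simp: dist_norm intro!: mult_left_mono)
      next
        case False
        then have "z i = 0" using z'[OF i] by (simp add: w_def)
        then show ?thesis by simp
      qed
    qed
    also have "\<dots> = e" using s1 by (simp add: s_def flip: sum_distrib_right)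
    finally show ?thesis using yz(1) by (auto simp: dist_norm)
  qed
  have "continuous_on S (\<lambda>x. dist (f x) x)" by (intro continuous_intros cont)
  then obtain x where x: "x \<in> S" "\<And>y. y \<in> S \<Longrightarrow> dist (f x) x \<le> dist (f y) y"
    using continuous_attains_inf[OF \<open>compact S\<close> \<open>S \<noteq> {}\<close>] by blast
  have "dist (f x) x \<le> 0 + e" if "e > 0" for e
    using approx[OF that] x(2) by force
  then have "dist (f x) x \<le> 0" by (rule field_le_epsilon)
  then show ?thesis using that x(1) by simp
qed

subsection \<open>Connected branches of fixed points\<close>

text \<open>Since \<open>sep\<close> forbids a splitting of \<open>S\<close> between
  \<open>q\<close> and the level \<open>l\<close>, the cut wire theorem gives a connected set
  joining them. Removing \<open>q\<close> may disconnect it, so \<open>\<Gamma>\<close> is only the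
  component of an end point at level \<open>l\<close>; boundary bumping keeps \<open>q\<close> in
  its closure, and connectedness then makes \<open>h\<close> take every value in between.\<close>

lemma connected_branch:
  fixes S :: "'a::metric_space set" and h :: "'a \<Rightarrow> real"
  assumes S: "compact S" and h: "continuous_on S h" and h0: "\<And>x. x \<in> S \<Longrightarrow> 0 \<le> h x" and l: "0 < l"
    and q: "\<And>x. x \<in> S \<and> h x = 0 \<longleftrightarrow> x = q"
    and sep: "\<And>S1 S2. \<lbrakk>compact S1; compact S2; S1 \<union> S2 = S; S1 \<inter> S2 = {}; q \<in> S1; {x\<in>S. h x = l} \<subseteq> S2\<rbrakk> \<Longrightarrow> False"
  obtains \<Gamma> where "connected \<Gamma>" "\<Gamma> \<subseteq> S - {q}" "q \<in> closure \<Gamma>" "{0<..l} \<subseteq> h ` \<Gamma>"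
proof -
  let ?B = "{x\<in>S. h x = l}"
  have qS: "q \<in> S" "h q = 0" using q by auto
  have closedS: "closed S" by (rule compact_imp_closed[OF S])
  have clB: "closed ?B"
    using continuous_closed_preimage_constant[OF h closedS] by simp
  have "\<exists>C. connectedin (top_of_set S) C \<and> \<not> disjnt C {q} \<and> \<not> disjnt C ?B"
  proof (rule ccontr)
    assume *: "\<not> ?thesis"
    have "separated_between (top_of_set S) {q} ?B"
    proof (rule cut_wire_fence_theorem)
      show "compact_space (top_of_set S)" using S by (simp add: compact_space_subtopology)
      show "Hausdorff_space (top_of_set S)" by (simp add: Hausdorff_space_subtopology)
      show "closedin (top_of_set S) {q}" using qS by (simp add: closed_subset)
      show "closedin (top_of_set S) ?B" using clB by (auto intro: closed_subset)
    qed (use * in blast)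
    then obtain U V where UV: "closedin (top_of_set S) U" "closedin (top_of_set S) V" "U \<union> V = S" "disjnt U V" "{q} \<subseteq> U" "?B \<subseteq> V"
      unfolding separated_between_alt by auto
    have "compact U" "compact V" using UV(1,2) S closedin_compact by blast+
    then show False using sep[of U V] UV by (auto simp: disjnt_def)
  qed
  then obtain C b where C: "connected C" "C \<subseteq> S" "q \<in> C" "b \<in> C" "h b = l"
    by (auto simp: connectedin_subtopology disjnt_iff)
  define D where "D = closure C"
  have DS: "D \<subseteq> S" using C(2) closedS by (simp add: D_def closure_minimal)
  have D: "connected D" "D \<subseteq> S" "q \<in> D" "b \<in> D" "compact D"
    using C DS S closure_subset[of C] compact_Int_closed[OF S, of D] closed_closure[of C]
    by (auto simp: D_def connected_imp_connected_closure Int_absorb1 simp del: closed_closure)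
  have bq: "b \<noteq> q" using C(5) qS l by auto
  define \<Gamma> where "\<Gamma> = connected_component_set (D - {q}) b"
  have b\<Gamma>: "b \<in> \<Gamma>" unfolding \<Gamma>_def using D bq by (simp add: connected_component_refl)
  have \<Gamma>D: "\<Gamma> \<subseteq> D - {q}" unfolding \<Gamma>_def by (rule connected_component_subset)
  have con: "connected \<Gamma>" unfolding \<Gamma>_def by simp
  have "(top_of_set D) frontier_of \<Gamma> \<inter> (top_of_set D) frontier_of (D - {q}) \<noteq> {}"
  proof (rule boundary_bumping_theorem)
    show "connected_space (top_of_set D)" using D(1) by (simp add: connected_space_subtopology connectedin_iff_connected)
    show "compact_space (top_of_set D)" using D(5) by (simp add: compact_space_subtopology)
    show "Hausdorff_space (top_of_set D)" by (simp add: Hausdorff_space_subtopology)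
    show "D - {q} \<subset> topspace (top_of_set D)" using D by auto
    have "\<Gamma> \<in> components (D - {q})" unfolding \<Gamma>_def using D bq by (intro componentsI) auto
    moreover have "connected_component_of (top_of_set T) x y \<longleftrightarrow> connected_component T x y" for T :: "'a set" and x y
      by (auto simp: connected_component_of_def connected_component_def connectedin_subtopology)
    then have "connected_component_of_set (top_of_set T) x = connected_component_set T x" for T :: "'a set" and x
      by (auto simp: set_eq_iff)
    ultimately show "\<Gamma> \<in> connected_components_of (subtopology (top_of_set D) (D - {q}))"
      unfolding connected_components_of_def components_def subtopology_subtopology
      by (simp add: Int_absorb1 Int_absorb2 Diff_subset)
  qed
  then obtain x where x: "x \<in> (top_of_set D) closure_of \<Gamma>" "x \<in> (top_of_set D) frontier_of (D - {q})"
    by (auto simp: frontier_of_def)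
  \<comment> \<open>Openness of \<open>D - {q}\<close> in \<open>D\<close> leaves \<open>q\<close>
    as the only possible frontier point; this identifies the point supplied by boundary
    bumping.\<close>
  have "(top_of_set D) frontier_of (D - {q}) \<subseteq> {q}"
  proof -
    have "openin (top_of_set D) (D - {q})" by (simp add: openin_delete)
    then show ?thesis by (auto simp: frontier_of_def interior_of_openin dest: closure_of_subset_topspace[THEN subsetD])
  qed
  then have "q \<in> (top_of_set D) closure_of \<Gamma>" using x by auto
  then have qcl: "q \<in> closure \<Gamma>"
    using closure_mono[of "D \<inter> \<Gamma>" \<Gamma>] by (auto simp: closure_of_subtopology)
  have "{0<..l} \<subseteq> h ` \<Gamma>"
  proof
    fix t assume t: "t \<in> {0<..l}"
    have hD: "continuous_on D h" using h D(2) continuous_on_subset by blast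
    have "\<exists>y\<in>\<Gamma>. h y < t"
    proof -
      obtain d where d: "d > 0" "\<And>y. y \<in> D \<Longrightarrow> dist y q < d \<Longrightarrow> dist (h y) (h q) < t"
        using hD D(3) t unfolding continuous_on_iff by (metis greaterThanAtMost_iff)
      obtain y where "y \<in> \<Gamma>" "dist y q < d" using qcl d(1) by (auto simp: closure_approachable)
      then show ?thesis using d(2)[of y] \<Gamma>D qS by (auto simp: dist_real_def intro!: bexI[of _ y])
    qed
    then obtain y where y: "y \<in> \<Gamma>" "h y < t" by blast
    have "connected (h ` \<Gamma>)"
      using con hD \<Gamma>D by (intro connected_continuous_image) (auto intro: continuous_on_subset)
    then have "t \<in> h ` \<Gamma>"
      using y b\<Gamma> C(5) t connectedD_interval[of "h ` \<Gamma>" "h y" "h b" t] by auto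
    then show "t \<in> h ` \<Gamma>" .
  qed
  with con qcl \<Gamma>D D(2) that show ?thesis by blast
qed

text \<open>A clamped update can stand still under a nonzero drift \<open>e\<close> only at the end
  towards which the drift points. Used twice: for the parameter \<lambda> and for the mean of
  \<open>x\<close>.\<close>

lemma clamp_fixed:
  fixes l u x e :: real
  assumes "x = max l (min u (x + e))"
  shows "l \<le> u \<Longrightarrow> x \<in> {l..u}" "e > 0 \<Longrightarrow> l \<le> u \<Longrightarrow> x = u" "e < 0 \<Longrightarrow> x = l"
  using assms by (auto simp: max_def min_def split: if_splits)

text \<open>Schauder is applied on \<open>{0..l} \<times> K\<close> to \<open>A\<close> together
  with a clamped drift of the parameter, which may be any continuous function. Uniqueness at 0 makes
  the slice of the solution set over 0 the single point \<open>q\<close>, so the part of a splitting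
  that contains \<open>q\<close> contains the whole slice.\<close>

theorem continuation:
  fixes A :: "real \<Rightarrow> 'a::real_normed_vector \<Rightarrow> 'a"
  assumes K: "compact K" "convex K" "K \<noteq> {}" and l: "0 < l"
    and A: "continuous_on ({0..l} \<times> K) (\<lambda>(\<mu>, w). A \<mu> w)"
    and self: "\<And>\<mu> w. \<mu> \<in> {0..l} \<Longrightarrow> w \<in> K \<Longrightarrow> A \<mu> w \<in> K"
    and uniq: "\<And>w. w \<in> K \<Longrightarrow> A 0 w = w \<Longrightarrow> w = q"
  obtains \<Gamma> where "connected \<Gamma>" "\<Gamma> \<subseteq> {(\<mu>, w). \<mu> \<in> {0<..l} \<and> w \<in> K \<and> A \<mu> w = w}"
    "(0, q) \<in> closure \<Gamma>" "{0<..l} \<subseteq> fst ` \<Gamma>" "q \<in> K" "A 0 q = q"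
proof -
  define X where "X = {0..l} \<times> K"
  define S where "S = {z \<in> X. A (fst z) (snd z) = snd z}"
  have X: "compact X" "convex X" "X \<noteq> {}" using K l by (auto simp: X_def compact_Times convex_Times)
  have contA: "continuous_on X (\<lambda>z. A (fst z) (snd z))" using A by (simp add: X_def case_prod_unfold)
  have key: "\<exists>z\<in>S. (e z > 0 \<longrightarrow> fst z = l) \<and> (e z < 0 \<longrightarrow> fst z = 0)"
    if e: "continuous_on X e" for e :: "real \<times> 'a \<Rightarrow> real"
  proof -
    let ?f = "\<lambda>z. (max 0 (min l (fst z + e z)), A (fst z) (snd z))"
    have "continuous_on X ?f" by (intro continuous_intros contA e)
    moreover have "?f ` X \<subseteq> X" using self l by (auto simp: X_def)
    ultimately obtain z where z: "z \<in> X" "?f z = z" using schauder[OF X] by blast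
    then have "fst z = max 0 (min l (fst z + e z))" "z \<in> S" by (auto simp: S_def prod_eq_iff)
    with clamp_fixed[OF this(1)] l show ?thesis by (intro bexI[of _ z]) auto
  qed
  have S0: "z = (0, q)" if "z \<in> S" "fst z = 0" for z
    using that uniq by (auto simp: S_def X_def prod_eq_iff)
  have qS: "(0, q) \<in> S"
  proof -
    \<comment> \<open>The constant drift -1 pushes the parameter to 0 and so produces the fixed
      point there; the drift 1 does the same at \<open>l\<close> below.\<close>
    obtain z where "z \<in> S" "fst z = 0" using key[of "\<lambda>_. -1"] by auto
    then show ?thesis using S0 by metis
  qed
  have clS: "closed S"
  proof -
    have "closedin (top_of_set X) {z \<in> X. A (fst z) (snd z) - snd z = 0}"
      by (intro continuous_closedin_preimage_constant continuous_intros contA)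
    then show ?thesis unfolding S_def using compact_imp_closed[OF X(1)] closedin_closed_trans by force
  qed
  have "S \<subseteq> X" by (auto simp: S_def)
  then have "compact S" using clS X(1) by (metis compact_Int_closed inf.absorb2)
  obtain \<Gamma> where \<Gamma>: "connected \<Gamma>" "\<Gamma> \<subseteq> S - {(0, q)}" "(0, q) \<in> closure \<Gamma>" "{0<..l} \<subseteq> fst ` \<Gamma>"
  proof (rule connected_branch[of S fst l "(0, q)"])
    show "z \<in> S \<and> fst z = 0 \<longleftrightarrow> z = (0, q)" for z using S0[of z] qS by force
    show "0 \<le> fst z" if "z \<in> S" for z using that by (auto simp: S_def X_def)
    fix S1 S2 assume S12: "compact S1" "compact S2" "S1 \<union> S2 = S" "S1 \<inter> S2 = {}" "(0, q) \<in> S1"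
      "{z \<in> S. fst z = l} \<subseteq> S2"
    \<comment> \<open>\<open>infdist\<close> to the empty set is 0, so \<open>S2\<close> has to be
      nonempty before distances can tell the two parts apart.\<close>
    have "S2 \<noteq> {}" using key[of "\<lambda>_. 1"] S12(6) by auto
    \<comment> \<open>Positive on \<open>S1\<close> and negative on \<open>S2\<close>: the part over
      0 drifts towards \<open>l\<close>, the part over \<open>l\<close> drifts towards 0, and
      neither can rest at an end.\<close>
    define e where "e z = infdist z S2 - infdist z S1" for z
    have e1: "e z \<ge> 0" if "z \<in> S1" for z using that by (simp add: e_def infdist_nonneg)
    have e2: "e z \<le> 0" if "z \<in> S2" for z using that by (simp add: e_def infdist_nonneg)
    have ne: "e z \<noteq> 0" if "z \<in> S" for z
    proof
      assume 0: "e z = 0"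
      have cl: "closed S1" "closed S2" using S12 compact_imp_closed by auto
      have "infdist z S1 = 0 \<or> infdist z S2 = 0" using that S12(3) by auto
      then have "z \<in> S1" "z \<in> S2"
        using 0 cl S12(5) \<open>S2 \<noteq> {}\<close> in_closed_iff_infdist_zero[of S1 z] in_closed_iff_infdist_zero[of S2 z]
        by (auto simp: e_def)
      then show False using S12(4) by blast
    qed
    have "continuous_on X e" unfolding e_def by (intro continuous_intros)
    from key[OF this] obtain z where z: "z \<in> S" "e z > 0 \<longrightarrow> fst z = l" "e z < 0 \<longrightarrow> fst z = 0" by blast
    show False
    proof (cases "e z > 0")
      case True
      then have "z \<in> S2" using z S12(6) by auto
      then show False using e2[of z] True by simp
    next
      case False
      then have "z = (0, q)" using z ne[of z] S0 by auto
      then show False using e1[OF S12(5)] False ne[OF z(1)] by auto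
    qed
  qed (use l \<open>compact S\<close> in \<open>auto intro: continuous_intros\<close>)
  have "\<Gamma> \<subseteq> {(\<mu>, w). \<mu> \<in> {0<..l} \<and> w \<in> K \<and> A \<mu> w = w}"
  proof
    fix z assume "z \<in> \<Gamma>"
    then have "z \<in> S" "z \<noteq> (0, q)" using \<Gamma>(2) by auto
    then show "z \<in> {(\<mu>, w). \<mu> \<in> {0<..l} \<and> w \<in> K \<and> A \<mu> w = w}"
      using S0[of z] by (auto simp: S_def X_def less_le)
  qed
  with \<Gamma> qS that show ?thesis by (auto simp: S_def X_def)
qed

subsection \<open>Wirtinger's inequality and Yorke's estimate\<close>

lemma integral_periodic:
  fixes F :: "real \<Rightarrow> real"
  assumes F: "continuous_on UNIV F" and per: "\<And>t. F (t + T) = F t" and c: "0 \<le> c" "c \<le> T"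
  shows "integral {c..c + T} F = integral {0..T} F"
proof -
  have int: "F integrable_on {u..v}" for u v
    by (rule integrable_continuous_real) (rule continuous_on_subset[OF F], simp)
  have "integral {0..c} (F \<circ> (\<lambda>x. x + T)) = integral {0 + T..c + T} F"
    by (rule integral_shift) (rule continuous_on_subset[OF F], simp)
  then have "integral {T..c + T} F = integral {0..c} F" by (simp add: o_def per)
  moreover have "integral {c..T} F + integral {T..c + T} F = integral {c..c + T} F"
    by (rule Henstock_Kurzweil_Integration.integral_combine) (use c int in auto)
  moreover have "integral {0..c} F + integral {c..T} F = integral {0..T} F"
    by (rule Henstock_Kurzweil_Integration.integral_combine) (use c int in auto)
  ultimately show ?thesis by linarith
qed

text \<open>The integrand of the difference is \<open>(y' + \<omega> z tan)\<^sup>2\<close> minus the derivative of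
  \<open>\<omega> z\<^sup>2 tan\<close>, with \<open>z = y - k\<close>; the tangent is finite because \<open>\<omega> h < \<pi>/2\<close>.\<close>
lemma wirtinger_dirichlet:
  fixes y y' :: "real \<Rightarrow> real"
  assumes y: "\<And>t. (y has_real_derivative y' t) (at t)" and y': "continuous_on UNIV y'"
    and ends: "y (c - h) = k" "y (c + h) = k" and h: "0 < h" and w: "0 < \<omega>" "\<omega> * h < pi / 2"
  shows "\<omega>\<^sup>2 * integral {c - h..c + h} (\<lambda>t. (y t - k)\<^sup>2) \<le> integral {c - h..c + h} (\<lambda>t. (y' t)\<^sup>2)"
proof -
  let ?I = "{c - h..c + h}"
  let ?t = "\<lambda>t. tan (\<omega> * (t - c))"
  define F where "F t = \<omega> * (y t - k)\<^sup>2 * ?t t" for t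
  define F' where "F' t = 2 * \<omega> * (y t - k) * y' t * ?t t + \<omega>\<^sup>2 * (y t - k)\<^sup>2 * (1 + (?t t)\<^sup>2)" for t
  have cos: "cos (\<omega> * (t - c)) \<noteq> 0" if "t \<in> ?I" for t
  proof -
    have "\<bar>\<omega> * (t - c)\<bar> \<le> \<omega> * h"
      using that w by (auto simp: abs_mult intro!: mult_left_mono)
    then have "- (pi / 2) < \<omega> * (t - c)" "\<omega> * (t - c) < pi / 2" using w by linarith+
    then show ?thesis using cos_gt_zero_pi[of "\<omega> * (t - c)"] by simp
  qed
  have conty: "continuous_on UNIV y" using y by (meson DERIV_isCont continuous_at_imp_continuous_on)
  have "(F has_real_derivative F' t) (at t)" if "t \<in> ?I" for t
  proof -
    define s where "s = ?t"
    have D: "(s has_real_derivative \<omega> * (1 + (s t)\<^sup>2)) (at t)"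
      unfolding s_def using cos[OF that] by (auto intro!: derivative_eq_intros simp: tan_sec power_inverse)
    have "((\<lambda>t. \<omega> * (y t - k)\<^sup>2 * s t) has_real_derivative
        2 * \<omega> * (y t - k) * y' t * s t + \<omega>\<^sup>2 * (y t - k)\<^sup>2 * (1 + (s t)\<^sup>2)) (at t)"
      by (auto intro!: derivative_eq_intros y D simp: algebra_simps power2_eq_square)
    then show ?thesis by (simp add: F_def[abs_def] F'_def s_def)
  qed
  then have "(F' has_integral (F (c + h) - F (c - h))) ?I"
    using h by (intro fundamental_theorem_of_calculus)
      (auto simp flip: has_real_derivative_iff_has_vector_derivative intro: has_field_derivative_at_within)
  then have F'0: "(F' has_integral 0) ?I" by (simp add: F_def ends)
  have i1: "(\<lambda>t. (y' t)\<^sup>2) integrable_on ?I" "(\<lambda>t. (y t - k)\<^sup>2) integrable_on ?I"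
    by (auto intro!: integrable_continuous_real continuous_intros continuous_on_subset[OF y'] continuous_on_subset[OF conty])
  have "((\<lambda>t. (y' t)\<^sup>2 - \<omega>\<^sup>2 * (y t - k)\<^sup>2 + F' t) has_integral
          (integral ?I (\<lambda>t. (y' t)\<^sup>2) - \<omega>\<^sup>2 * integral ?I (\<lambda>t. (y t - k)\<^sup>2) + 0)) ?I"
    by (intro has_integral_add has_integral_diff has_integral_mult_right integrable_integral i1 F'0)
  then have "0 \<le> integral ?I (\<lambda>t. (y' t)\<^sup>2) - \<omega>\<^sup>2 * integral ?I (\<lambda>t. (y t - k)\<^sup>2) + 0"
  proof (rule has_integral_nonneg)
    fix t
    have "(y' t)\<^sup>2 - \<omega>\<^sup>2 * (y t - k)\<^sup>2 + F' t = (y' t + \<omega> * (y t - k) * ?t t)\<^sup>2"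
      by (simp add: F'_def power2_eq_square algebra_simps)
    then show "0 \<le> (y' t)\<^sup>2 - \<omega>\<^sup>2 * (y t - k)\<^sup>2 + F' t" by simp
  qed
  then show ?thesis by simp
qed

text \<open>The difference \<open>y (t + T / 2) - y t\<close> changes sign over half a period, so
  some value \<open>k\<close> is taken at two points at distance T / 2. The Dirichlet version then
  applies to both half periods, with half-length T / 4, and \<omega> * T / 4 < pi / 2 is exactly the
  assumption on \<omega>. Mean zero makes k = 0 the choice that minimises the integral of (y - k)^2,
  which removes \<open>k\<close> at the end.\<close>

theorem wirtinger_periodic:
  fixes y y' :: "real \<Rightarrow> real"
  assumes y: "\<And>t. (y has_real_derivative y' t) (at t)" and y': "continuous_on UNIV y'"
    and per: "\<And>t. y (t + T) = y t" "\<And>t. y' (t + T) = y' t" and mean: "integral {0..T} y = 0"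
    and T: "0 < T" and w: "0 < \<omega>" "\<omega> * T < 2 * pi"
  shows "\<omega>\<^sup>2 * integral {0..T} (\<lambda>t. (y t)\<^sup>2) \<le> integral {0..T} (\<lambda>t. (y' t)\<^sup>2)"
proof -
  have conty: "continuous_on UNIV y" using y by (meson DERIV_isCont continuous_at_imp_continuous_on)
  define d where "d t = y (t + T / 2) - y t" for t
  have contd: "continuous_on {0..T / 2} d"
    unfolding d_def by (intro continuous_intros continuous_on_compose2[OF conty]) auto
  have dd: "d (T / 2) = - d 0" using per(1)[of 0] by (simp add: d_def)
  have "\<exists>t0. 0 \<le> t0 \<and> t0 \<le> T / 2 \<and> d t0 = 0"
  proof (cases "d 0 \<le> 0")
    case True
    then show ?thesis using IVT'[of d 0 0 "T / 2"] dd contd T by auto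
  next
    case False
    then show ?thesis using IVT2'[of d "T / 2" 0 0] dd contd T by auto
  qed
  then obtain t0 where t0: "0 \<le> t0" "t0 \<le> T / 2" "y (t0 + T / 2) = y t0" by (auto simp: d_def)
  define k where "k = y t0"
  have half: "\<omega>\<^sup>2 * integral {u..u + T / 2} (\<lambda>t. (y t - k)\<^sup>2) \<le> integral {u..u + T / 2} (\<lambda>t. (y' t)\<^sup>2)"
    if "y u = k" "y (u + T / 2) = k" for u
    using wirtinger_dirichlet[OF y y', of "u + T / 4" "T / 4" k \<omega>] that T w by (simp add: add.assoc mult.commute)
  have i: "(\<lambda>t. (y t - k)\<^sup>2) integrable_on {u..v}" "(\<lambda>t. (y' t)\<^sup>2) integrable_on {u..v}"
     "(\<lambda>t. (y t)\<^sup>2) integrable_on {u..v}" "y integrable_on {u..v}" for u v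
    by (auto intro!: integrable_continuous_real continuous_intros continuous_on_subset[OF y'] continuous_on_subset[OF conty])
  have comb: "integral {t0..t0 + T / 2} F + integral {t0 + T / 2..t0 + T / 2 + T / 2} F = integral {0..T} F"
    if "continuous_on UNIV F" "\<And>t. F (t + T) = F t" for F :: "real \<Rightarrow> real"
  proof -
    have "integral {t0..t0 + T / 2} F + integral {t0 + T / 2..t0 + T / 2 + T / 2} F = integral {t0..t0 + T / 2 + T / 2} F"
      using T by (intro Henstock_Kurzweil_Integration.integral_combine integrable_continuous_real continuous_on_subset[OF that(1)]) auto
    then show ?thesis using integral_periodic[OF that, of t0] t0 T by (simp add: add.assoc)
  qed
  have "y (t0 + T / 2 + T / 2) = k" using per(1)[of t0] by (simp add: k_def add.assoc)
  then have "\<omega>\<^sup>2 * (integral {t0..t0 + T / 2} (\<lambda>t. (y t - k)\<^sup>2) + integral {t0 + T / 2..t0 + T / 2 + T / 2} (\<lambda>t. (y t - k)\<^sup>2))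
    \<le> integral {t0..t0 + T / 2} (\<lambda>t. (y' t)\<^sup>2) + integral {t0 + T / 2..t0 + T / 2 + T / 2} (\<lambda>t. (y' t)\<^sup>2)"
    using half[of t0] half[of "t0 + T / 2"] t0(3) by (simp add: k_def distrib_left)
  then have 1: "\<omega>\<^sup>2 * integral {0..T} (\<lambda>t. (y t - k)\<^sup>2) \<le> integral {0..T} (\<lambda>t. (y' t)\<^sup>2)"
    using comb[of "\<lambda>t. (y t - k)\<^sup>2"] comb[of "\<lambda>t. (y' t)\<^sup>2"] conty y' per by (simp add: continuous_intros)
  have "((\<lambda>t. (y t)\<^sup>2 - 2 * k * y t + k\<^sup>2) has_integral
      (integral {0..T} (\<lambda>t. (y t)\<^sup>2) - 2 * k * integral {0..T} y + (T - 0) *\<^sub>R k\<^sup>2)) {0..T}"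
    using T has_integral_const_real[of "k\<^sup>2" 0 T] by (intro has_integral_add has_integral_diff has_integral_mult_right integrable_integral i) auto
  then have "integral {0..T} (\<lambda>t. (y t - k)\<^sup>2) = integral {0..T} (\<lambda>t. (y t)\<^sup>2) + T * k\<^sup>2"
    by (simp add: mean power2_diff mult.commute mult.left_commute integral_unique algebra_simps)
  moreover have "0 \<le> T * k\<^sup>2" using T by simp
  ultimately have "integral {0..T} (\<lambda>t. (y t)\<^sup>2) \<le> integral {0..T} (\<lambda>t. (y t - k)\<^sup>2)" by linarith
  then show ?thesis by (rule order_trans[OF mult_left_mono 1]) simp
qed

text \<open>The deviation from the mean is at most the variation over one period, and |y'| is at
  most (y'^2 / \<eta> + \<eta>) / 2. The free \<open>\<eta>\<close> replaces Cauchy-Schwarz: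
  choosing it of the order of the parameter turns a quadratically small energy into a linearly small
  deviation.\<close>

lemma deviation_le_energy:
  fixes y y' :: "real \<Rightarrow> real"
  assumes y: "\<And>t. (y has_real_derivative y' t) (at t)" and y': "continuous_on UNIV y'"
    and T: "0 < T" and e: "0 < \<eta>" and t: "t \<in> {0..T}" and mean: "integral {0..T} y = T * c"
  shows "\<bar>y t - c\<bar> \<le> (integral {0..T} (\<lambda>s. (y' s)\<^sup>2) / \<eta> + \<eta> * T) / 2"
proof -
  define M where "M = (integral {0..T} (\<lambda>s. (y' s)\<^sup>2) / \<eta> + \<eta> * T) / 2"
  have conty: "continuous_on UNIV y" using y by (meson DERIV_isCont continuous_at_imp_continuous_on)
  have ia: "(\<lambda>s. \<bar>y' s\<bar>) integrable_on {u..v}" and i2: "(\<lambda>s. (y' s)\<^sup>2) integrable_on {u..v}"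
    and i1: "y integrable_on {u..v}" for u v
    by (auto intro!: integrable_continuous_real continuous_intros continuous_on_subset[OF y'] continuous_on_subset[OF conty])
  have abs: "integral {0..T} (\<lambda>s. \<bar>y' s\<bar>) \<le> M"
  proof -
    have "((\<lambda>s. ((y' s)\<^sup>2 / \<eta> + \<eta>) / 2) has_integral (integral {0..T} (\<lambda>s. (y' s)\<^sup>2) / \<eta> + (T - 0) *\<^sub>R \<eta>) / 2) {0..T}"
      using T has_integral_const_real[of \<eta> 0 T]
      by (intro has_integral_divide has_integral_add integrable_integral i2) auto
    then have *: "((\<lambda>s. ((y' s)\<^sup>2 / \<eta> + \<eta>) / 2) has_integral M) {0..T}" by (simp add: M_def mult.commute)
    show ?thesis
    proof (rule has_integral_le[OF integrable_integral[OF ia] *])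
      fix s
      have "0 \<le> (\<bar>y' s\<bar> - \<eta>)\<^sup>2" by simp
      then show "\<bar>y' s\<bar> \<le> ((y' s)\<^sup>2 / \<eta> + \<eta>) / 2"
        using e by (simp add: power2_diff field_simps power2_eq_square)
    qed
  qed
  have two: "\<bar>y v - y u\<bar> \<le> M" if "0 \<le> u" "u \<le> v" "v \<le> T" for u v
  proof -
    have *: "(y' has_integral (y v - y u)) {u..v}"
      using that by (intro fundamental_theorem_of_calculus)
        (auto simp flip: has_real_derivative_iff_has_vector_derivative intro: has_field_derivative_at_within y)
    have "\<bar>y v - y u\<bar> \<le> integral {u..v} (\<lambda>s. \<bar>y' s\<bar>)"
      using has_integral_integrable[OF *] integral_unique[OF *] ia
      by (metis absolutely_integrable_continuous_real  integral_norm_bound_integral order_refl real_norm_def)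
    also have "\<dots> \<le> integral {0..T} (\<lambda>s. \<bar>y' s\<bar>)"
      using that ia by (intro integral_subset_le) auto
    finally show ?thesis using abs by linarith
  qed
  have yb: "y t - M \<le> y s" "y s \<le> y t + M" if "s \<in> {0..T}" for s
    using two[of s t] two[of t s] that t by (cases "s \<le> t"; force)+
  have "((\<lambda>s. y t - M) has_integral (T - 0) *\<^sub>R (y t - M)) {0..T}" "((\<lambda>s. y t + M) has_integral (T - 0) *\<^sub>R (y t + M)) {0..T}"
    using T has_integral_const_real[of "y t - M" 0 T] has_integral_const_real[of "y t + M" 0 T] by simp_all
  with yb have "T * (y t - M) \<le> T * c" "T * c \<le> T * (y t + M)"
    using has_integral_le[OF _ integrable_integral[OF i1[of 0 T]]] has_integral_le[OF integrable_integral[OF i1[of 0 T]]] mean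
    by fastforce+
  then have "y t - M \<le> c" "c \<le> y t + M" using T by simp_all
  then show ?thesis unfolding M_def[symmetric] by linarith
qed

text \<open>Yorke's argument: subtracting constants only decreases the energy of the derivative, and
  Wirtinger's inequality absorbs the Lipschitz part, since \<open>\<rho> < \<omega>\<close>.\<close>
lemma almost_constant:
  fixes w w' :: "nat \<Rightarrow> real \<Rightarrow> real"
  assumes w: "\<And>k t. k < m \<Longrightarrow> (w k has_real_derivative w' k t) (at t)"
    and w': "\<And>k. k < m \<Longrightarrow> continuous_on UNIV (w' k)"
    and per: "\<And>k t. k < m \<Longrightarrow> w k (t + T) = w k t" "\<And>k t. k < m \<Longrightarrow> w' k (t + T) = w' k t"
    and mean: "\<And>k. k < m \<Longrightarrow> integral {0..T} (w k) = T * c k"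
    and T: "0 < T" and \<omega>: "0 < \<omega>" "\<omega> * T < 2 * pi" and \<rho>: "0 \<le> \<rho>2" "\<rho>2 < \<omega>\<^sup>2"
    and C: "0 \<le> C" and \<mu>: "0 \<le> \<mu>"
    and bound: "\<And>t. (\<Sum>k<m. (w' k t + d k)\<^sup>2) \<le> \<rho>2 * (\<Sum>k<m. (w k t - c k)\<^sup>2) + \<mu>\<^sup>2 * C"
    and k: "k < m" and t: "t \<in> {0..T}"
  shows "\<bar>w k t - c k\<bar> \<le> \<mu> * ((C * T / (1 - \<rho>2 / \<omega>\<^sup>2) + T) / 2)"
proof -
  have ci: "((\<lambda>_. x) has_integral T * x) {0..T}" for x :: real
    using T has_integral_const_real[of x 0 T] by simp
  have contw: "continuous_on UNIV (w k)" if "k < m" for k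
    using w[OF that] by (meson DERIV_isCont continuous_at_imp_continuous_on)
  define E where "E k = integral {0..T} (\<lambda>t. (w' k t)\<^sup>2)" for k
  define V where "V k = integral {0..T} (\<lambda>t. (w k t - c k)\<^sup>2)" for k
  have iE: "((\<lambda>t. (w' k t)\<^sup>2) has_integral E k) {0..T}" if "k < m" for k
    unfolding E_def by (intro integrable_integral integrable_continuous_real continuous_intros continuous_on_subset[OF w'[OF that]]) auto
  have iV: "((\<lambda>t. (w k t - c k)\<^sup>2) has_integral V k) {0..T}" if "k < m" for k
    unfolding V_def by (intro integrable_integral integrable_continuous_real continuous_intros continuous_on_subset[OF contw[OF that]]) auto
  have E0: "0 \<le> E k" if "k < m" for k using has_integral_nonneg[OF iE[OF that]] by simp
  have wirt: "\<omega>\<^sup>2 * V k \<le> E k" if k: "k < m" for k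
    unfolding V_def E_def
  proof (rule wirtinger_periodic[OF _ w'[OF k] _ per(2)[OF k] _ T \<omega>])
    show "((\<lambda>t. w k t - c k) has_real_derivative w' k t) (at t)" for t
      using w[OF k, of t] by (auto intro!: derivative_eq_intros)
    have "((\<lambda>t. w k t - c k) has_integral (T * c k - T * c k)) {0..T}"
      using T ci[of "c k"] mean[OF k]
      by (intro has_integral_diff) (auto simp: has_integral_iff intro!: integrable_continuous_real continuous_on_subset[OF contw[OF k]])
    then show "integral {0..T} (\<lambda>t. w k t - c k) = 0" by (simp add: integral_unique)
  qed (use per k in auto)
  have i': "(w' k has_integral 0) {0..T}" if k: "k < m" for k
  proof -
    have "(w' k has_integral (w k T - w k 0)) {0..T}"
      using T by (intro fundamental_theorem_of_calculus)
        (auto simp flip: has_real_derivative_iff_has_vector_derivative intro: has_field_derivative_at_within w[OF k])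
    then show ?thesis using per(1)[OF k, of 0] by simp
  qed
  \<comment> \<open>The cross term integrates to 0 by periodicity, so the constants
    \<open>d k\<close> contribute only the nonnegative amounts
    \<open>T * (d k)\<^sup>2\<close>.\<close>
  have "((\<lambda>t. \<Sum>k<m. (w' k t)\<^sup>2 + 2 * d k * w' k t + (d k)\<^sup>2) has_integral (\<Sum>k<m. E k + 2 * d k * 0 + T * (d k)\<^sup>2)) {0..T}"
    using T ci
    by (intro has_integral_sum has_integral_add has_integral_mult_right iE i') auto
  moreover have "((\<lambda>t. \<rho>2 * (\<Sum>k<m. (w k t - c k)\<^sup>2) + \<mu>\<^sup>2 * C) has_integral (\<rho>2 * (\<Sum>k<m. V k) + T * (\<mu>\<^sup>2 * C))) {0..T}"
    using T ci
    by (intro has_integral_sum has_integral_add has_integral_mult_right iV) auto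
  ultimately have "(\<Sum>k<m. E k + 2 * d k * 0 + T * (d k)\<^sup>2) \<le> \<rho>2 * (\<Sum>k<m. V k) + T * (\<mu>\<^sup>2 * C)"
  proof (rule has_integral_le)
    fix t
    show "(\<Sum>k<m. (w' k t)\<^sup>2 + 2 * d k * w' k t + (d k)\<^sup>2) \<le> \<rho>2 * (\<Sum>k<m. (w k t - c k)\<^sup>2) + \<mu>\<^sup>2 * C"
      using bound[of t] by (simp add: power2_sum algebra_simps)
  qed
  moreover have "(\<Sum>k<m. E k) \<le> (\<Sum>k<m. E k + 2 * d k * 0 + T * (d k)\<^sup>2)"
    using T by (intro sum_mono) simp
  moreover have "\<rho>2 * (\<Sum>k<m. V k) \<le> \<rho>2 * ((\<Sum>k<m. E k) / \<omega>\<^sup>2)"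
    unfolding sum_divide_distrib using \<rho>(1) \<omega>(1) wirt
    by (intro mult_left_mono sum_mono) (auto simp: field_simps)
  ultimately have "(\<Sum>k<m. E k) \<le> \<rho>2 * ((\<Sum>k<m. E k) / \<omega>\<^sup>2) + T * (\<mu>\<^sup>2 * C)" by simp
  then have "(1 - \<rho>2 / \<omega>\<^sup>2) * (\<Sum>k<m. E k) \<le> T * (\<mu>\<^sup>2 * C)" by (simp add: algebra_simps)
  moreover have pos: "0 < 1 - \<rho>2 / \<omega>\<^sup>2" using \<rho> \<omega> by simp
  ultimately have "(\<Sum>k<m. E k) \<le> \<mu>\<^sup>2 * (C * T / (1 - \<rho>2 / \<omega>\<^sup>2))"
    by (simp add: pos_le_divide_eq mult.commute mult.left_commute)
  moreover have "E k \<le> (\<Sum>k<m. E k)" using k E0 by (intro member_le_sum) auto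
  ultimately have E: "E k \<le> \<mu>\<^sup>2 * (C * T / (1 - \<rho>2 / \<omega>\<^sup>2))" (is "_ \<le> _ * ?D") by linarith
  have dev: "\<bar>w k t - c k\<bar> \<le> (E k / \<eta> + \<eta> * T) / 2" if "\<eta> > 0" for \<eta>
    unfolding E_def by (rule deviation_le_energy[OF w[OF k] w'[OF k] T that t mean[OF k]])
  \<comment> \<open>The energy is of order \<mu>^2, so \<open>\<eta> = \<mu>\<close> gives a
    deviation of order \<mu>. At \<mu> = 0 this choice is not positive; there the energy vanishes
    and \<eta> tends to 0 instead.\<close>
  show ?thesis
  proof (cases "\<mu> = 0")
    case True
    have "\<bar>w k t - c k\<bar> \<le> 0 + \<epsilon>" if "\<epsilon> > 0" for \<epsilon>
    proof -
      have "E k / (2 * \<epsilon> / T) \<le> 0" using E True that T by (intro divide_nonpos_pos) auto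
      then show ?thesis using dev[of "2 * \<epsilon> / T"] that T by simp
    qed
    then have "\<bar>w k t - c k\<bar> \<le> 0" by (rule field_le_epsilon)
    then show ?thesis using True by simp
  next
    case False
    then have p: "\<mu> > 0" using \<mu> by simp
    have "E k / \<mu> \<le> \<mu> * ?D" using E p by (simp add: divide_le_eq power2_eq_square mult.commute mult.left_commute)
    moreover have "(X + \<mu> * T) / 2 \<le> \<mu> * ((D + T) / 2)" if "X \<le> \<mu> * D" for X D
      using that by (simp add: algebra_simps)
    ultimately have "(E k / \<mu> + \<mu> * T) / 2 \<le> \<mu> * ((?D + T) / 2)" by blast
    then show ?thesis using dev[OF p] by linarith
  qed
qed

subsection \<open>The linear chain trick\<close>

text \<open>The sum of \<open>erlang_density j a (t - s) * v (b - j) s\<close> over \<open>j < b\<close> telescopes when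
  differentiated in \<open>s\<close>; below, \<open>p j\<close> is the smooth extension of the density to negative times.\<close>
theorem linear_chain:
  fixes v :: "nat \<Rightarrow> real \<Rightarrow> real"
  assumes a: "a > 0" and b: "b \<ge> 1"
    and v: "\<And>k t. 1 \<le> k \<Longrightarrow> k \<le> b \<Longrightarrow> (v k has_real_derivative a * (v (k - 1) t - v k t)) (at t)"
    and v0: "continuous_on UNIV (v 0)" and bd: "\<And>k t. k \<le> b \<Longrightarrow> \<bar>v k t\<bar> \<le> B"
  shows "(LINT s:{..t}|lborel. erlang_density (b - 1) a (t - s) * v 0 s) = v b t"
proof -
  define p where "p j r = a * (a * r) ^ j / fact j * exp (- (a * r))" for j and r :: real
  have dp0: "(p 0 has_real_derivative - a * p 0 r) (at r)" for r
    unfolding p_def[abs_def] by (auto intro!: derivative_eq_intros)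
  have dpS: "(p (Suc j) has_real_derivative a * (p j r - p (Suc j) r)) (at r)" for j r
  proof -
    have f: "fact (Suc j) = (1 + real j) * fact j" by (simp add: of_nat_Suc)
    define q where "q r = (a * r) ^ Suc j" for r
    have "((\<lambda>r. (a * r) ^ Suc j) has_real_derivative real (Suc j) * (a * r) ^ (Suc j - Suc 0) * a) (at r)"
      by (rule DERIV_chain2[OF DERIV_pow]) (auto intro!: derivative_eq_intros)
    then have "(q has_real_derivative real (Suc j) * a * (a * r) ^ j) (at r)"
      unfolding q_def[abs_def] by (simp add: mult.commute mult.left_commute)
    then have "((\<lambda>r. a * q r / fact (Suc j) * exp (- (a * r))) has_real_derivative
       a * (real (Suc j) * a * (a * r) ^ j) / fact (Suc j) * exp (- (a * r))
       - a * (a * q r / fact (Suc j) * exp (- (a * r)))) (at r)"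
      by (auto intro!: derivative_eq_intros simp: diff_divide_distrib right_diff_distrib mult_ac simp del: fact_Suc)
    then have "(p (Suc j) has_real_derivative
       a * (real (Suc j) * a * (a * r) ^ j) / fact (Suc j) * exp (- (a * r)) - a * p (Suc j) r) (at r)"
      by (simp only: p_def[abs_def] q_def)
    also have "a * (real (Suc j) * a * (a * r) ^ j) / fact (Suc j) * exp (- (a * r)) = a * p j r"
    proof -
      have "a * (N * a * X) / (N * F) * e = a * (a * X / F * e)" if "N \<noteq> 0" for N F X e :: real
        using that by simp
      from this[of "1 + real j"] show ?thesis unfolding p_def f by (simp add: add_eq_0_iff)
    qed
    finally show ?thesis by (simp add: right_diff_distrib)
  qed
  define \<Psi> where "\<Psi> s = (\<Sum>j<b. p j (t - s) * v (b - j) s)" for s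
  \<comment> \<open>The telescoping is an induction over partial sums: the derivative of each new
    term cancels the product left over by the previous ones and leaves one of its own.\<close>
  have d\<Psi>n: "((\<lambda>s. \<Sum>j<n. p j (t - s) * v (b - j) s) has_real_derivative
       (if n = 0 then 0 else a * p (n - 1) (t - s) * v (b - n) s)) (at s)" if "n \<le> b" for n s
    using that
  proof (induction n)
    case (Suc n)
    have dv: "(v (b - n) has_real_derivative a * (v (b - Suc n) s - v (b - n) s)) (at s)"
      using v[of "b - n" s] Suc.prems by simp
    define p' where "p' = (if n = 0 then - a * p 0 (t - s) else a * (p (n - 1) (t - s) - p n (t - s)))"
    have "(p n has_real_derivative p') (at (t - s))"
      unfolding p'_def using dp0 dpS[of "n - 1"] by (cases n) auto
    then have dpn: "((\<lambda>s. p n (t - s)) has_real_derivative p' * (- 1)) (at s)"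
      by (rule DERIV_chain2) (auto intro!: derivative_eq_intros)
    have "((\<lambda>s. (\<Sum>j<n. p j (t - s) * v (b - j) s) + p n (t - s) * v (b - n) s) has_real_derivative
       (if n = 0 then 0 else a * p (n - 1) (t - s) * v (b - n) s) +
       (p' * (- 1) * v (b - n) s + a * (v (b - Suc n) s - v (b - n) s) * p n (t - s))) (at s)"
      by (intro DERIV_add DERIV_mult dpn dv Suc.IH) (use Suc.prems in simp)
    moreover have "(if n = 0 then 0 else a * p (n - 1) (t - s) * v (b - n) s) +
       (p' * (- 1) * v (b - n) s + a * (v (b - Suc n) s - v (b - n) s) * p n (t - s)) =
       a * p n (t - s) * v (b - Suc n) s"
      unfolding p'_def by (auto simp: algebra_simps)
    ultimately show ?case by simp
  qed simp
  have d\<Psi>: "(\<Psi> has_real_derivative a * (p (b - 1) (t - s) * v 0 s)) (at s)" for s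
    using d\<Psi>n[of b s] b unfolding \<Psi>_def[abs_def] by (simp add: mult.assoc)
  have er: "erlang_density (b - 1) a r = (if r < 0 then 0 else p (b - 1) r)" for r
    unfolding erlang_density_def p_def by (simp add: power_mult_distrib)
  have inter: "integrable lborel (erlang_density (b - 1) a)"
  proof -
    interpret P: prob_space "density lborel (erlang_density (b - 1) a)"
      using a by (rule prob_space_erlang_density)
    have "integrable (density lborel (erlang_density (b - 1) a)) (\<lambda>_. 1 :: real)"
      by (rule P.integrable_const)
    then show ?thesis using a
      by (subst (asm) integrable_density) (auto simp: erlang_density_nonneg)
  qed
  have cont: "continuous_on UNIV (\<lambda>s. p (b - 1) (t - s) * v 0 s)"
    unfolding p_def by (intro continuous_intros v0) auto
  have integ: "set_integrable lborel (einterval (-\<infinity>) (ereal t)) (\<lambda>s. a * (p (b - 1) (t - s) * v 0 s))"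
  proof -
    have "integrable lborel (\<lambda>s. erlang_density (b - 1) a (t + (-1) * s))"
      using lborel_integrable_real_affine[OF inter, of "-1" t] by simp
    then have 1: "integrable lborel (\<lambda>s. a * B * erlang_density (b - 1) a (t - s))" by simp
    show ?thesis
      unfolding set_integrable_def
    proof (rule Bochner_Integration.integrable_bound[OF 1])
      have "(\<lambda>s. a * (p (b - 1) (t - s) * v 0 s)) \<in> borel_measurable borel"
        using cont by (intro borel_measurable_continuous_onI continuous_on_mult_left)
      then have "(\<lambda>s. a * (p (b - 1) (t - s) * v 0 s)) \<in> borel_measurable lborel"
        unfolding measurable_lborel2 .
      then show "(\<lambda>s. indicator (einterval (-\<infinity>) (ereal t)) s *\<^sub>R (a * (p (b - 1) (t - s) * v 0 s))) \<in> borel_measurable lborel"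
        by (intro borel_measurable_scaleR borel_measurable_indicator) auto
      have B: "0 \<le> B" using bd[of 0 0] by linarith
      show "AE s in lborel. norm (indicator (einterval (-\<infinity>) (ereal t)) s *\<^sub>R (a * (p (b - 1) (t - s) * v 0 s)))
         \<le> norm (a * B * erlang_density (b - 1) a (t - s))"
      proof (intro AE_I2)
        fix s
        show "norm (indicator (einterval (-\<infinity>) (ereal t)) s *\<^sub>R (a * (p (b - 1) (t - s) * v 0 s)))
         \<le> norm (a * B * erlang_density (b - 1) a (t - s))"
        proof (cases "s < t")
          case True
          have "a * \<bar>p (b - 1) (t - s)\<bar> * \<bar>v 0 s\<bar> \<le> a * \<bar>p (b - 1) (t - s)\<bar> * B"
            using a bd[of 0 s] by (intro mult_left_mono) auto
          moreover have "\<bar>p (b - 1) (t - s)\<bar> = erlang_density (b - 1) a (t - s)"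
            using True a er[of "t - s"] erlang_density_nonneg[of a "b - 1" "t - s"] by simp
          ultimately show ?thesis using True a B
            by (simp add: einterval_def abs_mult mult.commute mult.left_commute)
        qed (simp add: einterval_def)
      qed
    qed
  qed
  have pj: "((\<lambda>s. p j (t - s)) \<longlongrightarrow> 0) at_bot" for j
  proof -
    have *: "filterlim (\<lambda>s. a * (t - s)) at_top at_bot"
      using a by real_asymp
    have "((\<lambda>s. a / fact j * ((a * (t - s)) ^ j / exp (a * (t - s)))) \<longlongrightarrow> a / fact j * 0) at_bot"
      by (intro tendsto_intros filterlim_compose[OF tendsto_power_div_exp_0 *])
    moreover have "p j (t - s) = a / fact j * ((a * (t - s)) ^ j / exp (a * (t - s)))" for s
      unfolding p_def exp_minus by (simp add: divide_inverse mult_ac)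
    ultimately show ?thesis by simp
  qed
  have lim0: "(\<Psi> \<longlongrightarrow> 0) at_bot"
    unfolding \<Psi>_def
  proof (rule tendsto_null_sum)
    fix j assume "j \<in> {..<b}"
    show "((\<lambda>s. p j (t - s) * v (b - j) s) \<longlongrightarrow> 0) at_bot"
    proof (rule Lim_null_comparison)
      show "\<forall>\<^sub>F s in at_bot. norm (p j (t - s) * v (b - j) s) \<le> \<bar>p j (t - s)\<bar> * B"
        using bd by (intro always_eventually allI) (simp add: abs_mult mult_left_mono)
      show "((\<lambda>s. \<bar>p j (t - s)\<bar> * B) \<longlongrightarrow> 0) at_bot"
        using tendsto_mult_left_zero[OF tendsto_rabs_zero[OF pj]] by simp
    qed
  qed
  \<comment> \<open>At zero delay only \<open>p 0\<close> is nonzero, with value \<open>a\<close>;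
    this factor cancels the \<open>a\<close> in front of the integrand at the end.\<close>
  have \<Psi>t: "\<Psi> t = a * v b t"
  proof -
    have "\<Psi> t = (\<Sum>j\<in>{0}. p j 0 * v (b - j) t)"
      unfolding \<Psi>_def using b by (intro sum.mono_neutral_cong_right) (auto simp: p_def)
    then show ?thesis by (simp add: p_def)
  qed
  have "(LBINT s=-\<infinity>..ereal t. a * (p (b - 1) (t - s) * v 0 s)) = \<Psi> t - 0"
  proof (rule interval_integral_FTC_integrable[of "-\<infinity>" "ereal t" \<Psi>])
    show "(\<Psi> has_vector_derivative a * (p (b - 1) (t - s) * v 0 s)) (at s)" for s
      using d\<Psi>[of s] by (simp add: has_real_derivative_iff_has_vector_derivative)
    show "isCont (\<lambda>s. a * (p (b - 1) (t - s) * v 0 s)) s" for s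
      using continuous_on_mult_left[OF cont, of a] by (simp add: continuous_on_eq_continuous_at)
    show "((\<Psi> \<circ> real_of_ereal) \<longlongrightarrow> 0) (at_right (-\<infinity>))"
      using lim0 by (simp add: ereal_tendsto_simps1)
    have "isCont \<Psi> t" using d\<Psi> DERIV_isCont by blast
    then show "((\<Psi> \<circ> real_of_ereal) \<longlongrightarrow> \<Psi> t) (at_left (ereal t))"
      by (simp add: ereal_tendsto_simps1 isCont_def filterlim_at_split)
  qed (use integ in auto)
  then have "(LINT s:{..<t}|lborel. a * (p (b - 1) (t - s) * v 0 s)) = a * v b t"
    by (simp add: interval_lebesgue_integral_def \<Psi>t einterval_def lessThan_def)
  \<comment> \<open>The fundamental theorem was applied on the open half-line with the smooth
    \<open>p\<close>; the end point is a null set, and \<open>p (b - 1)\<close> agrees with the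
    density at nonnegative arguments.\<close>
  moreover have "(LINT s:{..t}|lborel. erlang_density (b - 1) a (t - s) * v 0 s) =
      (LINT s:{..<t}|lborel. p (b - 1) (t - s) * v 0 s)"
    unfolding set_lebesgue_integral_def
  proof (rule Bochner_Integration.integral_cong_AE)
    have "(\<lambda>s. p (b - 1) (t - s) * v 0 s) \<in> borel_measurable borel"
      using cont by (rule borel_measurable_continuous_onI)
    then have "(\<lambda>s. p (b - 1) (t - s) * v 0 s) \<in> borel_measurable lborel"
      unfolding measurable_lborel2 .
    then show "(\<lambda>s. indicator {..<t} s *\<^sub>R (p (b - 1) (t - s) * v 0 s)) \<in> borel_measurable lborel"
      by (intro borel_measurable_scaleR borel_measurable_indicator) auto
    have "v 0 \<in> borel_measurable borel" using v0 by (rule borel_measurable_continuous_onI)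
    then show "(\<lambda>s. indicator {..t} s *\<^sub>R (erlang_density (b - 1) a (t - s) * v 0 s)) \<in> borel_measurable lborel"
      by measurable
    show "AE s in lborel. indicator {..t} s *\<^sub>R (erlang_density (b - 1) a (t - s) * v 0 s) =
        indicator {..<t} s *\<^sub>R (p (b - 1) (t - s) * v 0 s)"
      using AE_lborel_singleton[of t] by eventually_elim (auto simp: er[simplified] indicator_def)
  qed
  ultimately show ?thesis using a by simp
qed

subsection \<open>Spaces of periodic functions\<close>

text \<open>The value type is arbitrary so that \<open>h\<close> may be a tuple: one representative
  in [0, T] then serves several functions at once.\<close>

lemma periodic_representative:
  fixes h :: "real \<Rightarrow> 'a"
  assumes per: "\<And>t. h (t + T) = h t" and T: "0 < T"
  obtains s where "s \<in> {0..T}" "h t = h s"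
proof -
  interpret periodic_fun_simple h T by unfold_locales (rule per)
  define k where "k = \<lfloor>t / T\<rfloor>"
  have "of_int k \<le> t / T" "t / T < of_int k + 1" unfolding k_def by linarith+
  then have "of_int k * T \<le> t" "t < (of_int k + 1) * T" using T by (simp_all add: field_simps)
  then have "t - of_int k * T \<in> {0..T}" by (simp add: algebra_simps)
  moreover have "h t = h (t - of_int k * T)" by (rule minus_of_int[symmetric])
  ultimately show ?thesis by (rule that)
qed

text \<open>The uniform distance controls a change of the function, and continuity of the fixed
  function controls a change of the argument. A rule of \<open>continuous_intros\<close> because
  every component of the vector field is built from such evaluations.\<close>

lemma continuous_on_apply_bcontfun2 [continuous_intros]:
  fixes W :: "'x::topological_space \<Rightarrow> 'a::t2_space \<Rightarrow>\<^sub>C 'b::metric_space"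
  assumes "continuous_on X W" "continuous_on X z"
  shows "continuous_on X (\<lambda>x. apply_bcontfun (W x) (z x))"
proof -
  let ?ev = "\<lambda>y :: ('a \<Rightarrow>\<^sub>C 'b) \<times> 'a. apply_bcontfun (fst y) (snd y)"
  have "continuous_on UNIV ?ev"
  proof (rule continuous_at_imp_continuous_on, rule ballI)
    fix y :: "('a \<Rightarrow>\<^sub>C 'b) \<times> 'a"
    have "isCont (apply_bcontfun (fst y)) (snd y)"
      using continuous_on_apply_bcontfun[of UNIV "fst y"]
      unfolding continuous_on_eq_continuous_at[OF open_UNIV] by blast
    then have "((\<lambda>x. apply_bcontfun (fst y) (snd x)) \<longlongrightarrow> apply_bcontfun (fst y) (snd y)) (at y)"
      by (rule isCont_tendsto_compose) (intro tendsto_snd tendsto_ident_at)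
    then have l1: "((\<lambda>x. dist (apply_bcontfun (fst y) (snd x)) (?ev y)) \<longlongrightarrow> 0) (at y)"
      by (rule tendsto_dist_iff[THEN iffD1])
    have "((\<lambda>x. dist (fst x) (fst y)) \<longlongrightarrow> dist (fst y) (fst y)) (at y)"
      by (intro tendsto_intros)
    then have "((\<lambda>x. dist (fst x) (fst y) + dist (apply_bcontfun (fst y) (snd x)) (?ev y)) \<longlongrightarrow> 0) (at y)"
      using tendsto_add[OF _ l1] by fastforce
    then have "((\<lambda>x. dist (?ev x) (?ev y)) \<longlongrightarrow> 0) (at y)"
    proof (rule Lim_null_comparison[rotated], intro always_eventually allI)
      fix x :: "('a \<Rightarrow>\<^sub>C 'b) \<times> 'a"
      have "dist (?ev x) (apply_bcontfun (fst y) (snd x)) \<le> dist (fst x) (fst y)" by (rule dist_bounded)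
      then show "norm (dist (?ev x) (?ev y)) \<le> dist (fst x) (fst y) + dist (apply_bcontfun (fst y) (snd x)) (?ev y)"
        using dist_triangle[of "?ev x" "?ev y" "apply_bcontfun (fst y) (snd x)"] by simp
    qed
    then show "isCont ?ev y"
      unfolding isCont_def by (rule tendsto_dist_iff[THEN iffD2])
  qed
  then have "continuous_on X (\<lambda>x. (\<lambda>y. apply_bcontfun (fst y) (snd y)) (W x, z x))"
    by (rule continuous_on_compose2) (auto intro!: continuous_intros assms)
  then show ?thesis by simp
qed

lemma continuous_on_discrete_snd:
  fixes F :: "'a::topological_space \<Rightarrow> nat \<Rightarrow> 'b::topological_space"
  assumes "\<And>k. continuous_on UNIV (\<lambda>x. F x k)"
  shows "continuous_on UNIV (\<lambda>z. F (fst z) (snd z))"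
proof -
  have "continuous_on (\<Union>k. UNIV \<times> {k}) (\<lambda>z. F (fst z) (snd z))"
  proof (rule continuous_on_open_UN)
    show "open (UNIV \<times> {k} :: ('a \<times> nat) set)" for k by (intro open_Times open_UNIV discrete_topology_class.open_discrete)
    show "continuous_on (UNIV \<times> {k}) (\<lambda>z. F (fst z) (snd z))" for k
    proof -
      have "continuous_on (UNIV \<times> {k}) (\<lambda>z. F (fst z) k)"
        by (rule continuous_on_compose2[OF assms[of k]]) (auto intro!: continuous_intros)
      then show ?thesis by (rule continuous_on_eq) auto
    qed
  qed
  moreover have "(\<Union>k. UNIV \<times> {k}) = (UNIV :: ('a \<times> nat) set)" by auto
  ultimately show ?thesis by simp
qed

text \<open>Uniform continuity estimates range over all times; periodicity reduces them to the
  compact \<open>{0..T}\<close>, where a tube argument for each of the \<open>m\<close> components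
  suffices. This is how formulas in \<open>x\<close> and \<open>t\<close> become continuous maps
  into the function space.\<close>

lemma Bcontfun_param:
  fixes F :: "'x::topological_space \<Rightarrow> real \<Rightarrow> nat \<Rightarrow> real" and T :: real
  assumes cont: "\<And>k. k < m \<Longrightarrow> continuous_on (X \<times> UNIV) (\<lambda>(x, t). F x t k)"
    and per: "\<And>x t k. x \<in> X \<Longrightarrow> F x (t + T) k = F x t k"
    and zero: "\<And>x t k. m \<le> k \<Longrightarrow> F x t k = 0" and T: "0 < T"
  shows apply_Bcontfun_param: "x \<in> X \<Longrightarrow> apply_bcontfun (Bcontfun (\<lambda>z. F x (fst z) (snd z))) (t, k) = F x t k"
    and continuous_on_Bcontfun_param: "continuous_on X (\<lambda>x. Bcontfun (\<lambda>z. F x (fst z) (snd z)))"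
proof -
  have Fk: "continuous_on UNIV (\<lambda>t. F x t k)" if x: "x \<in> X" for x k
  proof (cases "k < m")
    case True
    have "continuous_on UNIV (\<lambda>t. (\<lambda>(x, t). F x t k) (x, t))"
      by (rule continuous_on_compose2[OF cont[OF True]]) (use x in \<open>auto intro!: continuous_intros\<close>)
    then show ?thesis by simp
  qed (simp add: zero)
  have mem: "(\<lambda>z. F x (fst z) (snd z)) \<in> bcontfun" if x: "x \<in> X" for x
  proof -
    have "\<exists>B. \<forall>t\<in>{0..T}. \<bar>F x t k\<bar> \<le> B" for k
    proof -
      have "compact ((\<lambda>t. F x t k) ` {0..T})"
        by (intro compact_continuous_image continuous_on_subset[OF Fk[OF x]]) auto
      then have "bounded ((\<lambda>t. F x t k) ` {0..T})" by (rule compact_imp_bounded)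
      then show ?thesis by (auto simp: bounded_iff)
    qed
    then obtain B where B: "\<And>k t. t \<in> {0..T} \<Longrightarrow> \<bar>F x t k\<bar> \<le> B k" by metis
    show ?thesis
    proof (rule bcontfun_normI)
      show "continuous_on UNIV (\<lambda>z. F x (fst z) (snd z))"
        by (rule continuous_on_discrete_snd[OF Fk[OF x]])
      fix z :: "real \<times> nat"
      obtain s where s: "s \<in> {0..T}" "F x (fst z) = F x s"
        by (rule periodic_representative[of "F x" T "fst z"]) (use per[OF x] T in auto)
      have "\<bar>F x s (snd z)\<bar> \<le> (\<Sum>k<m. \<bar>B k\<bar>)"
      proof (cases "snd z < m")
        case True
        have "\<bar>F x s (snd z)\<bar> \<le> \<bar>B (snd z)\<bar>" using B[OF s(1), of "snd z"] by linarith
        also have "\<dots> \<le> (\<Sum>k<m. \<bar>B k\<bar>)" using True by (intro member_le_sum) auto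
        finally show ?thesis .
      qed (simp add: zero sum_nonneg)
      then show "norm (F x (fst z) (snd z)) \<le> (\<Sum>k<m. \<bar>B k\<bar>)" using s by simp
    qed
  qed
  show ap: "apply_bcontfun (Bcontfun (\<lambda>z. F x (fst z) (snd z))) (t, k) = F x t k" if "x \<in> X" for x t k
    using Bcontfun_inverse[OF mem[OF that]] by simp
  show "continuous_on X (\<lambda>x. Bcontfun (\<lambda>z. F x (fst z) (snd z)))"
    unfolding continuous_on_topological
  proof (intro ballI allI impI)
    fix x0 B assume x0: "x0 \<in> X" and B: "open B" "Bcontfun (\<lambda>z. F x0 (fst z) (snd z)) \<in> B"
    then obtain e where e: "e > 0" "ball (Bcontfun (\<lambda>z. F x0 (fst z) (snd z))) e \<subseteq> B"
      using open_contains_ball by blast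
    have "\<exists>U. open U \<and> x0 \<in> U \<and> (\<forall>x\<in>U \<inter> X. \<forall>t\<in>{0..T}. dist (F x t k) (F x0 t k) \<le> e / 2)" if k: "k < m" for k
    proof -
      have "continuous_on (X \<times> {0..T}) (\<lambda>(x, t). F x t k)"
        by (rule continuous_on_subset[OF cont[OF k]]) auto
      then show ?thesis
        using continuous_on_prod_compactE[of X "{0..T}" "\<lambda>(x, t). F x t k" x0 "e / 2"] x0 e(1)
        by (metis case_prod_conv compact_Icc half_gt_zero)
    qed
    then obtain U where U: "\<And>k. k < m \<Longrightarrow> open (U k) \<and> x0 \<in> U k \<and> (\<forall>x\<in>U k \<inter> X. \<forall>t\<in>{0..T}. dist (F x t k) (F x0 t k) \<le> e / 2)"
      by metis
    have "\<forall>x\<in>X. x \<in> (\<Inter>k<m. U k) \<longrightarrow> Bcontfun (\<lambda>z. F x (fst z) (snd z)) \<in> B"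
    proof (intro ballI impI)
      fix x assume x: "x \<in> X" "x \<in> (\<Inter>k<m. U k)"
      have "dist (Bcontfun (\<lambda>z. F x (fst z) (snd z))) (Bcontfun (\<lambda>z. F x0 (fst z) (snd z))) \<le> e / 2"
      proof (rule dist_bound)
        fix z :: "real \<times> nat"
        obtain t k where z: "z = (t, k)" by force
        obtain s where s: "s \<in> {0..T}" "(F x t, F x0 t) = (F x s, F x0 s)"
          by (rule periodic_representative[of "\<lambda>t. (F x t, F x0 t)" T t]) (use per x x0 T in auto)
        have "dist (F x s k) (F x0 s k) \<le> e / 2"
          using U[of k] x s(1) e(1) by (cases "k < m") (auto simp: zero)
        then show "dist (apply_bcontfun (Bcontfun (\<lambda>z. F x (fst z) (snd z))) z)
            (apply_bcontfun (Bcontfun (\<lambda>z. F x0 (fst z) (snd z))) z) \<le> e / 2"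
          using s(2) by (simp add: z ap x(1) x0)
      qed
      then show "Bcontfun (\<lambda>z. F x (fst z) (snd z)) \<in> B"
        using e by (intro subsetD[OF e(2)]) (simp add: dist_commute)
    qed
    moreover have "open (\<Inter>k<m. U k)" "x0 \<in> (\<Inter>k<m. U k)" using U by (auto intro!: open_INT)
    ultimately show "\<exists>A. open A \<and> x0 \<in> A \<and> (\<forall>y\<in>X. y \<in> A \<longrightarrow> Bcontfun (\<lambda>z. F y (fst z) (snd z)) \<in> B)"
      by blast
  qed
qed

text \<open>The Arzela-Ascoli set on which Schauder's theorem is used. The bound \<open>R\<close>
  depends on the component, since components 0 and 1 must be bounded before \<phi> of them can
  be.\<close>

definition lip_functions :: "real \<Rightarrow> nat \<Rightarrow> real \<Rightarrow> (nat \<Rightarrow> real) \<Rightarrow> ((real \<times> nat) \<Rightarrow>\<^sub>C real) set" where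
  "lip_functions T m M R = {w :: (real \<times> nat) \<Rightarrow>\<^sub>C real. (\<forall>t k. apply_bcontfun w (t + T, k) = apply_bcontfun w (t, k)) \<and> (\<forall>s t k. \<bar>apply_bcontfun w (s, k) - apply_bcontfun w (t, k)\<bar> \<le> M * \<bar>s - t\<bar>) \<and>
     (\<forall>t k. \<bar>apply_bcontfun w (t, k)\<bar> \<le> R k) \<and> (\<forall>t k. m \<le> k \<longrightarrow> apply_bcontfun w (t, k) = 0)}"

lemma convex_lip_functions: "convex (lip_functions T m M R)"
proof (rule convexI)
  fix v w :: "(real \<times> nat) \<Rightarrow>\<^sub>C real" and x y :: real
  assume vw: "v \<in> lip_functions T m M R" "w \<in> lip_functions T m M R" and xy: "0 \<le> x" "0 \<le> y" "x + y = 1"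
  have "\<bar>x * apply_bcontfun v (s, k) + y * apply_bcontfun w (s, k) - (x * apply_bcontfun v (t, k) + y * apply_bcontfun w (t, k))\<bar> \<le> M * \<bar>s - t\<bar>" for s t k
  proof -
    have "\<bar>x * apply_bcontfun v (s, k) + y * apply_bcontfun w (s, k) - (x * apply_bcontfun v (t, k) + y * apply_bcontfun w (t, k))\<bar> \<le> x * \<bar>apply_bcontfun v (s, k) - apply_bcontfun v (t, k)\<bar> + y * \<bar>apply_bcontfun w (s, k) - apply_bcontfun w (t, k)\<bar>"
    proof -
      have "x * apply_bcontfun v (s, k) + y * apply_bcontfun w (s, k) - (x * apply_bcontfun v (t, k) + y * apply_bcontfun w (t, k))
          = x * (apply_bcontfun v (s, k) - apply_bcontfun v (t, k)) + y * (apply_bcontfun w (s, k) - apply_bcontfun w (t, k))"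
        by (simp add: algebra_simps)
      then show ?thesis
        using xy abs_triangle_ineq[of "x * (apply_bcontfun v (s, k) - apply_bcontfun v (t, k))" "y * (apply_bcontfun w (s, k) - apply_bcontfun w (t, k))"]
        by (simp only: abs_mult abs_of_nonneg)
    qed
    also have "\<dots> \<le> x * (M * \<bar>s - t\<bar>) + y * (M * \<bar>s - t\<bar>)"
      using vw xy by (intro add_mono mult_left_mono) (auto simp: lip_functions_def)
    finally show ?thesis using xy by (simp flip: distrib_right)
  qed
  moreover have "\<bar>x * apply_bcontfun v (t, k) + y * apply_bcontfun w (t, k)\<bar> \<le> R k" for t k
  proof -
    have "\<bar>x * apply_bcontfun v (t, k) + y * apply_bcontfun w (t, k)\<bar> \<le> x * \<bar>apply_bcontfun v (t, k)\<bar> + y * \<bar>apply_bcontfun w (t, k)\<bar>"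
      using xy abs_triangle_ineq[of "x * apply_bcontfun v (t, k)" "y * apply_bcontfun w (t, k)"] by (simp add: abs_mult)
    also have "\<dots> \<le> x * R k + y * R k"
      using vw xy by (intro add_mono mult_left_mono) (auto simp: lip_functions_def)
    finally show ?thesis using xy by (simp flip: distrib_right)
  qed
  ultimately show "x *\<^sub>R v + y *\<^sub>R w \<in> lip_functions T m M R"
    using vw by (simp add: lip_functions_def)
qed

lemma closed_lip_functions: "closed (lip_functions T m M R)"
  unfolding lip_functions_def
  by (intro closed_Collect_conj closed_Collect_all closed_Collect_imp closed_Collect_eq closed_Collect_le continuous_intros open_Collect_const)

text \<open>Arzela-Ascoli on one period; periodicity spreads the uniform convergence of the
  subsequence to all times, and the Cauchy criterion gives a limit that is again bounded and
  continuous.\<close>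

lemma compact_lip_functions:
  assumes T: "0 < T"
  shows "compact (lip_functions T m M R)"
  unfolding compact_eq_seq_compact_metric
proof (rule seq_compactI)
  fix f :: "nat \<Rightarrow> (real \<times> nat) \<Rightarrow>\<^sub>C real" assume f: "\<forall>n. f n \<in> lip_functions T m M R"
  have per: "apply_bcontfun (f n) (t + T, k) = apply_bcontfun (f n) (t, k)" and lip: "\<bar>apply_bcontfun (f n) (s, k) - apply_bcontfun (f n) (t, k)\<bar> \<le> M * \<bar>s - t\<bar>"
    and bd: "\<bar>apply_bcontfun (f n) (t, k)\<bar> \<le> R k" and zero: "m \<le> k \<Longrightarrow> apply_bcontfun (f n) (t, k) = 0" for n s t k
    using f by (auto simp: lip_functions_def)
  \<comment> \<open>Times and component indices together form a compact subset of the plane.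
    Distinct indices are at distance at least 1, so \<open>d\<close>, being at most 1 below,
    confines each comparison to one component.\<close>
  define S where "S = {0..T} \<times> real ` {..<m}"
  define F where "F n x = apply_bcontfun (f n) (fst x, nat \<lfloor>snd x\<rfloor>)" for n and x :: "real \<times> real"
  have Fk: "F n (t, real k) = apply_bcontfun (f n) (t, k)" for n t k by (simp add: F_def)
  have "compact S" unfolding S_def by (intro compact_Times compact_Icc finite_imp_compact) auto
  moreover have "norm (F n x) \<le> (\<Sum>k<m. \<bar>R k\<bar>)" if xS: "x \<in> S" for n x
  proof -
    obtain t k where x: "x = (t, real k)" "k < m" using xS by (auto simp: S_def)
    have "\<bar>apply_bcontfun (f n) (t, k)\<bar> \<le> \<bar>R k\<bar>" using bd[of n t k] by linarith
    also have "\<dots> \<le> (\<Sum>k<m. \<bar>R k\<bar>)" using x by (intro member_le_sum) auto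
    finally show ?thesis by (simp add: x Fk)
  qed
  moreover have "\<exists>d. 0 < d \<and> (\<forall>n y. y \<in> S \<and> norm (x - y) < d \<longrightarrow> norm (F n x - F n y) < e)" if xS: "x \<in> S" and e: "0 < e" for x e
  proof -
    obtain t k where x: "x = (t, real k)" "k < m" using xS by (auto simp: S_def)
    define d where "d = min 1 (e / (\<bar>M\<bar> + 1))"
    have "norm (F n x - F n y) < e" if y: "y \<in> S" "norm (x - y) < d" for n y
    proof -
      obtain s j where s: "y = (s, real j)" "j < m" using y by (auto simp: S_def)
      have "\<bar>t - s\<bar> < d" "\<bar>real k - real j\<bar> < d"
        using dist_fst_le[of x y] dist_snd_le[of x y] y(2)[folded dist_norm]
        by (simp_all add: x s dist_real_def)
      then have "\<bar>t - s\<bar> < e / (\<bar>M\<bar> + 1)" and "j = k" by (auto simp: d_def)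
      then have "(\<bar>M\<bar> + 1) * \<bar>t - s\<bar> < e" by (simp add: field_simps)
      moreover have "\<bar>apply_bcontfun (f n) (t, k) - apply_bcontfun (f n) (s, k)\<bar> \<le> M * \<bar>t - s\<bar>" by (rule lip)
      moreover have "M * \<bar>t - s\<bar> \<le> (\<bar>M\<bar> + 1) * \<bar>t - s\<bar>" by (intro mult_right_mono) auto
      ultimately show ?thesis by (simp add: x s \<open>j = k\<close> Fk)
    qed
    moreover have "0 < d" using e by (simp add: d_def)
    ultimately show ?thesis by blast
  qed
  ultimately obtain l r where r: "strict_mono (r :: nat \<Rightarrow> nat)"
    and l: "\<And>e. 0 < e \<Longrightarrow> \<exists>N. \<forall>n x. n \<ge> N \<and> x \<in> S \<longrightarrow> norm (F (r n) x - l x) < e"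
    using Arzela_Ascoli[of S F] by metis
  have "Cauchy (f \<circ> r)"
  proof (rule metric_CauchyI)
    fix e :: real assume e: "0 < e"
    obtain N where N: "\<And>n x. n \<ge> N \<Longrightarrow> x \<in> S \<Longrightarrow> norm (F (r n) x - l x) < e / 3"
      using l[of "e / 3"] e by auto
    have "dist ((f \<circ> r) i) ((f \<circ> r) j) < e" if ij: "i \<ge> N" "j \<ge> N" for i j
    proof -
      have "dist (f (r i)) (f (r j)) \<le> 2 * e / 3"
      proof (rule dist_bound)
        fix z :: "real \<times> nat"
        obtain t k where z: "z = (t, k)" by force
        obtain s where s: "s \<in> {0..T}" "(apply_bcontfun (f (r i)) (t, k), apply_bcontfun (f (r j)) (t, k)) = (apply_bcontfun (f (r i)) (s, k), apply_bcontfun (f (r j)) (s, k))"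
          by (rule periodic_representative[of "\<lambda>t. (apply_bcontfun (f (r i)) (t, k), apply_bcontfun (f (r j)) (t, k))" T t]) (use per T in auto)
        show "dist (apply_bcontfun (f (r i)) z) (apply_bcontfun (f (r j)) z) \<le> 2 * e / 3"
        proof (cases "k < m")
          case True
          then have "(s, real k) \<in> S" using s by (auto simp: S_def)
          then have "\<bar>apply_bcontfun (f (r i)) (s, k) - l (s, real k)\<bar> < e / 3" "\<bar>apply_bcontfun (f (r j)) (s, k) - l (s, real k)\<bar> < e / 3"
            using N[OF ij(1), of "(s, real k)"] N[OF ij(2), of "(s, real k)"] by (auto simp: Fk)
          then have "\<bar>apply_bcontfun (f (r i)) (s, k) - apply_bcontfun (f (r j)) (s, k)\<bar> \<le> 2 * e / 3"
            by linarith
          then show ?thesis using s(2) by (simp add: z dist_real_def)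
        next
          case False
          then show ?thesis using e by (simp add: z zero)
        qed
      qed
      then show ?thesis using e by simp
    qed
    then show "\<exists>N. \<forall>i\<ge>N. \<forall>j\<ge>N. dist ((f \<circ> r) i) ((f \<circ> r) j) < e" by blast
  qed
  then obtain g where "uniform_limit UNIV (\<lambda>n. apply_bcontfun ((f \<circ> r) n)) g sequentially"
    using uniformly_convergent_eq_cauchy[of "\<lambda>_. True" "\<lambda>n. apply_bcontfun ((f \<circ> r) n)"]
    unfolding Cauchy_def uniform_limit_sequentially_iff
    by (metis dist_fun_lt_imp_dist_val_lt)
  from uniform_limit_bcontfunE[OF this sequentially_bot]
  obtain w where w: "(f \<circ> r) \<longlonglongrightarrow> w" by metis
  moreover have "w \<in> lip_functions T m M R"
    by (rule closed_sequentially[OF closed_lip_functions _ w]) (use f in simp)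
  ultimately show "\<exists>l\<in>lip_functions T m M R. \<exists>r. strict_mono r \<and> (f \<circ> r) \<longlonglongrightarrow> l" using r by blast
qed

subsection \<open>Periodic primitives\<close>

lemma integral_periodic_shift:
  fixes h :: "real \<Rightarrow> real"
  assumes h: "continuous_on UNIV h" and per: "\<And>t. h (t + T) = h t" and T: "0 < T"
    and Q: "\<And>t. (Q has_real_derivative h t) (at t)"
  shows "Q (t + T) - Q t = integral {0..T} h"
proof -
  have "((\<lambda>t. Q (t + T) - Q t) has_real_derivative 0) (at t)" for t
    using DERIV_shift[of Q "h (t + T)" t T] Q[of "t + T"] Q[of t] per[of t]
    by (auto intro!: derivative_eq_intros)
  then have "Q (t + T) - Q t = Q (0 + T) - Q 0"
    using DERIV_isconst_all[of "\<lambda>t. Q (t + T) - Q t" t 0] by blast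
  also have "(h has_integral (Q T - Q 0)) {0..T}"
    using T by (intro fundamental_theorem_of_calculus)
      (auto simp flip: has_real_derivative_iff_has_vector_derivative intro: has_field_derivative_at_within Q)
  then have "Q (0 + T) - Q 0 = integral {0..T} h" by (simp add: integral_unique)
  finally show ?thesis .
qed

text \<open>The zero-mean periodic primitive of \<open>h\<close> minus its mean, written so that it depends
  on \<open>h\<close> through one integral over a fixed interval.\<close>
definition periodic_primitive :: "real \<Rightarrow> (real \<Rightarrow> real) \<Rightarrow> real \<Rightarrow> real" where
  "periodic_primitive T h t = integral {0..T} (\<lambda>s. (s - T / 2) * h (t + s)) / T"

lemma periodic_primitive_periodic:
  assumes "\<And>t. h (t + T) = h t"
  shows "periodic_primitive T h (t + T) = periodic_primitive T h t"
proof -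
  have "h (t + T + s) = h (t + s)" for s
    using assms[of "t + s"] by (simp add: add_ac)
  then show ?thesis by (simp add: periodic_primitive_def)
qed

text \<open>With antiderivatives \<open>Q\<close> of \<open>h\<close> and \<open>R\<close> of
  \<open>Q\<close>, integration by parts gives a formula in the values of \<open>Q\<close> and
  \<open>R\<close> at \<open>t\<close> and \<open>t + T\<close> only. Its derivative is
  \<open>h t\<close> minus \<open>(Q (t + T) - Q t) / T\<close>, which is the mean of
  \<open>h\<close>.\<close>

lemma DERIV_periodic_primitive:
  fixes h :: "real \<Rightarrow> real"
  assumes h: "continuous_on UNIV h" and per: "\<And>t. h (t + T) = h t" and T: "0 < T"
  shows "(periodic_primitive T h has_real_derivative h t - integral {0..T} h / T) (at t)"
proof -
  have anti: "\<exists>Q. \<forall>t. (Q has_real_derivative k t) (at t)" if "continuous_on UNIV k" for k :: "real \<Rightarrow> real"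
    using einterval_antiderivative[of "-\<infinity>" "\<infinity>" k] that
    by (auto simp: continuous_on_eq_continuous_at has_real_derivative_iff_has_vector_derivative)
  obtain Q where Q: "\<And>t. (Q has_real_derivative h t) (at t)" using anti[OF h] by blast
  then have "continuous_on UNIV Q" by (meson DERIV_isCont continuous_at_imp_continuous_on)
  then obtain R where R: "\<And>t. (R has_real_derivative Q t) (at t)" using anti by blast
  have eq: "periodic_primitive T h t = (T / 2 * (Q (t + T) + Q t) - (R (t + T) - R t)) / T" for t
  proof -
    have "((\<lambda>s. (s - T / 2) * h (t + s)) has_integral
       ((T - T / 2) * Q (t + T) - R (t + T) - ((0 - T / 2) * Q (t + 0) - R (t + 0)))) {0..T}"
    proof (rule fundamental_theorem_of_calculus)
      fix s assume "s \<in> {0..T}"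
      have "((\<lambda>s. Q (t + s)) has_real_derivative h (t + s)) (at s)" "((\<lambda>s. R (t + s)) has_real_derivative Q (t + s)) (at s)"
        using DERIV_shift[of Q "h (t + s)" s t] DERIV_shift[of R "Q (t + s)" s t] Q[of "t + s"] R[of "t + s"]
        by (simp_all add: add.commute)
      then have "((\<lambda>s. (s - T / 2) * Q (t + s) - R (t + s)) has_real_derivative (s - T / 2) * h (t + s)) (at s)"
        by (auto intro!: derivative_eq_intros)
      then show "((\<lambda>s. (s - T / 2) * Q (t + s) - R (t + s)) has_vector_derivative (s - T / 2) * h (t + s)) (at s within {0..T})"
        by (auto simp flip: has_real_derivative_iff_has_vector_derivative intro: has_field_derivative_at_within)
    qed (use T in simp)
    then show ?thesis unfolding periodic_primitive_def by (simp add: integral_unique algebra_simps)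
  qed
  have sh: "((\<lambda>t. Q (t + T)) has_real_derivative h t) (at t)" "((\<lambda>t. R (t + T)) has_real_derivative Q (t + T)) (at t)"
    using DERIV_shift[of Q "h (t + T)" t T] DERIV_shift[of R "Q (t + T)" t T] Q[of "t + T"] R[of "t + T"] per
    by simp_all
  have "((\<lambda>t. (T / 2 * (Q (t + T) + Q t) - (R (t + T) - R t)) / T) has_real_derivative
      (T / 2 * (h t + h t) - (Q (t + T) - Q t)) / T) (at t)"
    by (intro DERIV_cdivide DERIV_diff DERIV_cmult DERIV_add sh Q R)
  moreover have "(T / 2 * (h t + h t) - (Q (t + T) - Q t)) / T = h t - integral {0..T} h / T"
    using T by (simp add: integral_periodic_shift[OF h per T Q] diff_divide_distrib)
  ultimately show ?thesis unfolding eq[abs_def] by simp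
qed

text \<open>Fubini: the integral of \<open>h (t + s)\<close> over a period in \<open>t\<close> is
  the same for every \<open>s\<close>, and the weight \<open>s - T / 2\<close> has integral 0. This
  is why the weight is centred.\<close>

lemma integral_periodic_primitive:
  fixes h :: "real \<Rightarrow> real"
  assumes h: "continuous_on UNIV h" and per: "\<And>t. h (t + T) = h t" and T: "0 < T"
  shows "integral {0..T} (periodic_primitive T h) = 0"
proof -
  have c: "continuous_on (cbox (0, 0) (T, T)) (\<lambda>(t, s). (s - T / 2) * h (t + s))"
    unfolding case_prod_unfold by (intro continuous_intros continuous_on_compose2[OF h]) auto
  have "integral {0..T} (\<lambda>t. integral {0..T} (\<lambda>s. (s - T / 2) * h (t + s)))
     = integral {0..T} (\<lambda>s. integral {0..T} (\<lambda>t. (s - T / 2) * h (t + s)))"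
    using integral_swap_continuous[OF c] by simp
  also have "\<dots> = integral {0..T} (\<lambda>s. (s - T / 2) * integral {0..T} h)"
  proof (rule Henstock_Kurzweil_Integration.integral_cong)
    fix s assume s: "s \<in> {0..T}"
    have "integral {0..T} (h \<circ> (\<lambda>t. t + s)) = integral {0 + s..T + s} h"
      by (rule integral_shift) (rule continuous_on_subset[OF h], simp)
    also have "\<dots> = integral {0..T} h"
      using integral_periodic[OF h per, of s] s by (simp add: add.commute)
    finally show "integral {0..T} (\<lambda>t. (s - T / 2) * h (t + s)) = (s - T / 2) * integral {0..T} h"
      by (simp add: o_def)
  qed
  also have "\<dots> = 0"
  proof -
    have "((\<lambda>s. s - T / 2) has_integral ((T\<^sup>2 / 2 - T / 2 * T) - (0\<^sup>2 / 2 - T / 2 * 0))) {0..T}"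
      using T by (intro fundamental_theorem_of_calculus)
        (auto simp flip: has_real_derivative_iff_has_vector_derivative intro!: derivative_eq_intros)
    then have "integral {0..T} (\<lambda>s. s - T / 2) = 0" by (simp add: integral_unique power2_eq_square)
    then show ?thesis by simp
  qed
  finally show ?thesis unfolding periodic_primitive_def by simp
qed

lemma periodic_primitive_bound:
  fixes h :: "real \<Rightarrow> real"
  assumes h: "continuous_on UNIV h" and T: "0 < T" and M: "\<And>t. \<bar>h t\<bar> \<le> M"
  shows "\<bar>periodic_primitive T h t\<bar> \<le> T * M"
proof -
  have "norm (integral {0..T} (\<lambda>s. (s - T / 2) * h (t + s))) \<le> (T * M) * (T - 0)"
  proof (rule integral_bound)
    show "continuous_on {0..T} (\<lambda>s. (s - T / 2) * h (t + s))"
      by (intro continuous_intros continuous_on_compose2[OF h]) auto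
    fix s assume s: "s \<in> {0..T}"
    show "norm ((s - T / 2) * h (t + s)) \<le> T * M"
      unfolding real_norm_def abs_mult by (rule mult_mono) (use s T M in auto)
  qed (use T in simp)
  then show ?thesis using T unfolding periodic_primitive_def by (simp add: field_simps)
qed

text \<open>The derivative is \<open>h\<close> minus its mean, each at most \<open>M\<close> in
  absolute value, whence the factor 2. This gives the equicontinuity of the image of the
  operator.\<close>

lemma periodic_primitive_lipschitz:
  fixes h :: "real \<Rightarrow> real"
  assumes h: "continuous_on UNIV h" and per: "\<And>t. h (t + T) = h t" and T: "0 < T" and M: "\<And>t. \<bar>h t\<bar> \<le> M"
  shows "\<bar>periodic_primitive T h s - periodic_primitive T h t\<bar> \<le> 2 * M * \<bar>s - t\<bar>"
proof -
  have "norm (integral {0..T} h) \<le> M * (T - 0)"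
    by (rule integral_bound) (use T M continuous_on_subset[OF h] in auto)
  then have "\<bar>integral {0..T} h / T\<bar> \<le> M" using T by (simp add: field_simps)
  then have "\<bar>h t - integral {0..T} h / T\<bar> \<le> 2 * M" for t using M[of t] by linarith
  then have "norm (periodic_primitive T h s - periodic_primitive T h t) \<le> 2 * M * norm (s - t)"
    by (intro field_differentiable_bound[of UNIV _ "\<lambda>t. h t - integral {0..T} h / T"])
      (auto intro: DERIV_periodic_primitive[OF h per T])
  then show ?thesis by simp
qed

lemma continuous_on_integral_param:
  fixes h :: "'x::topological_space \<Rightarrow> real \<Rightarrow> real"
  assumes "continuous_on (X \<times> UNIV) (\<lambda>(x, t). h x t)"
  shows "continuous_on X (\<lambda>x. integral {0..T} (h x))"
  using integral_continuous_on_param[of X 0 T h] continuous_on_subset[OF assms] by (simp add: Sigma_mono)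

lemma continuous_on_periodic_primitive:
  fixes h :: "'x::topological_space \<Rightarrow> real \<Rightarrow> real"
  assumes h: "continuous_on (X \<times> UNIV) (\<lambda>(x, t). h x t)" and T: "0 < T"
  shows "continuous_on (X \<times> UNIV) (\<lambda>(x, t). periodic_primitive T (h x) t)"
proof -
  have "continuous_on ((X \<times> UNIV) \<times> UNIV) (\<lambda>(y, s). (s - T / 2) * h (fst y) (snd y + s))"
  proof -
    have "continuous_on ((X \<times> UNIV) \<times> UNIV) (\<lambda>z. (\<lambda>(x, t). h x t) (fst (fst z), snd (fst z) + snd z))"
      by (rule continuous_on_compose2[OF h]) (auto intro!: continuous_intros)
    then show ?thesis unfolding case_prod_unfold by (intro continuous_intros) auto
  qed
  then have "continuous_on (X \<times> UNIV) (\<lambda>y. integral {0..T} (\<lambda>s. (s - T / 2) * h (fst y) (snd y + s)))"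
    by (rule continuous_on_integral_param)
  then show ?thesis
    unfolding periodic_primitive_def case_prod_unfold using T by (intro continuous_intros) auto
qed

subsection \<open>The fixed point operator\<close>

lemma compact_abs_bound:
  fixes h :: "'a::topological_space \<Rightarrow> real"
  assumes "compact S" "continuous_on S h"
  obtains B where "\<And>z. z \<in> S \<Longrightarrow> \<bar>h z\<bar> \<le> B"
  using compact_imp_bounded[OF compact_continuous_image[OF assms(2,1)]] unfolding bounded_iff
  by auto

lemma mean_near:
  fixes h :: "real \<Rightarrow> real"
  assumes h: "continuous_on UNIV h" and T: "0 < T" and D: "\<And>t. \<bar>h t - x\<bar> \<le> D"
  shows "\<bar>integral {0..T} h / T - x\<bar> \<le> D"
proof -
  have i: "(h has_integral integral {0..T} h) {0..T}"
    by (intro integrable_integral integrable_continuous_real continuous_on_subset[OF h]) auto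
  have c: "((\<lambda>_. y) has_integral T * y) {0..T}" for y :: real
    using T has_integral_const_real[of y 0 T] by simp
  have "x - D \<le> h t" "h t \<le> x + D" for t using D[of t] by (auto simp: abs_le_iff)
  then have "T * (x - D) \<le> integral {0..T} h" "integral {0..T} h \<le> T * (x + D)"
    using has_integral_le[OF c i] has_integral_le[OF i c] by blast+
  then have "x - D \<le> integral {0..T} h / T" "integral {0..T} h / T \<le> x + D"
    using T by (simp_all add: le_divide_eq divide_le_eq mult.commute)
  then show ?thesis by (simp add: abs_le_iff)
qed

lemma dist_Pair_le: "dist (x, y) (x', y') \<le> dist x x' + dist y y'"
  unfolding dist_Pair_Pair by (rule sqrt_sum_squares_le_sum) auto

text \<open>Data at a single zero \<open>p\<close>. The field is Lipschitz on the box of radius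
  \<open>r\<close>; \<delta> is the half-width of the interval allowed for the mean of
  \<open>x\<close>; \<sigma> orients the mean equation so that its drift points towards
  \<open>p\<close> at both ends. In \<open>near_\<phi>\<close> the range is 2\<delta> since
  \<open>x\<close> may leave its mean by \<delta>, and the fractions r / 8 keep fixed points within
  r / 2 of the equilibrium, where the cutoff is 1.\<close>

locale delayed_equation =
  fixes a T :: real and b :: nat and g f :: "real \<times> real \<times> real \<Rightarrow> real" and \<phi> :: "real \<times> real \<Rightarrow> real"
    and p r \<delta> \<sigma> L :: real
  assumes a: "0 < a" and b: "1 \<le> b" and T: "0 < T"
    and contg: "continuous_on UNIV g" and cont\<phi>: "continuous_on UNIV \<phi>" and contf: "continuous_on UNIV f"
    and perf: "\<And>t u v. f (t + T, u, v) = f (t, u, v)"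
    and r: "0 < r" and \<delta>: "0 < \<delta>" "\<delta> \<le> r / 8" and L: "0 \<le> L" "L * T < 2 * pi"
    and lip: "\<And>v z. \<lbrakk>\<And>k. k < b + 2 \<Longrightarrow> \<bar>v k - P_point b \<phi> p k\<bar> < r; \<And>k. b + 2 \<le> k \<Longrightarrow> v k = 0;
       \<And>k. k < b + 2 \<Longrightarrow> \<bar>z k - P_point b \<phi> p k\<bar> < r; \<And>k. b + 2 \<le> k \<Longrightarrow> z k = 0\<rbrakk> \<Longrightarrow>
       L2_set (\<lambda>k. G_map a b g \<phi> v k - G_map a b g \<phi> z k) {..<b + 2} \<le> L * L2_set (\<lambda>k. v k - z k) {..<b + 2}"
    and sgn: "\<sigma> * Phi g \<phi> (p + \<delta>) < 0" "0 < \<sigma> * Phi g \<phi> (p - \<delta>)"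
    and zero: "\<And>u. \<bar>u - p\<bar> \<le> \<delta> \<Longrightarrow> Phi g \<phi> u = 0 \<Longrightarrow> u = p"
    and near_\<phi>: "\<And>u v. \<bar>u - p\<bar> \<le> 2 * \<delta> \<Longrightarrow> \<bar>v\<bar> \<le> \<delta> \<Longrightarrow> \<bar>\<phi> (u, v) - \<phi> (p, 0)\<bar> \<le> r / 8"
begin

abbreviation "m \<equiv> b + 2"
abbreviation "P \<equiv> P_point b \<phi> p"

definition Phat :: "(real \<times> nat) \<Rightarrow>\<^sub>C real" where "Phat = Bcontfun (\<lambda>z. P (snd z))"

lemma Phat [simp]: "apply_bcontfun Phat (t, k) = P k"
  unfolding Phat_def
  by (rule apply_Bcontfun_param[of m UNIV "\<lambda>_ _. P" T "0::nat"]) (auto simp: P_point_def T)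

text \<open>The cutoff \<open>cut\<close> makes the vector field globally bounded; it is one on the solutions found below.\<close>
definition cut :: "((real \<times> nat) \<Rightarrow>\<^sub>C real) \<Rightarrow> real" where
  "cut w = max 0 (min 1 (2 - 2 * dist w Phat / r))"

definition G :: "((real \<times> nat) \<Rightarrow>\<^sub>C real) \<Rightarrow> real \<Rightarrow> nat \<Rightarrow> real" where
  "G w t = G_map a b g \<phi> (\<lambda>j. apply_bcontfun w (t, j))"

text \<open>The factor \<open>cut w\<close> is one number for the whole trajectory, so it passes
  through time averages and does not spoil the vanishing means of the components other than the
  second.\<close>

definition H :: "real \<Rightarrow> ((real \<times> nat) \<Rightarrow>\<^sub>C real) \<Rightarrow> real \<Rightarrow> nat \<Rightarrow> real" where
  "H \<mu> w t k = cut w * (G w t k + (if k = 1 then \<mu> * f (t, apply_bcontfun w (t, 0), apply_bcontfun w (t, 1)) else 0))"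

definition mean_H :: "real \<Rightarrow> ((real \<times> nat) \<Rightarrow>\<^sub>C real) \<Rightarrow> nat \<Rightarrow> real" where
  "mean_H \<mu> w k = integral {0..T} (\<lambda>t. H \<mu> w t k) / T"

definition mean_\<phi> :: "((real \<times> nat) \<Rightarrow>\<^sub>C real) \<Rightarrow> real" where
  "mean_\<phi> w = integral {0..T} (\<lambda>t. \<phi> (apply_bcontfun w (t, 0), apply_bcontfun w (t, 1))) / T"

text \<open>A fixed point has means \<open>center\<close>. With this choice of the means, all components of the
  vector field but the second automatically have mean zero along a fixed point.\<close>
definition center :: "real \<Rightarrow> ((real \<times> nat) \<Rightarrow>\<^sub>C real) \<Rightarrow> nat \<Rightarrow> real" where
  "center \<mu> w k =
    (if k = 0 then max (p - \<delta>) (min (p + \<delta>) (integral {0..T} (\<lambda>t. apply_bcontfun w (t, 0)) / T + \<sigma> * mean_H \<mu> w 1))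
     else if k = 1 then 0 else mean_\<phi> w)"

definition F :: "real \<times> ((real \<times> nat) \<Rightarrow>\<^sub>C real) \<Rightarrow> real \<Rightarrow> nat \<Rightarrow> real" where
  "F x t k = (if k < m then center (fst x) (snd x) k + periodic_primitive T (\<lambda>t. H (fst x) (snd x) t k) t else 0)"

definition A :: "real \<Rightarrow> ((real \<times> nat) \<Rightarrow>\<^sub>C real) \<Rightarrow> (real \<times> nat) \<Rightarrow>\<^sub>C real" where
  "A \<mu> w = Bcontfun (\<lambda>z. F (\<mu>, w) (fst z) (snd z))"

text \<open>Lipschitz and size bounds are left out, so that the analysis of fixed points does not
  refer to the constants of the invariant set.\<close>

definition periodic_maps :: "((real \<times> nat) \<Rightarrow>\<^sub>C real) set" where
  "periodic_maps = {w. (\<forall>t k. apply_bcontfun w (t + T, k) = apply_bcontfun w (t, k)) \<and>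
     (\<forall>t k. m \<le> k \<longrightarrow> apply_bcontfun w (t, k) = 0)}"

lemma G_simps:
  "G w t 0 = apply_bcontfun w (t, 1)"
  "G w t 1 = g (apply_bcontfun w (t, 0), apply_bcontfun w (t, 1), apply_bcontfun w (t, b + 1))"
  "G w t 2 = a * (\<phi> (apply_bcontfun w (t, 0), apply_bcontfun w (t, 1)) - apply_bcontfun w (t, 2))"
  "2 < k \<Longrightarrow> k < m \<Longrightarrow> G w t k = a * (apply_bcontfun w (t, k - 1) - apply_bcontfun w (t, k))"
  by (simp_all add: G_def G_map_def)

lemma continuous_on_G:
  fixes Y :: "'y::topological_space set"
  assumes "continuous_on Y W" "continuous_on Y \<tau>"
  shows "continuous_on Y (\<lambda>y. G (W y) (\<tau> y) k)"
proof -
  have c: "continuous_on Y (\<lambda>y. apply_bcontfun (W y) (\<tau> y, j))" for j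
    by (intro continuous_intros assms)
  consider "k = 0" | "k = 1" | "k = 2" | "2 < k \<and> k < m" | "m \<le> k" using b by linarith
  then show ?thesis
  proof cases
    case 1
    then show ?thesis using c[of 1] by (simp add: G_simps)
  next
    case 2
    then show ?thesis
      by (simp only: G_simps) (rule continuous_on_compose2[OF contg], auto intro!: continuous_intros c)
  next
    case 3
    have "continuous_on Y (\<lambda>y. \<phi> (apply_bcontfun (W y) (\<tau> y, 0), apply_bcontfun (W y) (\<tau> y, 1)))"
      by (rule continuous_on_compose2[OF cont\<phi>]) (auto intro!: continuous_intros c)
    then show ?thesis using 3 by (simp only: G_simps) (intro continuous_intros c)
  next
    case 4
    then show ?thesis by (simp add: G_simps) (intro continuous_intros c)
  next
    case 5
    then have "G (W y) (\<tau> y) k = 0" for y using b by (simp add: G_def G_map_def)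
    then show ?thesis by simp
  qed
qed

lemma continuous_on_cut: "continuous_on Y cut"
  unfolding cut_def using r by (intro continuous_intros) auto

lemma continuous_on_H:
  fixes Y :: "'y::topological_space set"
  assumes "continuous_on Y \<mu>" "continuous_on Y W" "continuous_on Y \<tau>"
  shows "continuous_on Y (\<lambda>y. H (\<mu> y) (W y) (\<tau> y) k)"
proof -
  have c: "continuous_on Y (\<lambda>y. apply_bcontfun (W y) (\<tau> y, j))" for j
    by (intro continuous_intros assms)
  have 1: "continuous_on Y (\<lambda>y. cut (W y))"
    by (rule continuous_on_compose2[OF continuous_on_cut[of UNIV] assms(2)]) simp
  have 2: "continuous_on Y (\<lambda>y. f (\<tau> y, apply_bcontfun (W y) (\<tau> y, 0), apply_bcontfun (W y) (\<tau> y, 1)))"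
    by (rule continuous_on_compose2[OF contf]) (auto intro!: continuous_intros c assms)
  have "continuous_on Y (\<lambda>y. if k = 1 then \<mu> y * f (\<tau> y, apply_bcontfun (W y) (\<tau> y, 0), apply_bcontfun (W y) (\<tau> y, 1)) else 0)"
    using continuous_on_mult[OF assms(1) 2] by (cases "k = 1") auto
  then show ?thesis
    unfolding H_def by (intro continuous_on_mult continuous_on_add 1 continuous_on_G assms)
qed

lemma continuous_on_center: "continuous_on Y (\<lambda>x. center (fst x) (snd x) k)"
proof -
  have "continuous_on (Y \<times> UNIV) (\<lambda>(x, t). H (fst x) (snd x) t 1)"
    unfolding case_prod_unfold by (intro continuous_on_H continuous_intros)
  from continuous_on_integral_param[OF this]
  have 1: "continuous_on Y (\<lambda>x. mean_H (fst x) (snd x) 1)"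
    unfolding mean_H_def using T by (intro continuous_intros) auto
  have "continuous_on (Y \<times> UNIV) (\<lambda>(x, t). apply_bcontfun (snd x) (t, 0))"
    unfolding case_prod_unfold by (intro continuous_intros)
  from continuous_on_integral_param[OF this]
  have 2: "continuous_on Y (\<lambda>x. integral {0..T} (\<lambda>t. apply_bcontfun (snd x) (t, 0)) / T)"
    using T by (intro continuous_intros) auto
  have "continuous_on (Y \<times> UNIV) (\<lambda>(x, t). \<phi> (apply_bcontfun (snd x) (t, 0), apply_bcontfun (snd x) (t, 1)))"
    unfolding case_prod_unfold by (rule continuous_on_compose2[OF cont\<phi>]) (auto intro!: continuous_intros)
  from continuous_on_integral_param[OF this]
  have 3: "continuous_on Y (\<lambda>x. mean_\<phi> (snd x))"
    unfolding mean_\<phi>_def using T by (intro continuous_intros) auto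
  show ?thesis
    unfolding center_def by (cases "k = 0"; cases "k = 1") (auto intro!: continuous_intros 1[simplified] 2 3)
qed

lemma H_periodic: "w \<in> periodic_maps \<Longrightarrow> H \<mu> w (t + T) k = H \<mu> w t k"
  by (simp add: H_def G_def perf periodic_maps_def)

lemma continuous_H: "continuous_on UNIV (\<lambda>t. H \<mu> w t k)"
  by (intro continuous_on_H continuous_intros)

lemma F_props:
  assumes Y: "Y \<subseteq> UNIV \<times> periodic_maps"
  shows "k < m \<Longrightarrow> continuous_on (Y \<times> UNIV) (\<lambda>(x, t). F x t k)"
    and "x \<in> Y \<Longrightarrow> F x (t + T) k = F x t k" and "m \<le> k \<Longrightarrow> F x t k = 0"
proof -
  have "continuous_on (Y \<times> UNIV) (\<lambda>(x, t). H (fst x) (snd x) t k)"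
    unfolding case_prod_unfold by (intro continuous_on_H continuous_intros)
  from continuous_on_periodic_primitive[OF this T]
  have "continuous_on (Y \<times> UNIV) (\<lambda>(x, t). periodic_primitive T (\<lambda>t. H (fst x) (snd x) t k) t)" .
  moreover have "continuous_on (Y \<times> UNIV) (\<lambda>y. center (fst (fst y)) (snd (fst y)) k)"
    by (rule continuous_on_compose2[OF continuous_on_center[of UNIV]]) (auto intro!: continuous_intros)
  ultimately show "k < m \<Longrightarrow> continuous_on (Y \<times> UNIV) (\<lambda>(x, t). F x t k)"
    unfolding F_def case_prod_unfold by (auto intro!: continuous_intros)
  show "x \<in> Y \<Longrightarrow> F x (t + T) k = F x t k"
    using Y periodic_primitive_periodic[of "\<lambda>t. H (fst x) (snd x) t k" T t] H_periodic
    by (auto simp: F_def)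
  show "m \<le> k \<Longrightarrow> F x t k = 0" by (simp add: F_def)
qed

lemma apply_A: "w \<in> periodic_maps \<Longrightarrow> apply_bcontfun (A \<mu> w) (t, k) = F (\<mu>, w) t k"
  unfolding A_def using F_props[of "UNIV \<times> periodic_maps"] T
  by (intro apply_Bcontfun_param[of m "UNIV \<times> periodic_maps" F T]) auto

lemma continuous_on_A:
  assumes "K \<subseteq> periodic_maps"
  shows "continuous_on (I \<times> K) (\<lambda>(\<mu>, w). A \<mu> w)"
proof -
  have Y: "I \<times> K \<subseteq> UNIV \<times> periodic_maps" using assms by auto
  show ?thesis
    unfolding A_def case_prod_unfold prod.collapse
    by (rule continuous_on_Bcontfun_param[of m _ F T]) (fact F_props[OF Y] T)+
qed

section \<open>A priori bounds and an invariant compact convex set\<close>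

lemma near_Phat:
  assumes w: "w \<in> periodic_maps" and cut: "cut w \<noteq> 0"
  shows "\<bar>apply_bcontfun w (t, k) - P k\<bar> \<le> dist w Phat" "dist w Phat < r"
proof -
  show "\<bar>apply_bcontfun w (t, k) - P k\<bar> \<le> dist w Phat"
    using dist_bounded[of w "(t, k)" Phat] by (simp add: dist_real_def)
  show "dist w Phat < r"
  proof (rule ccontr)
    assume "\<not> ?thesis"
    then have "2 - 2 * dist w Phat / r \<le> 0" using r by (simp add: field_simps)
    then show False using cut by (simp add: cut_def)
  qed
qed

lemma cut_le_1: "0 \<le> cut w" "cut w \<le> 1" by (auto simp: cut_def)

text \<open>Where the cutoff does not vanish, the trajectory stays within \<open>r\<close> of the
  equilibrium, so only a compact set of arguments enters.\<close>

lemma f_bound: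
  obtains B where "0 \<le> B"
    "\<And>w t. w \<in> periodic_maps \<Longrightarrow> cut w \<noteq> 0 \<Longrightarrow> \<bar>f (t, apply_bcontfun w (t, 0), apply_bcontfun w (t, 1))\<bar> \<le> B"
proof -
  let ?S = "{0..T} \<times> {p - r..p + r} \<times> {- r..r}"
  obtain B where B: "\<And>z. z \<in> ?S \<Longrightarrow> \<bar>f z\<bar> \<le> B"
    by (rule compact_abs_bound[of ?S f]) (auto intro!: compact_Times continuous_on_subset[OF contf])
  show ?thesis
  proof
    show "0 \<le> \<bar>B\<bar>" by simp
    fix w t assume w: "w \<in> periodic_maps" "cut w \<noteq> 0"
    \<comment> \<open>One time \<open>s\<close> in [0, T] must serve both the explicit time in
      \<open>f\<close> and the trajectory, hence the pair of functions.\<close>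
    obtain s where s: "s \<in> {0..T}"
      "(\<lambda>u. f (t, u), \<lambda>j. apply_bcontfun w (t, j)) = (\<lambda>u. f (s, u), \<lambda>j. apply_bcontfun w (s, j))"
      by (rule periodic_representative[of "\<lambda>t. (\<lambda>u. f (t, u), \<lambda>j. apply_bcontfun w (t, j))" T t])
        (use w(1) T perf in \<open>auto simp: periodic_maps_def\<close>)
    have "\<bar>apply_bcontfun w (s, 0) - p\<bar> < r" "\<bar>apply_bcontfun w (s, 1)\<bar> < r"
      using near_Phat(1)[OF w, of s 0] near_Phat(1)[OF w, of s 1] near_Phat(2)[OF w] by (auto simp: P_point_def)
    then have "\<bar>f (s, apply_bcontfun w (s, 0), apply_bcontfun w (s, 1))\<bar> \<le> B"
      using s(1) by (intro B) auto
    moreover have "f (t, u, v) = f (s, u, v)" "apply_bcontfun w (t, j) = apply_bcontfun w (s, j)" for u v j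
      using s(2) by (simp_all add: fun_eq_iff)
    ultimately show "\<bar>f (t, apply_bcontfun w (t, 0), apply_bcontfun w (t, 1))\<bar> \<le> \<bar>B\<bar>" by simp
  qed
qed

lemma H_bound:
  obtains M where "0 \<le> M"
    "\<And>\<mu> w t k. \<mu> \<in> {0..1} \<Longrightarrow> w \<in> periodic_maps \<Longrightarrow> k < m \<Longrightarrow> \<bar>H \<mu> w t k\<bar> \<le> M"
proof -
  obtain B where B: "0 \<le> B" "\<And>w t. w \<in> periodic_maps \<Longrightarrow> cut w \<noteq> 0 \<Longrightarrow> \<bar>f (t, apply_bcontfun w (t, 0), apply_bcontfun w (t, 1))\<bar> \<le> B"
    by (rule f_bound) blast
  \<comment> \<open>The field at the equilibrium, its Lipschitz growth over the box (with the
    Euclidean distance bounded by the sum of the coordinates), and the forcing for a parameter at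
    most 1.\<close>
  define M where "M = (\<Sum>k<m. \<bar>G_map a b g \<phi> P k\<bar>) + L * (real m * r) + B"
  show ?thesis
  proof
    show "0 \<le> M" unfolding M_def using B L r by (auto intro!: add_nonneg_nonneg sum_nonneg)
    fix \<mu> w t k assume \<mu>: "\<mu> \<in> {0..1::real}" and w: "w \<in> periodic_maps" and k: "k < m"
    show "\<bar>H \<mu> w t k\<bar> \<le> M"
    proof (cases "cut w = 0")
      case True
      then show ?thesis using \<open>0 \<le> M\<close> by (simp add: H_def)
    next
      case False
      let ?v = "\<lambda>j. apply_bcontfun w (t, j)"
      have near: "\<bar>?v j - P j\<bar> < r" for j
        using near_Phat(1)[OF w False, of t j] near_Phat(2)[OF w False] by linarith
      have "L2_set (\<lambda>k. G_map a b g \<phi> ?v k - G_map a b g \<phi> P k) {..<m} \<le> L * L2_set (\<lambda>k. ?v k - P k) {..<m}"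
        by (rule lip) (use near w r in \<open>auto simp: periodic_maps_def P_point_def\<close>)
      also have "\<dots> \<le> L * (real m * r)"
      proof (rule mult_left_mono[OF order_trans[OF L2_set_le_sum_abs] L(1)])
        show "(\<Sum>i<m. \<bar>?v i - P i\<bar>) \<le> real m * r"
          using sum_bounded_above[of "{..<m}" "\<lambda>i. \<bar>?v i - P i\<bar>" r] near by (simp add: less_imp_le)
      qed
      finally have 1: "L2_set (\<lambda>k. G_map a b g \<phi> ?v k - G_map a b g \<phi> P k) {..<m} \<le> L * (real m * r)" .
      have "\<bar>G_map a b g \<phi> ?v k - G_map a b g \<phi> P k\<bar> \<le> L2_set (\<lambda>k. \<bar>G_map a b g \<phi> ?v k - G_map a b g \<phi> P k\<bar>) {..<m}"
        by (rule member_le_L2_set) (use k in auto)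
      also have "\<dots> = L2_set (\<lambda>k. G_map a b g \<phi> ?v k - G_map a b g \<phi> P k) {..<m}" by (simp add: L2_set_def)
      finally have "\<bar>G w t k - G_map a b g \<phi> P k\<bar> \<le> L * (real m * r)" using 1 by (simp add: G_def)
      moreover have "\<bar>G_map a b g \<phi> P k\<bar> \<le> (\<Sum>k<m. \<bar>G_map a b g \<phi> P k\<bar>)"
        by (rule member_le_sum) (use k in auto)
      moreover have "\<bar>if k = 1 then \<mu> * f (t, ?v 0, ?v 1) else 0\<bar> \<le> B"
      proof -
        have "\<bar>\<mu>\<bar> * \<bar>f (t, ?v 0, ?v 1)\<bar> \<le> 1 * B" by (rule mult_mono) (use \<mu> B(2)[OF w False] B(1) in auto)
        then show ?thesis using B(1) by (simp add: abs_mult)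
      qed
      ultimately have "\<bar>G w t k + (if k = 1 then \<mu> * f (t, ?v 0, ?v 1) else 0)\<bar> \<le> M"
        unfolding M_def by linarith
      then have "cut w * \<bar>G w t k + (if k = 1 then \<mu> * f (t, ?v 0, ?v 1) else 0)\<bar> \<le> 1 * M"
        by (intro mult_mono) (use cut_le_1 in auto)
      then show ?thesis unfolding H_def using cut_le_1[of w] by (simp add: abs_mult)
    qed
  qed
qed

lemma lip_functions_subset: "lip_functions T m M R \<subseteq> periodic_maps"
  by (auto simp: lip_functions_def periodic_maps_def)

text \<open>The cutoff bounds the field by some \<open>M\<close> whatever the size of
  \<open>w\<close>: the primitive is then bounded by \<open>T * M\<close> and Lipschitz with
  constant \<open>2 * M\<close>, while the means are bounded by truncation or by \<phi> on a
  box.\<close>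

lemma invariant_set:
  obtains M R where "lip_functions T m M R \<noteq> {}"
    "\<And>\<mu> w. \<mu> \<in> {0..1} \<Longrightarrow> w \<in> lip_functions T m M R \<Longrightarrow> A \<mu> w \<in> lip_functions T m M R"
proof -
  obtain M where M: "0 \<le> M" "\<And>\<mu> w t k. \<mu> \<in> {0..1} \<Longrightarrow> w \<in> periodic_maps \<Longrightarrow> k < m \<Longrightarrow> \<bar>H \<mu> w t k\<bar> \<le> M"
    by (rule H_bound) blast
  define R0 where "R0 = \<bar>p\<bar> + \<delta> + T * M"
  let ?S = "{- R0..R0} \<times> {- R0..R0}"
  obtain B where B: "\<And>z. z \<in> ?S \<Longrightarrow> \<bar>\<phi> z\<bar> \<le> B"
    by (rule compact_abs_bound[of ?S \<phi>]) (auto intro!: compact_Times continuous_on_subset[OF cont\<phi>])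
  have R0: "0 \<le> R0" using M(1) T \<delta> by (simp add: R0_def)
  have B0: "0 \<le> B" using B[of "(0, 0)"] R0 by simp
  \<comment> \<open>Two sizes: the bound for components 0 and 1 does not involve \<phi>; the
    remaining ones are bounded through the maximum of |\<phi>| on the box which that first bound
    defines.\<close>
  define R where "R k = (if k < (2::nat) then R0 else B + T * M)" for k
  define K where "K = lip_functions T m (2 * M) R"
  have "(0 :: (real \<times> nat) \<Rightarrow>\<^sub>C real) \<in> K"
    unfolding K_def lip_functions_def using R0 B0 M(1) T by (simp add: R_def)
  moreover have "A \<mu> w \<in> K" if \<mu>: "\<mu> \<in> {0..1}" and wK: "w \<in> K" for \<mu> w
  proof -
    have w: "w \<in> periodic_maps" using wK lip_functions_subset unfolding K_def by blast
    note Fp = F_props[of "UNIV \<times> periodic_maps", OF order_refl]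
    have H: "\<bar>periodic_primitive T (\<lambda>t. H \<mu> w t k) t\<bar> \<le> T * M"
      "\<bar>periodic_primitive T (\<lambda>t. H \<mu> w t k) s - periodic_primitive T (\<lambda>t. H \<mu> w t k) t\<bar> \<le> 2 * M * \<bar>s - t\<bar>" if "k < m" for k s t
      using periodic_primitive_bound[OF continuous_H T, of \<mu> w k M t]
        periodic_primitive_lipschitz[OF continuous_H _ T, of \<mu> w k M s t] M(2)[OF \<mu> w that] H_periodic[OF w] by auto
    have cen: "\<bar>center \<mu> w k\<bar> \<le> R k - T * M" for k
    proof -
      have "\<bar>\<phi> (apply_bcontfun w (t, 0), apply_bcontfun w (t, 1)) - 0\<bar> \<le> B" for t
      proof -
        have "\<bar>apply_bcontfun w (t, 0)\<bar> \<le> R 0" "\<bar>apply_bcontfun w (t, 1)\<bar> \<le> R 1"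
          using wK by (auto simp: K_def lip_functions_def)
        then show ?thesis using B[of "(apply_bcontfun w (t, 0), apply_bcontfun w (t, 1))"]
          by (auto simp: R_def abs_le_iff)
      qed
      moreover have "continuous_on UNIV (\<lambda>t. \<phi> (apply_bcontfun w (t, 0), apply_bcontfun w (t, 1)))"
        by (rule continuous_on_compose2[OF cont\<phi>]) (auto intro!: continuous_intros)
      ultimately have "\<bar>mean_\<phi> w - 0\<bar> \<le> B" unfolding mean_\<phi>_def by (intro mean_near T)
      moreover have "\<bar>max (p - \<delta>) (min (p + \<delta>) x)\<bar> \<le> \<bar>p\<bar> + \<delta>" for x using \<delta> by auto
      ultimately show ?thesis using \<delta> by (auto simp: center_def R_def R0_def)
    qed
    have "\<bar>F (\<mu>, w) t k\<bar> \<le> R k" for t k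
      using cen[of k] H(1)[of k t] R0 B0 M(1) T by (auto simp: F_def R_def)
    moreover have "\<bar>F (\<mu>, w) s k - F (\<mu>, w) t k\<bar> \<le> 2 * M * \<bar>s - t\<bar>" for s t k
      using H(2)[of k s t] M(1) by (simp add: F_def)
    ultimately show ?thesis
      unfolding K_def lip_functions_def using w by (simp add: apply_A Fp(2,3))
  qed
  ultimately show ?thesis using that[of "2 * M" R] unfolding K_def by blast
qed

subsection \<open>Fixed points are close to constants\<close>

lemma fixed_point_eq:
  assumes w: "w \<in> periodic_maps" and fp: "A \<mu> w = w" and k: "k < m"
  shows "apply_bcontfun w (t, k) = center \<mu> w k + periodic_primitive T (\<lambda>t. H \<mu> w t k) t"
  using apply_A[OF w, of \<mu> t k] k by (simp add: fp F_def)

lemma fixed_point_DERIV: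
  assumes w: "w \<in> periodic_maps" and fp: "A \<mu> w = w" and k: "k < m"
  shows "((\<lambda>t. apply_bcontfun w (t, k)) has_real_derivative H \<mu> w t k - mean_H \<mu> w k) (at t)"
  unfolding fixed_point_eq[OF w fp k] mean_H_def
  using DERIV_add[OF DERIV_const DERIV_periodic_primitive[OF continuous_H H_periodic[OF w] T]] by simp

lemma fixed_point_mean:
  assumes w: "w \<in> periodic_maps" and fp: "A \<mu> w = w" and k: "k < m"
  shows "integral {0..T} (\<lambda>t. apply_bcontfun w (t, k)) = T * center \<mu> w k"
proof -
  let ?P = "periodic_primitive T (\<lambda>t. H \<mu> w t k)"
  have "continuous_on UNIV ?P"
    using DERIV_periodic_primitive[OF continuous_H H_periodic[OF w] T]
    by (meson DERIV_isCont continuous_at_imp_continuous_on)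
  then have "?P integrable_on {0..T}"
    by (intro integrable_continuous_real) (rule continuous_on_subset, auto)
  then have P: "(?P has_integral 0) {0..T}"
    using integral_periodic_primitive[OF continuous_H H_periodic[OF w] T] by (metis integrable_integral)
  have "((\<lambda>t. center \<mu> w k + ?P t) has_integral T * center \<mu> w k + 0) {0..T}"
    using T has_integral_const_real[of "center \<mu> w k" 0 T] by (intro has_integral_add P) simp
  then show ?thesis by (simp add: fixed_point_eq[OF w fp k] integral_unique)
qed

text \<open>The prescribed means cancel: component 1 has mean 0, component 2 has the mean of \<phi>,
  and the later ones share it. Only component 1 of the field leaves a scalar equation.\<close>

lemma fixed_point_mean_H:
  assumes w: "w \<in> periodic_maps" and fp: "A \<mu> w = w" and k: "k < m" "k \<noteq> 1"
  shows "mean_H \<mu> w k = 0"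
proof -
  let ?W = "\<lambda>k t. apply_bcontfun w (t, k)"
  let ?\<phi> = "\<lambda>t. \<phi> (?W 0 t, ?W 1 t)"
  have i: "(?W j has_integral T * center \<mu> w j) {0..T}" if "j < m" for j
    using fixed_point_mean[OF w fp that]
    by (simp add: has_integral_iff) (intro integrable_continuous_real continuous_intros)
  have c\<phi>: "continuous_on UNIV ?\<phi>"
    by (rule continuous_on_compose2[OF cont\<phi>]) (auto intro!: continuous_intros)
  have "?\<phi> integrable_on {0..T}"
    by (intro integrable_continuous_real continuous_on_subset[OF c\<phi>]) simp
  then have i\<phi>: "(?\<phi> has_integral T * mean_\<phi> w) {0..T}"
    using T by (simp add: has_integral_iff mean_\<phi>_def)
  have H: "H \<mu> w t k = cut w * G w t k" for t using k by (simp add: H_def)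
  have "((\<lambda>t. G w t k) has_integral 0) {0..T}"
  proof -
    consider "k = 0" | "k = 2" | "2 < k" using k by linarith
    then show ?thesis
    proof cases
      case 1
      then show ?thesis using i[of 1] b by (simp add: G_simps center_def)
    next
      case 2
      have "((\<lambda>t. a * (?\<phi> t - ?W 2 t)) has_integral a * (T * mean_\<phi> w - T * center \<mu> w 2)) {0..T}"
        using b by (intro has_integral_mult_right has_integral_diff i\<phi> i) simp
      moreover have "a * (T * mean_\<phi> w - T * center \<mu> w 2) = 0" by (simp add: center_def)
      ultimately show ?thesis unfolding 2 G_simps by (simp only:)
    next
      case 3
      have "((\<lambda>t. a * (?W (k - 1) t - ?W k t)) has_integral a * (T * center \<mu> w (k - 1) - T * center \<mu> w k)) {0..T}"
        using k by (intro has_integral_mult_right has_integral_diff i) auto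
      moreover have "a * (T * center \<mu> w (k - 1) - T * center \<mu> w k) = 0" using 3 by (simp add: center_def)
      ultimately show ?thesis unfolding G_simps(4)[OF 3 k(1)] by (simp only:)
    qed
  qed
  then have "((\<lambda>t. H \<mu> w t k) has_integral cut w * 0) {0..T}"
    unfolding H by (rule has_integral_mult_right)
  then show ?thesis by (simp add: mean_H_def integral_unique)
qed

text \<open>Subtracting the field at the mean vector leaves a Lipschitz part and a forcing part of
  size \<mu>; \<open>almost_constant\<close> applies with
  \<open>(1 + \<epsilon>) * L\<^sup>2\<close> for \<open>\<rho>2\<close>, where \<epsilon> pays for
  separating the two squares. As \<open>C\<close> does not depend on the fixed point, all fixed
  points at \<mu> = 0 are constant.\<close>

lemma fixed_point_near_center:
  obtains C where "0 \<le> C" "\<And>\<mu> w k t. \<mu> \<in> {0..1} \<Longrightarrow> w \<in> periodic_maps \<Longrightarrow> A \<mu> w = w \<Longrightarrow> k < m \<Longrightarrow>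
    \<bar>apply_bcontfun w (t, k) - center \<mu> w k\<bar> \<le> \<mu> * C"
proof -
  obtain B where B: "0 \<le> B" "\<And>w t. w \<in> periodic_maps \<Longrightarrow> cut w \<noteq> 0 \<Longrightarrow> \<bar>f (t, apply_bcontfun w (t, 0), apply_bcontfun w (t, 1))\<bar> \<le> B"
    by (rule f_bound) blast
  \<comment> \<open>The midpoint of \<open>L\<close> and 2 pi / T: strictly above the Lipschitz
    constant and still admissible in Wirtinger's inequality.\<close>
  define \<omega> where "\<omega> = (L + 2 * pi / T) / 2"
  have "L < 2 * pi / T" using L T by (simp add: pos_less_divide_eq)
  then have \<omega>: "L < \<omega>" "\<omega> < 2 * pi / T" by (auto simp: \<omega>_def)
  then have \<omega>T: "0 < \<omega>" "\<omega> * T < 2 * pi" using L T by (auto simp: pos_less_divide_eq)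
  have L\<omega>: "L\<^sup>2 < \<omega>\<^sup>2" using \<omega>(1) L by (intro power_strict_mono) auto
  \<comment> \<open>Uses up at most half of the gap: \<epsilon> * L^2 is at most (\<omega>^2 - L^2)
    / 2. The \<open>+ 1\<close> keeps the denominator positive when \<open>L = 0\<close>.\<close>
  define \<epsilon> where "\<epsilon> = (\<omega>\<^sup>2 - L\<^sup>2) / (2 * (L\<^sup>2 + 1))"
  have den: "0 < L\<^sup>2 + 1" by (simp add: add_nonneg_pos)
  have \<epsilon>: "0 < \<epsilon>" unfolding \<epsilon>_def using L\<omega> den by (intro divide_pos_pos) auto
  have \<rho>: "0 \<le> (1 + \<epsilon>) * L\<^sup>2" "(1 + \<epsilon>) * L\<^sup>2 < \<omega>\<^sup>2"
  proof -
    have "\<epsilon> * L\<^sup>2 \<le> \<epsilon> * (L\<^sup>2 + 1)" using \<epsilon> by simp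
    also have "\<dots> = (\<omega>\<^sup>2 - L\<^sup>2) / 2" unfolding \<epsilon>_def using den by (simp add: field_simps)
    also have "\<dots> < \<omega>\<^sup>2 - L\<^sup>2" using L\<omega> by simp
    finally show "(1 + \<epsilon>) * L\<^sup>2 < \<omega>\<^sup>2" by (simp add: algebra_simps)
  qed (use \<epsilon> in simp)
  define E where "E = (1 + 1 / \<epsilon>) * B\<^sup>2"
  have E: "0 \<le> E" using \<epsilon> by (simp add: E_def)
  define C where "C = (E * T / (1 - (1 + \<epsilon>) * L\<^sup>2 / \<omega>\<^sup>2) + T) / 2"
  have dd: "0 < 1 - (1 + \<epsilon>) * L\<^sup>2 / \<omega>\<^sup>2" using \<rho>(2) \<omega>T by simp
  show ?thesis
  proof
    show "0 \<le> C" unfolding C_def using E T dd by (auto intro!: add_nonneg_nonneg divide_nonneg_pos)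
    fix \<mu> w k t assume \<mu>: "\<mu> \<in> {0..1::real}" and w: "w \<in> periodic_maps" and fp: "A \<mu> w = w" and k: "k < m"
    let ?W = "\<lambda>k t. apply_bcontfun w (t, k)"
    define c where "c j = (if j < m then center \<mu> w j else 0)" for j
    \<comment> \<open>Adding this constant to the derivative cancels the mean of the field and
      subtracts the field at the mean vector, which leaves a difference of two field values plus the
      forcing.\<close>
    define d where "d j = mean_H \<mu> w j - cut w * G_map a b g \<phi> c j" for j
    obtain s where s: "s \<in> {0..T}" "?W k t = ?W k s"
      by (rule periodic_representative[of "?W k" T t]) (use w T in \<open>auto simp: periodic_maps_def\<close>)
    have "\<bar>?W k s - c k\<bar> \<le> \<mu> * ((E * T / (1 - (1 + \<epsilon>) * L\<^sup>2 / \<omega>\<^sup>2) + T) / 2)"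
    proof (rule almost_constant[of m ?W "\<lambda>k t. H \<mu> w t k - mean_H \<mu> w k", where d = d])
      fix j t assume j: "j < m"
      show "(?W j has_real_derivative H \<mu> w t j - mean_H \<mu> w j) (at t)" by (rule fixed_point_DERIV[OF w fp j])
      show "continuous_on UNIV (\<lambda>t. H \<mu> w t j - mean_H \<mu> w j)" by (intro continuous_intros continuous_H)
      show "?W j (t + T) = ?W j t" using w by (simp add: periodic_maps_def)
      show "H \<mu> w (t + T) j - mean_H \<mu> w j = H \<mu> w t j - mean_H \<mu> w j" by (simp add: H_periodic[OF w])
      show "integral {0..T} (?W j) = T * c j" using fixed_point_mean[OF w fp j] j by (simp add: c_def)
    next
      fix t
      define x where "x j = cut w * (G w t j - G_map a b g \<phi> c j)" for j
      define y where "y j = (if j = 1 then cut w * (\<mu> * f (t, ?W 0 t, ?W 1 t)) else 0)" for j :: nat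
      have xy: "H \<mu> w t j - mean_H \<mu> w j + d j = x j + y j" for j
        by (simp add: H_def d_def x_def y_def algebra_simps)
      have sq: "(u + v)\<^sup>2 \<le> (1 + \<epsilon>) * u\<^sup>2 + (1 + 1 / \<epsilon>) * v\<^sup>2" for u v :: real
      proof -
        have "0 \<le> (\<epsilon> * u - v)\<^sup>2 / \<epsilon>" using \<epsilon> by simp
        then have "2 * u * v \<le> \<epsilon> * u\<^sup>2 + v\<^sup>2 / \<epsilon>" using \<epsilon> by (simp add: field_simps power2_eq_square)
        then show ?thesis by (simp add: power2_sum algebra_simps)
      qed
      have XY: "(\<Sum>j<m. (x j)\<^sup>2) \<le> L\<^sup>2 * (\<Sum>j<m. (?W j t - c j)\<^sup>2) \<and> (\<Sum>j<m. (y j)\<^sup>2) \<le> \<mu>\<^sup>2 * B\<^sup>2"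
      proof (cases "cut w = 0")
        case True
        then have "x j = 0" "y j = 0" for j by (simp_all add: x_def y_def)
        then show ?thesis by (simp add: sum_nonneg)
      next
        case cut: False
          have cut1: "(cut w)\<^sup>2 \<le> 1" using cut_le_1[of w] by (simp add: power_le_one)
          \<comment> \<open>The Lipschitz bound is also applied at \<open>c\<close>, which must lie
            in the box; as a vector of averages of \<open>w\<close> it is within
            \<open>dist w Phat\<close> of the equilibrium.\<close>
          have cn: "\<bar>c j - P j\<bar> < r" if "j < m" for j
          proof -
            have "\<bar>integral {0..T} (?W j) / T - P j\<bar> \<le> dist w Phat"
              by (rule mean_near[OF _ T near_Phat(1)[OF w cut]]) (intro continuous_intros)
            then show ?thesis
              using fixed_point_mean[OF w fp that] near_Phat(2)[OF w cut] T that by (simp add: c_def)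
          qed
          have wn: "\<bar>?W j t - P j\<bar> < r" for j
            using near_Phat(1)[OF w cut, of t j] near_Phat(2)[OF w cut] by linarith
          let ?w = "\<lambda>j. ?W j t"
          have L2sq: "(L2_set h S)\<^sup>2 = (\<Sum>i\<in>S. (h i)\<^sup>2)" for h and S :: "nat set"
            by (simp add: L2_set_def sum_nonneg)
          have "L2_set (\<lambda>k. G_map a b g \<phi> ?w k - G_map a b g \<phi> c k) {..<m} \<le> L * L2_set (\<lambda>k. ?w k - c k) {..<m}"
            by (rule lip) (use cn wn w in \<open>auto simp: c_def periodic_maps_def\<close>)
          then have "(L2_set (\<lambda>k. G_map a b g \<phi> ?w k - G_map a b g \<phi> c k) {..<m})\<^sup>2 \<le> (L * L2_set (\<lambda>k. ?w k - c k) {..<m})\<^sup>2"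
            by (intro power_mono) auto
          then have G2: "(\<Sum>k<m. (G_map a b g \<phi> ?w k - G_map a b g \<phi> c k)\<^sup>2) \<le> L\<^sup>2 * (\<Sum>j<m. (?W j t - c j)\<^sup>2)"
            by (simp only: L2sq power_mult_distrib)
          have "(\<Sum>j<m. (x j)\<^sup>2) = (cut w)\<^sup>2 * (\<Sum>k<m. (G_map a b g \<phi> ?w k - G_map a b g \<phi> c k)\<^sup>2)"
            by (simp only: x_def G_def power_mult_distrib sum_distrib_left)
          also have "\<dots> \<le> 1 * (L\<^sup>2 * (\<Sum>j<m. (?W j t - c j)\<^sup>2))"
            by (rule mult_mono[OF cut1 G2]) (simp, intro sum_nonneg zero_le_power2)
          finally have 1: "(\<Sum>j<m. (x j)\<^sup>2) \<le> L\<^sup>2 * (\<Sum>j<m. (?W j t - c j)\<^sup>2)" by simp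
          have "(\<Sum>j<m. (y j)\<^sup>2) = (\<Sum>j\<in>{1}. (y j)\<^sup>2)"
            by (rule sum.mono_neutral_right) (use b in \<open>auto simp: y_def\<close>)
          also have "\<dots> = (cut w)\<^sup>2 * (\<mu>\<^sup>2 * (f (t, ?W 0 t, ?W 1 t))\<^sup>2)" by (simp add: y_def power_mult_distrib)
          also have "\<dots> \<le> 1 * (\<mu>\<^sup>2 * B\<^sup>2)"
          proof (intro mult_mono cut1 order_refl)
            show "(f (t, ?W 0 t, ?W 1 t))\<^sup>2 \<le> B\<^sup>2"
              using B(2)[OF w cut, of t] B(1) by (simp add: abs_le_square_iff[symmetric])
          qed auto
          finally show ?thesis using 1 by simp
      qed
      note X = XY[THEN conjunct1] and Y = XY[THEN conjunct2]
      have "(\<Sum>j<m. (H \<mu> w t j - mean_H \<mu> w j + d j)\<^sup>2) \<le> (\<Sum>j<m. (1 + \<epsilon>) * (x j)\<^sup>2 + (1 + 1 / \<epsilon>) * (y j)\<^sup>2)"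
        unfolding xy by (intro sum_mono sq)
      also have "\<dots> = (1 + \<epsilon>) * (\<Sum>j<m. (x j)\<^sup>2) + (1 + 1 / \<epsilon>) * (\<Sum>j<m. (y j)\<^sup>2)"
        by (simp only: sum.distrib sum_distrib_left)
      also have "\<dots> \<le> (1 + \<epsilon>) * (L\<^sup>2 * (\<Sum>j<m. (?W j t - c j)\<^sup>2)) + (1 + 1 / \<epsilon>) * (\<mu>\<^sup>2 * B\<^sup>2)"
        using \<epsilon> by (intro add_mono mult_left_mono X Y) auto
      finally show "(\<Sum>j<m. (H \<mu> w t j - mean_H \<mu> w j + d j)\<^sup>2) \<le> (1 + \<epsilon>) * L\<^sup>2 * (\<Sum>j<m. (?W j t - c j)\<^sup>2) + \<mu>\<^sup>2 * E"
        by (simp add: E_def mult_ac)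
    qed (use T \<omega>T \<rho> E \<mu> k s in auto)
    then show "\<bar>?W k t - center \<mu> w k\<bar> \<le> \<mu> * C" using s(2) k by (simp add: c_def C_def)
  qed
qed

text \<open>Applied at the ends p + \<delta> and p - \<delta>: continuity preserves half of the
  strict sign. The third argument of \<open>g\<close> is the last chain component, within \<eta> of
  the mean of \<phi>, which in turn is within \<zeta> of the value of \<phi> at the end; hence the
  tolerance \<zeta> + \<eta>.\<close>

lemma edge:
  assumes "x * Phi g \<phi> u0 < 0"
  obtains \<eta> \<zeta> where "0 < \<eta>" "\<And>u v. \<bar>u - u0\<bar> \<le> \<eta> \<Longrightarrow> \<bar>v\<bar> \<le> \<eta> \<Longrightarrow> \<bar>\<phi> (u, v) - \<phi> (u0, 0)\<bar> \<le> \<zeta>"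
    "\<And>u v z. \<bar>u - u0\<bar> \<le> \<eta> \<Longrightarrow> \<bar>v\<bar> \<le> \<eta> \<Longrightarrow> \<bar>z - \<phi> (u0, 0)\<bar> \<le> \<zeta> + \<eta> \<Longrightarrow> x * g (u, v, z) \<le> x * Phi g \<phi> u0 / 2"
proof -
  let ?z = "\<phi> (u0, 0)" and ?h = "x * Phi g \<phi> u0"
  have "continuous_on UNIV (\<lambda>z. x * g z)" by (intro continuous_intros contg)
  moreover have "0 < - ?h / 2" using assms by simp
  ultimately obtain d where d: "0 < d" "\<And>y. dist y (u0, 0, ?z) < d \<Longrightarrow> dist (x * g y) (x * g (u0, 0, ?z)) < - ?h / 2"
    unfolding continuous_on_iff by (metis UNIV_I)
  have "0 < d / 8" using d(1) by simp
  then obtain d2 where d2: "0 < d2" "\<And>y. dist y (u0, 0) < d2 \<Longrightarrow> dist (\<phi> y) ?z < d / 8"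
    using cont\<phi> unfolding continuous_on_iff by (metis UNIV_I)
  define \<eta> where "\<eta> = min (d / 8) (d2 / 4)"
  show ?thesis
  proof
    show "0 < \<eta>" using d(1) d2(1) by (simp add: \<eta>_def)
    fix u v assume uv: "\<bar>u - u0\<bar> \<le> \<eta>" "\<bar>v\<bar> \<le> \<eta>"
    have "dist (u, v) (u0, 0) \<le> \<bar>u - u0\<bar> + \<bar>v\<bar>" using dist_Pair_le[of u v u0 0] by (simp add: dist_real_def)
    also have "\<dots> < d2" using uv d2(1) unfolding \<eta>_def by linarith
    finally show "\<bar>\<phi> (u, v) - ?z\<bar> \<le> d / 8" using d2(2)[of "(u, v)"] by (simp add: dist_real_def)
    fix z assume z: "\<bar>z - ?z\<bar> \<le> d / 8 + \<eta>"
    have "dist (u, v, z) (u0, 0, ?z) \<le> \<bar>u - u0\<bar> + (\<bar>v\<bar> + \<bar>z - ?z\<bar>)"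
      using dist_Pair_le[of u "(v, z)" u0 "(0, ?z)"] dist_Pair_le[of v z 0 ?z] by (simp add: dist_real_def)
    also have "\<dots> < d" using uv z d(1) unfolding \<eta>_def by linarith
    finally have "\<bar>x * g (u, v, z) - ?h\<bar> < - ?h / 2" using d(2)[of "(u, v, z)"] by (simp add: dist_real_def Phi_def)
    then show "x * g (u, v, z) \<le> ?h / 2" by linarith
  qed
qed

lemma cut_eq_1: "dist w Phat \<le> r / 2 \<Longrightarrow> cut w = 1"
  using r by (simp add: cut_def field_simps)

lemma mean_H_nonpos:
  assumes "\<And>t. x * H \<mu> w t k \<le> 0"
  shows "x * mean_H \<mu> w k \<le> 0"
proof -
  have "((\<lambda>t. x * H \<mu> w t k) has_integral x * integral {0..T} (\<lambda>t. H \<mu> w t k)) {0..T}"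
    by (intro has_integral_mult_right integrable_integral integrable_continuous_real continuous_on_subset[OF continuous_H]) auto
  from has_integral_le[OF this has_integral_0] have "x * integral {0..T} (\<lambda>t. H \<mu> w t k) \<le> 0"
    using assms by blast
  then show ?thesis using T by (simp add: mean_H_def divide_le_0_iff)
qed

text \<open>A nonzero drift of the mean pins it, by \<open>clamp_fixed\<close>, to the end towards
  which it points; there \<Phi> has the opposite sign, with a margin that the deviation from the
  mean and the forcing together cannot exceed. So the drift vanishes, and at \<mu> = 0 a fixed point
  is a constant at a zero of \<Phi>.\<close>

lemma isolating:
  obtains l where "0 < l" "l \<le> 1"
    "\<And>\<mu> w. \<mu> \<in> {0..l} \<Longrightarrow> w \<in> periodic_maps \<Longrightarrow> A \<mu> w = w \<Longrightarrow> dist w Phat \<le> r / 2 \<and> mean_H \<mu> w 1 = 0"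
    "\<And>w. w \<in> periodic_maps \<Longrightarrow> A 0 w = w \<Longrightarrow> w = Phat"
proof -
  obtain C where C: "0 \<le> C" "\<And>\<mu> w k t. \<mu> \<in> {0..1} \<Longrightarrow> w \<in> periodic_maps \<Longrightarrow> A \<mu> w = w \<Longrightarrow> k < m \<Longrightarrow>
    \<bar>apply_bcontfun w (t, k) - center \<mu> w k\<bar> \<le> \<mu> * C" by (rule fixed_point_near_center) blast
  obtain B where B: "0 \<le> B" "\<And>w t. w \<in> periodic_maps \<Longrightarrow> cut w \<noteq> 0 \<Longrightarrow> \<bar>f (t, apply_bcontfun w (t, 0), apply_bcontfun w (t, 1))\<bar> \<le> B"
    by (rule f_bound) blast
  obtain \<eta>1 \<zeta>1 where e1: "0 < \<eta>1" "\<And>u v. \<bar>u - (p + \<delta>)\<bar> \<le> \<eta>1 \<Longrightarrow> \<bar>v\<bar> \<le> \<eta>1 \<Longrightarrow> \<bar>\<phi> (u, v) - \<phi> (p + \<delta>, 0)\<bar> \<le> \<zeta>1"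
    "\<And>u v z. \<bar>u - (p + \<delta>)\<bar> \<le> \<eta>1 \<Longrightarrow> \<bar>v\<bar> \<le> \<eta>1 \<Longrightarrow> \<bar>z - \<phi> (p + \<delta>, 0)\<bar> \<le> \<zeta>1 + \<eta>1 \<Longrightarrow> \<sigma> * g (u, v, z) \<le> \<sigma> * Phi g \<phi> (p + \<delta>) / 2"
    using edge[OF sgn(1)] by blast
  have "- \<sigma> * Phi g \<phi> (p - \<delta>) < 0" using sgn(2) by simp
  then obtain \<eta>2 \<zeta>2 where e2: "0 < \<eta>2" "\<And>u v. \<bar>u - (p - \<delta>)\<bar> \<le> \<eta>2 \<Longrightarrow> \<bar>v\<bar> \<le> \<eta>2 \<Longrightarrow> \<bar>\<phi> (u, v) - \<phi> (p - \<delta>, 0)\<bar> \<le> \<zeta>2"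
    "\<And>u v z. \<bar>u - (p - \<delta>)\<bar> \<le> \<eta>2 \<Longrightarrow> \<bar>v\<bar> \<le> \<eta>2 \<Longrightarrow> \<bar>z - \<phi> (p - \<delta>, 0)\<bar> \<le> \<zeta>2 + \<eta>2 \<Longrightarrow> - \<sigma> * g (u, v, z) \<le> - \<sigma> * Phi g \<phi> (p - \<delta>) / 2"
    by (rule edge) blast
  define \<eta> where "\<eta> = min \<delta> (min \<eta>1 \<eta>2)"
  have \<eta>: "0 < \<eta>" "\<eta> \<le> \<delta>" "\<eta> \<le> \<eta>1" "\<eta> \<le> \<eta>2" using \<delta> e1(1) e2(1) by (auto simp: \<eta>_def)
  define e where "e = min (- (\<sigma> * Phi g \<phi> (p + \<delta>))) (\<sigma> * Phi g \<phi> (p - \<delta>))"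
  have e: "0 < e" "\<sigma> * Phi g \<phi> (p + \<delta>) \<le> - e" "- \<sigma> * Phi g \<phi> (p - \<delta>) \<le> - e" using sgn by (auto simp: e_def)
  \<comment> \<open>The bound 1 makes the deviation estimate available, the second bound keeps
    deviations below \<eta>, and the third keeps the forcing below e / 2, the margin that
    \<open>edge\<close> leaves.\<close>
  define l where "l = min 1 (min (\<eta> / (C + 1)) (e / (2 * (\<bar>\<sigma>\<bar> * B + 1))))"
  have den: "0 < 2 * (\<bar>\<sigma>\<bar> * B + 1)" using B(1) by (simp add: add_nonneg_pos)
  have l: "0 < l" "l \<le> 1" using \<eta> e C(1) den by (auto simp: l_def)
  have lC: "l * C \<le> \<eta>"
  proof -
    have "l \<le> \<eta> / (C + 1)" by (simp add: l_def)
    then have "l * (C + 1) \<le> \<eta>" using C(1) by (simp add: le_divide_eq)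
    then show ?thesis using l by (simp add: algebra_simps)
  qed
  have lB: "l * (\<bar>\<sigma>\<bar> * B) \<le> e / 2"
  proof -
    have "l \<le> e / (2 * (\<bar>\<sigma>\<bar> * B + 1))" by (simp add: l_def)
    then have "l * (2 * (\<bar>\<sigma>\<bar> * B + 1)) \<le> e" using den by (simp only: pos_le_divide_eq)
    then show ?thesis using l by (simp add: algebra_simps)
  qed
  have c0: "center \<mu> w 0 \<in> {p - \<delta>..p + \<delta>}" for \<mu> w using \<delta> by (auto simp: center_def)
  have c1: "center \<mu> w 1 = 0" for \<mu> w by (simp add: center_def)
  have ck: "center \<mu> w k = mean_\<phi> w" if "2 \<le> k" for \<mu> w k using that by (simp add: center_def)
  have cont_\<phi>W: "continuous_on UNIV (\<lambda>t. \<phi> (apply_bcontfun w (t, 0), apply_bcontfun w (t, 1)))"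
    for w :: "(real \<times> nat) \<Rightarrow>\<^sub>C real"
    by (rule continuous_on_compose2[OF cont\<phi>]) (auto intro!: continuous_intros)
  have main: "dist w Phat \<le> r / 2 \<and> mean_H \<mu> w 1 = 0"
    if \<mu>: "\<mu> \<in> {0..l}" and w: "w \<in> periodic_maps" and fp: "A \<mu> w = w" for \<mu> w
  proof -
    let ?W = "\<lambda>k t. apply_bcontfun w (t, k)"
    have dev: "\<bar>?W k t - center \<mu> w k\<bar> \<le> \<eta>" if "k < m" for k t
    proof -
      have "\<bar>?W k t - center \<mu> w k\<bar> \<le> \<mu> * C" using C(2)[OF _ w fp that] \<mu> l by simp
      also have "\<dots> \<le> l * C" using \<mu> C(1) by (intro mult_right_mono) auto
      finally show ?thesis using lC by linarith
    qed
    have W0: "\<bar>?W 0 t - center \<mu> w 0\<bar> \<le> \<eta>" and W1: "\<bar>?W 1 t\<bar> \<le> \<eta>" for t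
      using dev[of 0 t] dev[of 1 t] c1[of \<mu> w] by auto
    have "\<bar>\<phi> (?W 0 t, ?W 1 t) - \<phi> (p, 0)\<bar> \<le> r / 8" for t
      using W0[of t] W1[of t] c0[of \<mu> w] \<eta> by (intro near_\<phi>) auto
    from mean_near[OF cont_\<phi>W T this] have mp: "\<bar>mean_\<phi> w - \<phi> (p, 0)\<bar> \<le> r / 8" by (simp only: mean_\<phi>_def)
    have "dist w Phat \<le> r / 2"
    proof (rule dist_bound)
      fix z :: "real \<times> nat"
      obtain t k where z: "z = (t, k)" by force
      consider "k = 0" | "k = 1" | "2 \<le> k" "k < m" | "m \<le> k" by linarith
      then have "\<bar>?W k t - P k\<bar> \<le> r / 2"
      proof cases
        case 1
        then have "\<bar>?W k t - P k\<bar> = \<bar>?W 0 t - p\<bar>" by (simp add: P_point_def)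
        moreover have "p - \<delta> \<le> center \<mu> w 0" "center \<mu> w 0 \<le> p + \<delta>" using c0[of \<mu> w] by auto
        ultimately show ?thesis using W0[of t] \<eta> \<delta> r by linarith
      next
        case 2
        then have "\<bar>?W k t - P k\<bar> = \<bar>?W 1 t\<bar>" by (simp add: P_point_def)
        then show ?thesis using W1[of t] \<eta> \<delta> r by linarith
      next
        case 3
        then have "P k = \<phi> (p, 0)" by (simp add: P_point_def)
        then show ?thesis using dev[OF 3(2), of t] ck[OF 3(1), of \<mu> w] mp \<eta> \<delta> by linarith
      next
        case 4
        then show ?thesis using w r by (simp add: periodic_maps_def P_point_def)
      qed
      then show "dist (apply_bcontfun w z) (apply_bcontfun Phat z) \<le> r / 2" by (simp add: z dist_real_def)
    qed
    moreover have "mean_H \<mu> w 1 = 0"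
    proof -
      have cut: "cut w = 1" by (rule cut_eq_1) fact
      have Hg: "x * H \<mu> w t 1 \<le> x * g (?W 0 t, ?W 1 t, ?W (b + 1) t) + e / 2" if x: "\<bar>x\<bar> = \<bar>\<sigma>\<bar>" for x t
      proof -
        have fB: "\<bar>f (t, ?W 0 t, ?W 1 t)\<bar> \<le> B" using B(2)[OF w] cut by simp
        have "x * (\<mu> * f (t, ?W 0 t, ?W 1 t)) \<le> \<bar>x * (\<mu> * f (t, ?W 0 t, ?W 1 t))\<bar>" by (rule abs_ge_self)
        also have "\<dots> = \<mu> * (\<bar>\<sigma>\<bar> * \<bar>f (t, ?W 0 t, ?W 1 t)\<bar>)" using \<mu> x by (simp add: abs_mult)
        also have "\<dots> \<le> l * (\<bar>\<sigma>\<bar> * B)" using \<mu> fB l by (intro mult_mono) (auto intro: mult_left_mono)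
        also have "\<dots> \<le> e / 2" by (rule lB)
        finally have "x * (\<mu> * f (t, ?W 0 t, ?W 1 t)) \<le> e / 2" .
        moreover have "H \<mu> w t 1 = g (?W 0 t, ?W 1 t, ?W (b + 1) t) + \<mu> * f (t, ?W 0 t, ?W 1 t)"
          unfolding H_def G_simps cut by simp
        ultimately show ?thesis by (simp add: distrib_left)
      qed
      have Wb: "\<bar>?W (b + 1) t - y\<bar> \<le> \<zeta> + \<eta>" if "\<And>t. \<bar>\<phi> (?W 0 t, ?W 1 t) - y\<bar> \<le> \<zeta>" for y \<zeta> t
      proof -
        have "\<bar>mean_\<phi> w - y\<bar> \<le> \<zeta>" unfolding mean_\<phi>_def by (rule mean_near[OF cont_\<phi>W T that])
        moreover have "\<bar>?W (b + 1) t - mean_\<phi> w\<bar> \<le> \<eta>" using dev[of "b + 1" t] ck[of "b + 1"] b by simp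
        ultimately show ?thesis by linarith
      qed
      \<comment> \<open>At a fixed point the mean of component 0 is its own centre, so the centre is
        a fixed point of the clamped update.\<close>
      have cc: "center \<mu> w 0 = max (p - \<delta>) (min (p + \<delta>) (center \<mu> w 0 + \<sigma> * mean_H \<mu> w 1))"
        using fixed_point_mean[OF w fp, of 0] T by (subst center_def) simp
      have dl: "p - \<delta> \<le> p + \<delta>" using \<delta> by simp
      have "\<not> 0 < \<sigma> * mean_H \<mu> w 1"
      proof
        assume pos: "0 < \<sigma> * mean_H \<mu> w 1"
        have c: "center \<mu> w 0 = p + \<delta>" by (rule clamp_fixed(2)[OF cc pos dl])
        have n1: "\<bar>?W 0 t - (p + \<delta>)\<bar> \<le> \<eta>1" "\<bar>?W 1 t\<bar> \<le> \<eta>1" for t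
          using W0[of t] W1[of t] \<eta> c by auto
        have "\<sigma> * H \<mu> w t 1 \<le> 0" for t
        proof -
          have "\<bar>?W (b + 1) t - \<phi> (p + \<delta>, 0)\<bar> \<le> \<zeta>1 + \<eta>" by (rule Wb[OF e1(2)[OF n1]])
          then have "\<sigma> * g (?W 0 t, ?W 1 t, ?W (b + 1) t) \<le> \<sigma> * Phi g \<phi> (p + \<delta>) / 2"
            using \<eta> by (intro e1(3) n1) linarith
          then show ?thesis using Hg[of \<sigma> t] e by simp
        qed
        from mean_H_nonpos[of \<sigma>, OF this] pos show False by simp
      qed
      moreover have "\<not> \<sigma> * mean_H \<mu> w 1 < 0"
      proof
        assume neg: "\<sigma> * mean_H \<mu> w 1 < 0"
        have c: "center \<mu> w 0 = p - \<delta>" by (rule clamp_fixed(3)[OF cc neg])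
        have n1: "\<bar>?W 0 t - (p - \<delta>)\<bar> \<le> \<eta>2" "\<bar>?W 1 t\<bar> \<le> \<eta>2" for t
          using W0[of t] W1[of t] \<eta> c by auto
        have "- \<sigma> * H \<mu> w t 1 \<le> 0" for t
        proof -
          have "\<bar>?W (b + 1) t - \<phi> (p - \<delta>, 0)\<bar> \<le> \<zeta>2 + \<eta>" by (rule Wb[OF e2(2)[OF n1]])
          then have "- \<sigma> * g (?W 0 t, ?W 1 t, ?W (b + 1) t) \<le> - \<sigma> * Phi g \<phi> (p - \<delta>) / 2"
            using \<eta> by (intro e2(3) n1) linarith
          then show ?thesis using Hg[of "- \<sigma>" t] e by simp
        qed
        from mean_H_nonpos[of "- \<sigma>", OF this] neg show False by simp
      qed
      ultimately have "\<sigma> * mean_H \<mu> w 1 = 0" by linarith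
      then show ?thesis using sgn by auto
    qed
    ultimately show ?thesis by blast
  qed
  moreover have "w = Phat" if w: "w \<in> periodic_maps" and fp: "A 0 w = w" for w
  proof -
    let ?W = "\<lambda>k t. apply_bcontfun w (t, k)"
    let ?c = "center 0 w 0"
    have W: "?W k t = center 0 w k" if "k < m" for k t
      using C(2)[OF _ w fp that, of t] by simp
    have mw: "dist w Phat \<le> r / 2" "mean_H 0 w 1 = 0" using main[OF _ w fp] l by auto
    have int: "integral {0..T} (\<lambda>_. x) / T = x" for x :: real
      using T has_integral_const_real[of x 0 T] by (simp add: integral_unique)
    have mp: "mean_\<phi> w = \<phi> (?c, 0)"
      using int W[of 0] W[of 1] c1 unfolding mean_\<phi>_def by simp
    have "H 0 w t 1 = Phi g \<phi> ?c" for t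
      using W[of 0] W[of 1] W[of "b + 1"] c1 ck[of "b + 1"] mp b cut_eq_1[OF mw(1)]
      unfolding H_def G_simps Phi_def by simp
    then have "mean_H 0 w 1 = Phi g \<phi> ?c" unfolding mean_H_def using int by simp
    then have "?c = p" using mw(2) c0[of 0 w] by (intro zero) auto
    then have "center 0 w k = P k" if "k < m" for k
      using that c1[of 0 w] ck[of k 0 w] mp by (cases "k = 0"; cases "k = 1") (auto simp: P_point_def)
    then have "?W k t = P k" for k t
      using W[of k t] w by (cases "k < m") (auto simp: periodic_maps_def P_point_def)
    then show ?thesis by (intro bcontfun_eqI) auto
  qed
  ultimately show ?thesis using that[OF l] by blast
qed

text \<open>With the cutoff equal to 1 and all means of \<open>H\<close> zero, a fixed point
  satisfies the first-order system exactly, and \<open>linear_chain\<close> identifies its last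
  component with the gamma integral.\<close>

lemma fixed_point_solution:
  assumes w: "w \<in> periodic_maps" and fp: "A \<mu> w = w" and near: "dist w Phat \<le> r / 2" and mH: "mean_H \<mu> w 1 = 0"
  shows "periodic_solution a b T g \<phi> f \<mu> (\<lambda>t. apply_bcontfun w (t, 0))"
    and "(\<lambda>t. apply_bcontfun w (t, 0)) \<in> C1_per T"
    and "deriv (\<lambda>t. apply_bcontfun w (t, 0)) = (\<lambda>t. apply_bcontfun w (t, 1))"
proof -
  let ?W = "\<lambda>k t. apply_bcontfun w (t, k)"
  have cut: "cut w = 1" by (rule cut_eq_1[OF near])
  have dW: "(?W k has_real_derivative H \<mu> w t k) (at t)" if "k < m" for k t
    using fixed_point_DERIV[OF w fp that, of t] fixed_point_mean_H[OF w fp that] mH by (cases "k = 1") auto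
  have H0: "H \<mu> w t 0 = ?W 1 t" for t unfolding H_def G_simps cut by simp
  have H1: "H \<mu> w t 1 = g (?W 0 t, ?W 1 t, ?W (b + 1) t) + \<mu> * f (t, ?W 0 t, ?W 1 t)" for t
    unfolding H_def G_simps cut by simp
  have d0: "(?W 0 has_real_derivative ?W 1 t) (at t)" for t using dW[of 0 t] by (simp only: H0)
  have d1: "(?W 1 has_real_derivative H \<mu> w t 1) (at t)" for t using dW[of 1 t] by simp
  show deriv0: "deriv (?W 0) = ?W 1" using d0 by (intro ext DERIV_imp_deriv)
  have deriv1: "deriv (?W 1) t = H \<mu> w t 1" for t using d1 by (intro DERIV_imp_deriv)
  have C1: "?W 0 C1_differentiable_on UNIV"
    unfolding C1_differentiable_on_def
    by (intro exI[of _ "?W 1"]) (auto simp flip: has_real_derivative_iff_has_vector_derivative intro!: d0[simplified] continuous_intros)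
  have C1': "?W 1 C1_differentiable_on UNIV"
    unfolding C1_differentiable_on_def
    using d1 continuous_H[of \<mu> w 1] by (intro exI[of _ "\<lambda>t. H \<mu> w t 1"]) (auto simp flip: has_real_derivative_iff_has_vector_derivative)
  have per: "?W k (t + T) = ?W k t" for k t using w by (simp add: periodic_maps_def)
  show "?W 0 \<in> C1_per T" using C1 per by (simp add: C1_per_def)
  \<comment> \<open>Index shift: the chain starts with the driving term \<phi>(x, x') at index 0,
    and stage \<open>k \<ge> 1\<close> is component \<open>k + 1\<close>.\<close>
  define v where "v k t = (if k = 0 then \<phi> (?W 0 t, ?W 1 t) else ?W (k + 1) t)" for k t
  have nW: "\<bar>?W k t\<bar> \<le> norm w" for k t using norm_bounded[of w "(t, k)"] by simp
  let ?S = "{- norm w..norm w} \<times> {- norm w..norm w}"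
  obtain B where B: "\<And>z. z \<in> ?S \<Longrightarrow> \<bar>\<phi> z\<bar> \<le> B"
    by (rule compact_abs_bound[of ?S \<phi>]) (auto intro!: compact_Times continuous_on_subset[OF cont\<phi>])
  have "(LINT s:{..t}|lborel. erlang_density (b - 1) a (t - s) * v 0 s) = v b t" for t
  proof (rule linear_chain[OF a b])
    show "(v k has_real_derivative a * (v (k - 1) t - v k t)) (at t)" if k: "1 \<le> k" "k \<le> b" for k t
    proof -
      have "v k = ?W (k + 1)" using k by (auto simp: v_def)
      moreover have "H \<mu> w t (k + 1) = a * (v (k - 1) t - v k t)"
      proof (cases "k = 1")
        case True
        then show ?thesis by (simp add: H_def cut v_def G_simps(3)[unfolded numeral_2_eq_2] numeral_2_eq_2)
      next
        case False
        then show ?thesis using k by (simp add: H_def cut v_def G_simps)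
      qed
      ultimately show ?thesis using dW[of "k + 1" t] k by simp
    qed
    show "continuous_on UNIV (v 0)"
      unfolding v_def[abs_def] by (simp, rule continuous_on_compose2[OF cont\<phi>]) (auto intro!: continuous_intros)
    show "\<bar>v k t\<bar> \<le> norm w + \<bar>B\<bar>" for k t
    proof (cases "k = 0")
      case True
      have "\<bar>\<phi> (?W 0 t, ?W 1 t)\<bar> \<le> B" using nW[of t 0] nW[of t 1] by (intro B) (simp add: abs_le_iff)
      then show ?thesis using True norm_ge_zero[of w] by (simp add: v_def del: norm_ge_zero)
    next
      case False
      then show ?thesis using nW[of t "k + 1"] by (simp add: v_def)
    qed
  qed
  then have conv: "(LINT s:{..t}|lborel. gamma_density a b (t - s) * \<phi> (?W 0 s, ?W 1 s)) = ?W (b + 1) t" for t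
    using b by (simp add: v_def gamma_density_def)
  show "periodic_solution a b T g \<phi> f \<mu> (?W 0)"
    unfolding periodic_solution_def C2_fun_def deriv0 deriv1 conv
    using C1 C1' per H1 by auto
qed

subsection \<open>The branch of forced pairs\<close>

text \<open>The derivative of component 0 is component 1, so uniform closeness of trajectories is
  already closeness in the C^1 norm, with factor 2.\<close>

lemma continuous_map_first_component:
  assumes Z: "\<And>\<mu> w. (\<mu>, w) \<in> Z \<Longrightarrow> 0 \<le> \<mu> \<and> (\<lambda>t. apply_bcontfun w (t, 0)) \<in> C1_per T \<and>
      deriv (\<lambda>t. apply_bcontfun w (t, 0)) = (\<lambda>t. apply_bcontfun w (t, 1))"
  shows "continuous_map (top_of_set Z) (pair_topology T) (\<lambda>z. (fst z, \<lambda>t. apply_bcontfun (snd z) (t, 0 :: nat)))"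
proof -
  let ?x = "\<lambda>z :: real \<times> ((real \<times> nat) \<Rightarrow>\<^sub>C real). (\<lambda>t. apply_bcontfun (snd z) (t, 0))"
  interpret M: Metric_space "C1_per T" "C1_dist T" by (rule Metric_space_C1[OF T])
  have dist: "C1_dist T (?x z) (?x z') \<le> 2 * dist z z'" if "z \<in> Z" "z' \<in> Z" for z z'
  proof -
    have z: "?x z \<in> C1_per T" "deriv (?x z) = (\<lambda>t. apply_bcontfun (snd z) (t, 1))"
      "?x z' \<in> C1_per T" "deriv (?x z') = (\<lambda>t. apply_bcontfun (snd z') (t, 1))"
      using Z[of "fst z" "snd z"] Z[of "fst z'" "snd z'"] that by auto
    have d: "\<bar>apply_bcontfun (snd z) (t, k) - apply_bcontfun (snd z') (t, k)\<bar> \<le> dist z z'" for t k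
      using dist_bounded[of "snd z" "(t, k)" "snd z'"] dist_snd_le[of z z'] by (simp add: dist_real_def)
    have "(SUP t. \<bar>?x z t - ?x z' t\<bar>) \<le> dist z z'" "(SUP t. \<bar>deriv (?x z) t - deriv (?x z') t\<bar>) \<le> dist z z'"
      unfolding z by (intro cSUP_least d; simp)+
    then show ?thesis
      using z(1,3) deriv_C1_diff[OF z(1,3)] by (simp add: C1_dist_def C1_norm_def)
  qed
  have "continuous_map (top_of_set Z) (C1_topology T) ?x"
    unfolding C1_topology_def M.continuous_map_to_metric
  proof (intro ballI allI impI)
    fix z and \<epsilon> :: real assume z: "z \<in> topspace (top_of_set Z)" and \<epsilon>: "0 < \<epsilon>"
    let ?U = "Z \<inter> ball z (\<epsilon> / 2)"
    have "?x y \<in> M.mball (?x z) \<epsilon>" if "y \<in> ?U" for y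
      using that z dist[of z y] Z[of "fst z" "snd z"] Z[of "fst y" "snd y"] by (auto simp: M.in_mball)
    moreover have "openin (top_of_set Z) ?U" by (rule openin_open_Int) simp
    moreover have "z \<in> ?U" using z \<epsilon> by simp
    ultimately show "\<exists>U. openin (top_of_set Z) U \<and> z \<in> U \<and> (\<forall>y\<in>U. ?x y \<in> M.mball (?x z) \<epsilon>)" by blast
  qed
  moreover have "continuous_map (top_of_set Z) (top_of_set {0..}) fst"
    using Z by (auto simp: continuous_map_in_subtopology intro: continuous_on_fst continuous_on_id)
  ultimately show ?thesis
    unfolding pair_topology_def continuous_map_pairwise by (simp add: o_def)
qed

theorem branch:
  obtains l \<Gamma> where "0 < l" "connectedin (pair_topology T) \<Gamma>"
    "\<Gamma> \<subseteq> {q \<in> forced_pairs a b T g \<phi> f. \<not> trivial_pair q}" "emanates_from T \<Gamma> (0, \<lambda>_. p)"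
    "{0<..l} \<subseteq> fst ` \<Gamma>" "\<And>\<mu> x t. (\<mu>, x) \<in> \<Gamma> \<Longrightarrow> \<bar>x t - p\<bar> < r"
    "periodic_solution a b T g \<phi> f 0 (\<lambda>_. p)"
proof -
  obtain l where l: "0 < l" "l \<le> 1"
    and iso: "\<And>\<mu> w. \<mu> \<in> {0..l} \<Longrightarrow> w \<in> periodic_maps \<Longrightarrow> A \<mu> w = w \<Longrightarrow> dist w Phat \<le> r / 2 \<and> mean_H \<mu> w 1 = 0"
    and uniq: "\<And>w. w \<in> periodic_maps \<Longrightarrow> A 0 w = w \<Longrightarrow> w = Phat"
    by (rule isolating) blast
  obtain M R where ne: "lip_functions T m M R \<noteq> {}"
    and self: "\<And>\<mu> w. \<mu> \<in> {0..1} \<Longrightarrow> w \<in> lip_functions T m M R \<Longrightarrow> A \<mu> w \<in> lip_functions T m M R"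
    by (rule invariant_set) blast
  define K where "K = lip_functions T m M R"
  have Kp: "K \<subseteq> periodic_maps" unfolding K_def by (rule lip_functions_subset)
  obtain \<Gamma> where \<Gamma>: "connected \<Gamma>" "\<Gamma> \<subseteq> {(\<mu>, w). \<mu> \<in> {0<..l} \<and> w \<in> K \<and> A \<mu> w = w}"
    "(0, Phat) \<in> closure \<Gamma>" "{0<..l} \<subseteq> fst ` \<Gamma>" and q: "Phat \<in> K" "A 0 Phat = Phat"
  proof (rule continuation[of K l A Phat])
    show "compact K" "convex K" "K \<noteq> {}"
      using ne T by (simp_all add: K_def compact_lip_functions convex_lip_functions)
    show "continuous_on ({0..l} \<times> K) (\<lambda>(\<mu>, w). A \<mu> w)" by (rule continuous_on_A[OF Kp])
    show "A \<mu> w \<in> K" if "\<mu> \<in> {0..l}" "w \<in> K" for \<mu> w using self[of \<mu> w] that l by (simp add: K_def)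
  qed (use l uniq Kp in auto)
  \<comment> \<open>The limit point must belong to the domain of the continuous map, so that the
    closure relation can be carried over to forced pairs.\<close>
  define Z where "Z = insert (0, Phat) \<Gamma>"
  define \<iota> where "\<iota> z = (fst z, \<lambda>t. apply_bcontfun (snd z) (t, 0 :: nat))" for z :: "real \<times> ((real \<times> nat) \<Rightarrow>\<^sub>C real)"
  have Zp: "\<mu> \<in> {0..l}" "w \<in> periodic_maps" "A \<mu> w = w" if "(\<mu>, w) \<in> Z" for \<mu> w
    using that \<Gamma>(2) q Kp l by (auto simp: Z_def)
  have sol: "periodic_solution a b T g \<phi> f \<mu> (\<lambda>t. apply_bcontfun w (t, 0))"
    "(\<lambda>t. apply_bcontfun w (t, 0)) \<in> C1_per T"
    "deriv (\<lambda>t. apply_bcontfun w (t, 0)) = (\<lambda>t. apply_bcontfun w (t, 1))" if "(\<mu>, w) \<in> Z" for \<mu> w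
    using fixed_point_solution[of w \<mu>] iso[of \<mu> w] Zp[OF that] by blast+
  have cm: "continuous_map (top_of_set Z) (pair_topology T) \<iota>"
    unfolding \<iota>_def[abs_def] by (rule continuous_map_first_component) (use sol Zp in auto)
  have near: "\<bar>apply_bcontfun w (t, 0) - p\<bar> < r" if "(\<mu>, w) \<in> Z" for \<mu> w t
  proof -
    have "\<bar>apply_bcontfun w (t, 0) - p\<bar> \<le> dist w Phat"
      using dist_bounded[of w "(t, 0)" Phat] by (simp add: dist_real_def P_point_def)
    then show ?thesis using iso[OF Zp[OF that]] r by linarith
  qed
  have \<iota>P: "\<iota> (0, Phat) = (0, \<lambda>_. p)" by (simp add: \<iota>_def P_point_def)
  show ?thesis
  proof
    show "0 < l" by fact
    show "connectedin (pair_topology T) (\<iota> ` \<Gamma>)"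
      by (rule connectedin_continuous_map_image[OF cm]) (use \<Gamma>(1) in \<open>auto simp: connectedin_subtopology Z_def\<close>)
    show "\<iota> ` \<Gamma> \<subseteq> {q \<in> forced_pairs a b T g \<phi> f. \<not> trivial_pair q}"
    proof
      fix x assume "x \<in> \<iota> ` \<Gamma>"
      then obtain \<mu> w where x: "x = \<iota> (\<mu>, w)" "(\<mu>, w) \<in> \<Gamma>" by auto
      then have "(\<mu>, w) \<in> Z" "0 < \<mu>" using \<Gamma>(2) by (auto simp: Z_def)
      then show "x \<in> {q \<in> forced_pairs a b T g \<phi> f. \<not> trivial_pair q}"
        using sol(1,2)[of \<mu> w] by (simp add: x \<iota>_def forced_pairs_def trivial_pair_def)
    qed
    have "(0, Phat) \<in> top_of_set Z closure_of \<Gamma>"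
      using \<Gamma>(3) by (auto simp: closure_of_subtopology Z_def Int_absorb1 subset_insertI)
    then have "\<iota> (0, Phat) \<in> pair_topology T closure_of (\<iota> ` \<Gamma>)"
      using continuous_map_image_closure_subset[OF cm, of \<Gamma>] by blast
    then show "emanates_from T (\<iota> ` \<Gamma>) (0, \<lambda>_. p)" by (simp only: emanates_from_def \<iota>P)
    show "{0<..l} \<subseteq> fst ` \<iota> ` \<Gamma>" using \<Gamma>(4) by (simp add: image_image \<iota>_def)
    show "\<bar>x t - p\<bar> < r" if mx: "(\<mu>, x) \<in> \<iota> ` \<Gamma>" for \<mu> x t
    proof -
      obtain w where "(\<mu>, w) \<in> \<Gamma>" "x = (\<lambda>t. apply_bcontfun w (t, 0))" using mx by (auto simp: \<iota>_def)
      then show ?thesis using near[of \<mu> w t] by (simp add: Z_def)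
    qed
    have "(0, Phat) \<in> Z" by (simp add: Z_def)
    from sol(1)[OF this] show "periodic_solution a b T g \<phi> f 0 (\<lambda>_. p)" by (simp add: P_point_def)
  qed
qed

end

section \<open>From the assumptions on neighbourhoods and signs to the local setting\<close>

lemma locally_lipschitz_continuous:
  assumes "locally_lipschitz h"
  shows "continuous_on UNIV h"
proof (rule continuous_at_imp_continuous_on, rule ballI)
  fix z
  obtain r C where r: "0 < r" "C-lipschitz_on (ball z r) h" using assms unfolding locally_lipschitz_def by blast
  then have "continuous_on (ball z r) h" by (intro lipschitz_on_continuous_on)
  then show "isCont h z" using r(1) by (simp add: continuous_on_eq_continuous_at)
qed

text \<open>A basic open set of the product topology gives one radius per coordinate; the least of
  those below \<open>n\<close> is positive, and from \<open>n\<close> on both points are 0.\<close>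

lemma Euclidean_space_box:
  assumes U: "openin (Euclidean_space n) U" and P: "P \<in> U"
  obtains r where "0 < r" "\<And>v. \<lbrakk>\<And>k. k < n \<Longrightarrow> \<bar>v k - P k\<bar> < r; \<And>k. n \<le> k \<Longrightarrow> v k = 0\<rbrakk> \<Longrightarrow> v \<in> U"
proof -
  obtain V where V: "openin (powertop_real UNIV) V" "U = V \<inter> {x. \<forall>i\<ge>n. x i = 0}"
    using U by (auto simp: Euclidean_space_def openin_subtopology)
  have "P \<in> V" using P V(2) by auto
  then obtain X where X: "P \<in> PiE UNIV X" "\<And>i. openin euclideanreal (X i)" "PiE UNIV X \<subseteq> V"
    using product_topology_open_contains_basis[OF V(1)] by blast
  have "\<exists>e>0. \<forall>y. \<bar>y - P k\<bar> < e \<longrightarrow> y \<in> X k" for k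
  proof -
    have "open (X k)" using X(2)[of k] by (simp only: open_openin)
    moreover have "P k \<in> X k" using X(1) by (rule PiE_mem) simp
    ultimately show ?thesis unfolding open_dist dist_real_def by blast
  qed
  then obtain e where e: "\<And>k. 0 < e k" "\<And>k y. \<bar>y - P k\<bar> < e k \<Longrightarrow> y \<in> X k" by metis
  define r where "r = Min (insert 1 (e ` {..<n}))"
  show ?thesis
  proof
    show "0 < r" unfolding r_def using e(1) by (subst Min_gr_iff) auto
    fix v assume v: "\<And>k. k < n \<Longrightarrow> \<bar>v k - P k\<bar> < r" "\<And>k. n \<le> k \<Longrightarrow> v k = 0"
    have "v k \<in> X k" for k
    proof (cases "k < n")
      case True
      then have "r \<le> e k" unfolding r_def by (intro Min_le) auto
      then show ?thesis using e(2)[of "v k" k] v(1)[OF True] by linarith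
    next
      case False
      then have "v k = P k" using v(2) P V(2) by auto
      then show ?thesis using e by simp
    qed
    then show "v \<in> U" using X(3) V(2) v(2) by (auto simp: PiE_iff)
  qed
qed

text \<open>\<open>\<epsilon>\<close> caps the radius of the box and thereby the distance from
  \<open>p\<close> of all solutions on the branch; this is what later keeps the ranges
  apart.\<close>

lemma branch_at_zero:
  assumes a: "0 < a" and b: "1 \<le> b" and T: "0 < T"
    and contg: "continuous_on UNIV g" and cont\<phi>: "continuous_on UNIV \<phi>" and contf: "continuous_on UNIV f"
    and perf: "\<And>t u v. f (t + T, u, v) = f (t, u, v)"
    and zero: "Phi g \<phi> p = 0" and sign: "changes_sign_at (Phi g \<phi>) p"
    and U: "openin (Euclidean_space (b + 2)) U" "P_point b \<phi> p \<in> U" "euclidean_lipschitz_on (b + 2) L U (G_map a b g \<phi>)"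
    and TL: "T < 2 * pi / L" and \<epsilon>: "0 < \<epsilon>"
  obtains l \<Gamma> where "0 < l" "connectedin (pair_topology T) \<Gamma>"
    "\<Gamma> \<subseteq> {q \<in> forced_pairs a b T g \<phi> f. \<not> trivial_pair q}" "emanates_from T \<Gamma> (0, \<lambda>_. p)"
    "{0<..l} \<subseteq> fst ` \<Gamma>" "\<And>\<mu> x t. (\<mu>, x) \<in> \<Gamma> \<Longrightarrow> \<bar>x t - p\<bar> < \<epsilon>"
    "periodic_solution a b T g \<phi> f 0 (\<lambda>_. p)"
proof -
  obtain r0 where r0: "0 < r0" "\<And>v. \<lbrakk>\<And>k. k < b + 2 \<Longrightarrow> \<bar>v k - P_point b \<phi> p k\<bar> < r0; \<And>k. b + 2 \<le> k \<Longrightarrow> v k = 0\<rbrakk> \<Longrightarrow> v \<in> U"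
    by (rule Euclidean_space_box[OF U(1,2)]) blast
  define r where "r = min r0 \<epsilon>"
  have r: "0 < r" "r \<le> r0" "r \<le> \<epsilon>" using r0 \<epsilon> by (auto simp: r_def)
  \<comment> \<open>Division by 0 yields 0, so \<open>L = 0\<close> would make the bound on the
    period read \<open>T < 0\<close>.\<close>
  have L: "0 < L"
  proof -
    have "0 \<le> L" using U(3) by (simp add: euclidean_lipschitz_on_def)
    moreover have "L \<noteq> 0" using TL T by auto
    ultimately show ?thesis by simp
  qed
  \<comment> \<open>The sign \<sigma> is 1 when \<Phi> passes from positive to negative at
    \<open>p\<close>, and -1 in the other case.\<close>
  obtain \<sigma> d where d: "0 < d" "\<And>u. p - d < u \<Longrightarrow> u < p \<Longrightarrow> 0 < \<sigma> * Phi g \<phi> u" "\<And>u. p < u \<Longrightarrow> u < p + d \<Longrightarrow> \<sigma> * Phi g \<phi> u < 0"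
  proof -
    note obt = that
    have *: thesis if ev: "\<forall>\<^sub>F u in at_left p. 0 < s * Phi g \<phi> u" "\<forall>\<^sub>F u in at_right p. s * Phi g \<phi> u < 0" for s :: real
    proof -
      obtain x y where "x < p" "\<forall>u>x. u < p \<longrightarrow> 0 < s * Phi g \<phi> u" "p < y" "\<forall>u>p. u < y \<longrightarrow> s * Phi g \<phi> u < 0"
        using ev by (auto simp: eventually_at_left_field eventually_at_right_field)
      then show thesis using obt[of "min (p - x) (y - p)" s] by auto
    qed
    show thesis
      using sign *[of 1] *[of "- 1"] by (auto simp: changes_sign_at_def)
  qed
  have "0 < r / 8" using r by simp
  then obtain d' where d': "0 < d'" "\<And>y. dist y (p, 0) < d' \<Longrightarrow> dist (\<phi> y) (\<phi> (p, 0)) < r / 8"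
    using cont\<phi> unfolding continuous_on_iff by (metis UNIV_I)
  \<comment> \<open>The bounds serve, in turn, the cutoff radius, the signs and the uniqueness of
    the zero in the interval, and the estimate for \<phi>, where |u - p| + |v| is at most 3\<delta>
    and must stay below \<open>d'\<close>.\<close>
  define \<delta> where "\<delta> = min (r / 8) (min (d / 2) (d' / 4))"
  have \<delta>: "0 < \<delta>" "\<delta> \<le> r / 8" "\<delta> < d" "4 * \<delta> \<le> d'" using r d(1) d'(1) by (auto simp: \<delta>_def)
  interpret E: delayed_equation a T b g f \<phi> p r \<delta> \<sigma> L
  proof
    show "L * T < 2 * pi" using TL L by (simp add: pos_less_divide_eq mult.commute)
    show "L2_set (\<lambda>k. G_map a b g \<phi> v k - G_map a b g \<phi> z k) {..<b + 2} \<le> L * L2_set (\<lambda>k. v k - z k) {..<b + 2}"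
      if "\<And>k. k < b + 2 \<Longrightarrow> \<bar>v k - P_point b \<phi> p k\<bar> < r" "\<And>k. b + 2 \<le> k \<Longrightarrow> v k = 0"
       "\<And>k. k < b + 2 \<Longrightarrow> \<bar>z k - P_point b \<phi> p k\<bar> < r" "\<And>k. b + 2 \<le> k \<Longrightarrow> z k = 0" for v z
    proof -
      have "v \<in> U" "z \<in> U" by (rule r0(2); use that r in force)+
      then show ?thesis using U(3) unfolding euclidean_lipschitz_on_def by blast
    qed
    show "\<sigma> * Phi g \<phi> (p + \<delta>) < 0" "0 < \<sigma> * Phi g \<phi> (p - \<delta>)" using d(2)[of "p - \<delta>"] d(3)[of "p + \<delta>"] \<delta> by auto
    show "u = p" if "\<bar>u - p\<bar> \<le> \<delta>" "Phi g \<phi> u = 0" for u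
      using d(2)[of u] d(3)[of u] that \<delta> by (cases "u < p"; cases "p < u") auto
    show "\<bar>\<phi> (u, v) - \<phi> (p, 0)\<bar> \<le> r / 8" if "\<bar>u - p\<bar> \<le> 2 * \<delta>" "\<bar>v\<bar> \<le> \<delta>" for u v
    proof -
      have "dist (u, v) (p, 0) \<le> \<bar>u - p\<bar> + \<bar>v\<bar>" using dist_Pair_le[of u v p 0] by (simp add: dist_real_def)
      also have "\<dots> < d'" using that \<delta> by linarith
      finally show ?thesis using d'(2)[of "(u, v)"] by (simp add: dist_real_def)
    qed
  qed (use a b T contg cont\<phi> contf perf r \<delta> L in auto)
  show ?thesis
  proof (rule E.branch)
    fix l \<Gamma> assume *: "0 < l" "connectedin (pair_topology T) \<Gamma>"
      "\<Gamma> \<subseteq> {q \<in> forced_pairs a b T g \<phi> f. \<not> trivial_pair q}" "emanates_from T \<Gamma> (0, \<lambda>_. p)"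
      "{0<..l} \<subseteq> fst ` \<Gamma>" "\<And>\<mu> x t. (\<mu>, x) \<in> \<Gamma> \<Longrightarrow> \<bar>x t - p\<bar> < r"
      "periodic_solution a b T g \<phi> f 0 (\<lambda>_. p)"
    have "\<bar>x t - p\<bar> < \<epsilon>" if "(\<mu>, x) \<in> \<Gamma>" for \<mu> x t using *(6)[OF that, of t] r by linarith
    with * show thesis by (intro that)
  qed
qed

text \<open>The branches consist of nontrivial pairs, so the trivial pair at \<open>p i\<close> is
  adjoined where the parameter value 0 has to be covered. Disjointness of the images is a matter of
  scale: solutions on a branch stay closer to its zero than half of the smallest gap between
  zeros.\<close>

theorem theorem6p2:
  fixes a T L :: real and b n :: nat
    and g f :: "real \<times> real \<times> real \<Rightarrow> real" and \<phi> :: "real \<times> real \<Rightarrow> real"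
    and I :: "real set" and p :: "nat \<Rightarrow> real"
  assumes "a > 0" and "b \<ge> 1" and "T > 0"
    and "continuous_on UNIV g"
    and "locally_lipschitz \<phi>"
    and "continuous_on UNIV f"
    and "\<And>t u v. f (t + T, u, v) = f (t, u, v)"
    and "open I" and "is_interval I"
    and "\<And>i. i \<in> {1..n} \<Longrightarrow> p i \<in> I"
    and "inj_on p {1..n}"
    and "\<And>i. i \<in> {1..n} \<Longrightarrow> isolated_zero (Phi g \<phi>) (p i)"
    and "\<And>i. i \<in> {1..n} \<Longrightarrow> changes_sign_at (Phi g \<phi>) (p i)"
    and "\<exists>U. openin (Euclidean_space (b + 2)) U \<and>
             (\<forall>i\<in>{1..n}. P_point b \<phi> (p i) \<in> U) \<and>
             euclidean_lipschitz_on (b + 2) L U (G_map a b g \<phi>)"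
    and "T < 2 * pi / L"
  shows "\<exists>\<Gamma> :: nat \<Rightarrow> (real \<times> (real \<Rightarrow> real)) set.
    (\<forall>i\<in>{1..n}. connectedin (pair_topology T) (\<Gamma> i) \<and>
                \<Gamma> i \<subseteq> {q \<in> forced_pairs a b T g \<phi> f. \<not> trivial_pair q} \<and>
                emanates_from T (\<Gamma> i) (0, \<lambda>_. p i)) \<and>
    (\<exists>\<mu>s>0.
      (\<forall>i\<in>{1..n}. {0..\<mu>s} \<subseteq> fst ` insert (0, \<lambda>_. p i) (\<Gamma> i)) \<and>
      (\<exists>x :: nat \<Rightarrow> real \<Rightarrow> real \<Rightarrow> real. \<forall>\<mu>\<in>{0..<\<mu>s}.
        (\<forall>i\<in>{1..n}. periodic_solution a b T g \<phi> f \<mu> (x i \<mu>) \<and>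
                    (\<mu>, x i \<mu>) \<in> insert (0, \<lambda>_. p i) (\<Gamma> i)) \<and>
        inj_on (\<lambda>i. x i \<mu>) {1..n} \<and>
        disjoint_family_on (\<lambda>i. range (x i \<mu>)) {1..n}))"
proof -
  have cont\<phi>: "continuous_on UNIV \<phi>" by (rule locally_lipschitz_continuous) fact
  obtain U where U: "openin (Euclidean_space (b + 2)) U" "\<And>i. i \<in> {1..n} \<Longrightarrow> P_point b \<phi> (p i) \<in> U"
    "euclidean_lipschitz_on (b + 2) L U (G_map a b g \<phi>)"
    using assms(14) by blast
  \<comment> \<open>Half the smallest gap, or 1 if that is less; the inserted 1 also keeps the
    minimum defined when \<open>n \<le> 1\<close>.\<close>
  define \<epsilon> where "\<epsilon> = Min (insert 1 ((\<lambda>(i, j). \<bar>p i - p j\<bar> / 2) ` {(i, j) \<in> {1..n} \<times> {1..n}. i \<noteq> j}))"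
  have fin: "finite {(i, j) \<in> {1..n} \<times> {1..n}. i \<noteq> j}"
    by (rule finite_subset[of _ "{1..n} \<times> {1..n}"]) auto
  have \<epsilon>: "0 < \<epsilon>"
    unfolding \<epsilon>_def using fin assms(11) by (subst Min_gr_iff) (auto dest: inj_onD)
  have sep: "2 * \<epsilon> \<le> \<bar>p i - p j\<bar>" if "i \<in> {1..n}" "j \<in> {1..n}" "i \<noteq> j" for i j
  proof -
    have "\<epsilon> \<le> \<bar>p i - p j\<bar> / 2"
      unfolding \<epsilon>_def by (rule Min_le) (use fin that in \<open>auto intro!: image_eqI[of _ _ "(i, j)"]\<close>)
    then show ?thesis by simp
  qed
  define Q where "Q i l \<Gamma> \<longleftrightarrow> 0 < l \<and> connectedin (pair_topology T) \<Gamma> \<and>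
      \<Gamma> \<subseteq> {q \<in> forced_pairs a b T g \<phi> f. \<not> trivial_pair q} \<and> emanates_from T \<Gamma> (0, \<lambda>_. p i) \<and>
      {0<..l} \<subseteq> fst ` \<Gamma> \<and> (\<forall>\<mu> x t. (\<mu>, x) \<in> \<Gamma> \<longrightarrow> \<bar>x t - p i\<bar> < \<epsilon>) \<and>
      periodic_solution a b T g \<phi> f 0 (\<lambda>_. p i)" for i l \<Gamma>
  have "\<exists>l \<Gamma>. Q i l \<Gamma>" if i: "i \<in> {1..n}" for i
  proof -
    have "Phi g \<phi> (p i) = 0" using assms(12)[OF i] by (simp add: isolated_zero_def)
    then show ?thesis
      unfolding Q_def
      by (rule branch_at_zero[OF assms(1-4) cont\<phi> assms(6,7) _ assms(13)[OF i] U(1) U(2)[OF i] U(3) assms(15) \<epsilon>])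
        blast
  qed
  then obtain l \<Gamma> where "\<And>i. i \<in> {1..n} \<Longrightarrow> Q i (l i) (\<Gamma> i)" by metis
  then have l: "\<And>i. i \<in> {1..n} \<Longrightarrow> 0 < l i"
    and \<Gamma>: "\<And>i. i \<in> {1..n} \<Longrightarrow> connectedin (pair_topology T) (\<Gamma> i)"
      "\<And>i. i \<in> {1..n} \<Longrightarrow> \<Gamma> i \<subseteq> {q \<in> forced_pairs a b T g \<phi> f. \<not> trivial_pair q}"
      "\<And>i. i \<in> {1..n} \<Longrightarrow> emanates_from T (\<Gamma> i) (0, \<lambda>_. p i)"
      "\<And>i. i \<in> {1..n} \<Longrightarrow> {0<..l i} \<subseteq> fst ` \<Gamma> i"
      "\<And>i \<mu> x t. i \<in> {1..n} \<Longrightarrow> (\<mu>, x) \<in> \<Gamma> i \<Longrightarrow> \<bar>x t - p i\<bar> < \<epsilon>"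
      "\<And>i. i \<in> {1..n} \<Longrightarrow> periodic_solution a b T g \<phi> f 0 (\<lambda>_. p i)"
    unfolding Q_def by blast+
  define \<mu>s where "\<mu>s = Min (insert 1 (l ` {1..n}))"
  have \<mu>s: "0 < \<mu>s" unfolding \<mu>s_def using l by (subst Min_gr_iff) auto
  have \<mu>sl: "\<mu>s \<le> l i" if "i \<in> {1..n}" for i unfolding \<mu>s_def using that by (intro Min_le) auto
  have proj: "{0..\<mu>s} \<subseteq> fst ` insert (0, \<lambda>_. p i) (\<Gamma> i)" if i: "i \<in> {1..n}" for i
  proof
    fix \<mu> assume "\<mu> \<in> {0..\<mu>s}"
    then have "\<mu> = 0 \<or> \<mu> \<in> {0<..l i}" using \<mu>sl[OF i] by auto
    then show "\<mu> \<in> fst ` insert (0, \<lambda>_. p i) (\<Gamma> i)" using \<Gamma>(4)[OF i] by auto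
  qed
  define x where "x i \<mu> = (SOME y. (\<mu>, y) \<in> insert (0, \<lambda>_. p i) (\<Gamma> i))" for i \<mu>
  have x: "(\<mu>, x i \<mu>) \<in> insert (0, \<lambda>_. p i) (\<Gamma> i)" if "i \<in> {1..n}" "\<mu> \<in> {0..<\<mu>s}" for i \<mu>
  proof -
    have "\<mu> \<in> fst ` insert (0, \<lambda>_. p i) (\<Gamma> i)" by (rule subsetD[OF proj[OF that(1)]]) (use that in simp)
    then have "\<exists>y. (\<mu>, y) \<in> insert (0, \<lambda>_. p i) (\<Gamma> i)" by force
    then show ?thesis unfolding x_def by (rule someI_ex)
  qed
  have near: "\<bar>x i \<mu> t - p i\<bar> < \<epsilon>" if i: "i \<in> {1..n}" and \<mu>: "\<mu> \<in> {0..<\<mu>s}" for i \<mu> t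
  proof (cases "(\<mu>, x i \<mu>) \<in> \<Gamma> i")
    case True
    then show ?thesis by (rule \<Gamma>(5)[OF i])
  next
    case False
    then have "x i \<mu> = (\<lambda>_. p i)" using x[OF i \<mu>] by blast
    then show ?thesis using \<epsilon> by simp
  qed
  have sol: "periodic_solution a b T g \<phi> f \<mu> (x i \<mu>)" if i: "i \<in> {1..n}" and \<mu>: "\<mu> \<in> {0..<\<mu>s}" for i \<mu>
  proof (cases "(\<mu>, x i \<mu>) \<in> \<Gamma> i")
    case True
    then have "(\<mu>, x i \<mu>) \<in> forced_pairs a b T g \<phi> f" using \<Gamma>(2)[OF i] by blast
    then show ?thesis by (simp add: forced_pairs_def)
  next
    case False
    then have "\<mu> = 0" "x i \<mu> = (\<lambda>_. p i)" using x[OF i \<mu>] by blast+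
    then show ?thesis using \<Gamma>(6)[OF i] by simp
  qed
  have disj: "range (x i \<mu>) \<inter> range (x j \<mu>) = {}"
    if "i \<in> {1..n}" "j \<in> {1..n}" "i \<noteq> j" "\<mu> \<in> {0..<\<mu>s}" for i j \<mu>
  proof -
    have "x i \<mu> s \<noteq> x j \<mu> t" for s t
      using near[OF that(1,4), of s] near[OF that(2,4), of t] sep[OF that(1-3)] by linarith
    then show ?thesis by auto
  qed
  have inj: "inj_on (\<lambda>i. x i \<mu>) {1..n}" if "\<mu> \<in> {0..<\<mu>s}" for \<mu>
  proof (rule inj_onI, rule ccontr)
    fix i j assume "i \<in> {1..n}" "j \<in> {1..n}" "x i \<mu> = x j \<mu>" "i \<noteq> j"
    then show False using disj[of i j \<mu>] that by auto
  qed
  have "disjoint_family_on (\<lambda>i. range (x i \<mu>)) {1..n}" if "\<mu> \<in> {0..<\<mu>s}" for \<mu>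
    using disj that by (auto simp: disjoint_family_on_def)
  then show ?thesis
    using \<Gamma>(1-3) proj sol x inj \<mu>s
    by (intro exI[of _ \<Gamma>] conjI exI[of _ \<mu>s] exI[of _ x] ballI) simp_all
qed

end
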